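(* The adjunctions $L_{\mathrm{Sq}}\dashv\mathrm{Sq}$ and $\mathrm{Sq}\dashv\mathbf R$ with $\mathrm{Sq}\colon\mathrm{2Cat}_{\mathrm{ladj}}\to\mathrm{DblCat}_{\mathrm{tr,ladj}}$, and likewise the adjunctions $L_{\mathrm{Sq}}\dashv\mathrm{Sq}$ and $\mathrm{Sq}\dashv\mathbf R$ with $\mathrm{Sq}\colon\mathrm{2Cat}_{\mathrm{adj}}\to\mathrm{DblCat}_{\mathrm{tr,adj}}$, are Quillen equivalences.
   Context: **Double categories.** All double categories are small and strict (internal categories in $\mathrm{Cat}$): they have objects, horizontal morphisms, vertical morphisms, and squares, each square having a top and a bottom horizontal morphism and a left and a right vertical morphism. $\mathrm{DblCat}$ is the category of double categories and double functors, $\mathrm{2Cat}$ that of 2-categories and 2-functors. $\alpha\vert\beta$ is the horizontal composite ($\alpha$ to the left of $\beta$), $\frac{\alpha}{\beta}$ the vertical composite ($\alpha$ above $\beta$); $e_f$ is the vertical identity square at a horizontal morphism $f$, $\mathrm{id}_u$ the horizontal identity square at a vertical morphism $u$. A double functor is a *canonical trivial fibration* if it is surjective on objects, full on horizontal and on vertical morphisms, and fully faithful on squares (bijective on squares with any given boundary in the source). **Companions and conjoints.** A *companion pair* $(f,u,\varphi,\psi)$ consists of a horizontal morphism $f\colon A\to B$, a vertical morphism $u$ from $A$ to $B$, a square $\varphi$ with top $f$, left $u$, bottom and right identities at $B$, and a square $\psi$ with top and left identities at $A$, bottom $f$, right $u$, such that $\psi\vert\varphi=e_f$ and $\frac{\psi}{\varphi}=\mathrm{id}_u$.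 A *conjoint pair* $(f,u,\varphi,\psi)$ consists of a horizontal morphism $f\colon A\to B$, a vertical morphism $u$ from $B$ to $A$, a square $\varphi$ with top and right identities at $B$, left $u$, bottom $f$, and a square $\psi$ with left and bottom identities at $A$, top $f$, right $u$, such that $\psi\vert\varphi=e_f$ and $\frac{\varphi}{\psi}=\mathrm{id}_u$. A horizontal or vertical morphism has a companion (conjoint) if it is part of a companion (conjoint) pair. **Functors.** For a 2-category $\mathcal A$, $\mathrm{Sq}\mathcal A$ has the objects of $\mathcal A$, morphisms of $\mathcal A$ as both horizontal and vertical morphisms, and as squares with top $f$, bottom $f'$, left $u$, right $v$ the 2-morphisms $vf\Rightarrow f'u$. The functor $\mathrm{Sq}\colon\mathrm{2Cat}\to\mathrm{DblCat}$ has a left adjoint $L_{\mathrm{Sq}}$ and a right adjoint $\mathbf R$, where $\mathbf R\mathbb A$ has the objects of $\mathbb A$, companion pairs as morphisms, and as 2-morphisms $(f,u,\varphi,\psi)\Rightarrow(f',u',\varphi',\psi')$ the squares with top $f$, bottom $f'$ and identity left and right sides. **Model structures.** $\mathrm{DblCat}_{\mathrm{tr,ladj}}$ (resp. $\mathrm{DblCat}_{\mathrm{tr,adj}}$) is the (existing, unique, cofibrantly generated) model structure on $\mathrm{DblCat}$ whose trivial fibrations are the canonical ones and whose fibrant objects are the double categories in which every horizontal morphism has both a companion and a conjoint and every vertical morphism has a companion (resp. every horizontal and every vertical morphism has both a companion and a conjoint). $\mathrm{2Cat}_{\mathrm{ladj}}$ and $\mathrm{2Cat}_{\mathrm{adj}}$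 denote the model structures on $\mathrm{2Cat}$ right-transferred along $\mathrm{Sq}$ from $\mathrm{DblCat}_{\mathrm{tr,ladj}}$ and $\mathrm{DblCat}_{\mathrm{tr,adj}}$ respectively, i.e. a 2-functor $F$ is a weak equivalence (resp. fibration) iff $\mathrm{Sq}F$ is; these transferred model structures exist. Equivalently, they are the left Bousfield localizations of Lack's model structure on $\mathrm{2Cat}$ (weak equivalences the biequivalences) at $\{r\colon\mathbf 2\to\mathrm{Adj}\}$ and at $\{r,\ell\colon\mathbf 2\to\mathrm{Adj}\}$ respectively, where $\mathbf 2$ is the free category on a morphism and $\mathrm{Adj}$ is the free 2-category on an adjunction $\ell\dashv r$. *)

theory Defs
  imports Main "HOL-Library.FuncSet"
begin

unbundle cardinal_syntax

section \<open>Categories, adjunctions and model structures\<close>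

text \<open>Composition is written in applicative order: \<open>Cm C g f\<close> is \<open>g\<close> after \<open>f\<close>.
  Only the values of the operations on the carriers matter.\<close>

record ('o, 'a) cat =
  Ob :: "'o set"
  Ar :: "'a set"
  Dm :: "'a \<Rightarrow> 'o"
  Cd :: "'a \<Rightarrow> 'o"
  Idt :: "'o \<Rightarrow> 'a"
  Cm :: "'a \<Rightarrow> 'a \<Rightarrow> 'a"

locale category =
  fixes C :: "('o, 'a) cat"
  assumes Dm_in: "f \<in> Ar C \<Longrightarrow> Dm C f \<in> Ob C"
    and Cd_in: "f \<in> Ar C \<Longrightarrow> Cd C f \<in> Ob C"
    and Idt_in: "x \<in> Ob C \<Longrightarrow> Idt C x \<in> Ar C"
    and Dm_Idt: "x \<in> Ob C \<Longrightarrow> Dm C (Idt C x) = x"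
    and Cd_Idt: "x \<in> Ob C \<Longrightarrow> Cd C (Idt C x) = x"
    and Cm_in: "\<lbrakk>f \<in> Ar C; g \<in> Ar C; Cd C f = Dm C g\<rbrakk> \<Longrightarrow> Cm C g f \<in> Ar C"
    and Dm_Cm: "\<lbrakk>f \<in> Ar C; g \<in> Ar C; Cd C f = Dm C g\<rbrakk> \<Longrightarrow> Dm C (Cm C g f) = Dm C f"
    and Cd_Cm: "\<lbrakk>f \<in> Ar C; g \<in> Ar C; Cd C f = Dm C g\<rbrakk> \<Longrightarrow> Cd C (Cm C g f) = Cd C g"
    and Cm_Idt: "f \<in> Ar C \<Longrightarrow> Cm C f (Idt C (Dm C f)) = f"
    and Idt_Cm: "f \<in> Ar C \<Longrightarrow> Cm C (Idt C (Cd C f)) f = f"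
    and Cm_assoc: "\<lbrakk>f \<in> Ar C; g \<in> Ar C; h \<in> Ar C; Cd C f = Dm C g; Cd C g = Dm C h\<rbrakk>
      \<Longrightarrow> Cm C h (Cm C g f) = Cm C (Cm C h g) f"

definition hom :: "('o, 'a) cat \<Rightarrow> 'o \<Rightarrow> 'o \<Rightarrow> 'a set" where
  "hom C x y = {f \<in> Ar C. Dm C f = x \<and> Cd C f = y}"

definition initial_object :: "('o, 'a) cat \<Rightarrow> 'o \<Rightarrow> bool" where
  "initial_object C i \<longleftrightarrow> i \<in> Ob C \<and> (\<forall>x\<in>Ob C. \<exists>!f. f \<in> hom C i x)"

definition terminal_object :: "('o, 'a) cat \<Rightarrow> 'o \<Rightarrow> bool" where
  "terminal_object C t \<longleftrightarrow> t \<in> Ob C \<and> (\<forall>x\<in>Ob C. \<exists>!f. f \<in> hom C x t)"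

locale is_functor = dom: category C + cod: category D
  for C :: "('o, 'a) cat" and D :: "('p, 'b) cat" +
  fixes Fo :: "'o \<Rightarrow> 'p" and Fa :: "'a \<Rightarrow> 'b"
  assumes Fo_in: "x \<in> Ob C \<Longrightarrow> Fo x \<in> Ob D"
    and Fa_in: "f \<in> Ar C \<Longrightarrow> Fa f \<in> Ar D"
    and Fa_Dm: "f \<in> Ar C \<Longrightarrow> Dm D (Fa f) = Fo (Dm C f)"
    and Fa_Cd: "f \<in> Ar C \<Longrightarrow> Cd D (Fa f) = Fo (Cd C f)"
    and Fa_Idt: "x \<in> Ob C \<Longrightarrow> Fa (Idt C x) = Idt D (Fo x)"
    and Fa_Cm: "\<lbrakk>f \<in> Ar C; g \<in> Ar C; Cd C f = Dm C g\<rbrakk>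
      \<Longrightarrow> Fa (Cm C g f) = Cm D (Fa g) (Fa f)"

text \<open>An adjunction with left adjoint \<open>(Lo, La) : C \<rightarrow> D\<close> and right adjoint
  \<open>(Ro, Ra) : D \<rightarrow> C\<close>, given by its unit \<open>\<eta>\<close>. The transpose of \<open>g : L x \<rightarrow> y\<close> is
  \<open>R g \<circ> \<eta> x\<close>.\<close>

locale adjunction =
  left: is_functor C D Lo La + right: is_functor D C Ro Ra
  for C :: "('o, 'a) cat" and D :: "('p, 'b) cat"
    and Lo :: "'o \<Rightarrow> 'p" and La :: "'a \<Rightarrow> 'b" and Ro :: "'p \<Rightarrow> 'o" and Ra :: "'b \<Rightarrow> 'a" +
  fixes \<eta> :: "'o \<Rightarrow> 'a"
  assumes unit_in: "x \<in> Ob C \<Longrightarrow> \<eta> x \<in> hom C x (Ro (Lo x))"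
    and unit_natural: "f \<in> Ar C \<Longrightarrow> Cm C (Ra (La f)) (\<eta> (Dm C f)) = Cm C (\<eta> (Cd C f)) f"
    and unit_universal: "\<lbrakk>x \<in> Ob C; y \<in> Ob D; f \<in> hom C x (Ro y)\<rbrakk>
      \<Longrightarrow> \<exists>!g. g \<in> hom D (Lo x) y \<and> Cm C (Ra g) (\<eta> x) = f"

definition is_retract :: "('o, 'a) cat \<Rightarrow> 'a \<Rightarrow> 'a \<Rightarrow> bool" where
  "is_retract C f g \<longleftrightarrow> f \<in> Ar C \<and> g \<in> Ar C \<and>
    (\<exists>i\<in>hom C (Dm C f) (Dm C g). \<exists>r\<in>hom C (Dm C g) (Dm C f).
     \<exists>j\<in>hom C (Cd C f) (Cd C g). \<exists>s\<in>hom C (Cd C g) (Cd C f).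
      Cm C r i = Idt C (Dm C f) \<and> Cm C s j = Idt C (Cd C f) \<and>
      Cm C g i = Cm C j f \<and> Cm C f r = Cm C s g)"

definition has_lifting :: "('o, 'a) cat \<Rightarrow> 'a \<Rightarrow> 'a \<Rightarrow> bool" where
  "has_lifting C i p \<longleftrightarrow>
    (\<forall>a\<in>hom C (Dm C i) (Dm C p). \<forall>b\<in>hom C (Cd C i) (Cd C p). Cm C p a = Cm C b i \<longrightarrow>
      (\<exists>l\<in>hom C (Cd C i) (Dm C p). Cm C l i = a \<and> Cm C p l = b))"

record 'a model =
  WE :: "'a set"
  Cof :: "'a set"
  Fib :: "'a set"

locale model_structure = category C
  for C :: "('o, 'a) cat" +
  fixes M :: "'a model"
  assumes WE_sub: "WE M \<subseteq> Ar C" and Cof_sub: "Cof M \<subseteq> Ar C" and Fib_sub: "Fib M \<subseteq> Ar C"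
    and two_of_three: "\<lbrakk>f \<in> Ar C; g \<in> Ar C; Cd C f = Dm C g\<rbrakk> \<Longrightarrow>
      (f \<in> WE M \<and> g \<in> WE M \<longrightarrow> Cm C g f \<in> WE M) \<and>
      (f \<in> WE M \<and> Cm C g f \<in> WE M \<longrightarrow> g \<in> WE M) \<and>
      (g \<in> WE M \<and> Cm C g f \<in> WE M \<longrightarrow> f \<in> WE M)"
    and retract_WE: "\<lbrakk>is_retract C f g; g \<in> WE M\<rbrakk> \<Longrightarrow> f \<in> WE M"
    and retract_Cof: "\<lbrakk>is_retract C f g; g \<in> Cof M\<rbrakk> \<Longrightarrow> f \<in> Cof M"
    and retract_Fib: "\<lbrakk>is_retract C f g; g \<in> Fib M\<rbrakk> \<Longrightarrow> f \<in> Fib M"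
    and lift_Cof: "\<lbrakk>i \<in> Cof M; p \<in> Fib M \<inter> WE M\<rbrakk> \<Longrightarrow> has_lifting C i p"
    and lift_triv_Cof: "\<lbrakk>i \<in> Cof M \<inter> WE M; p \<in> Fib M\<rbrakk> \<Longrightarrow> has_lifting C i p"
    and factor_Cof: "f \<in> Ar C \<Longrightarrow>
      \<exists>i\<in>Cof M. \<exists>p\<in>Fib M \<inter> WE M. Cd C i = Dm C p \<and> Cm C p i = f"
    and factor_triv_Cof: "f \<in> Ar C \<Longrightarrow>
      \<exists>i\<in>Cof M \<inter> WE M. \<exists>p\<in>Fib M. Cd C i = Dm C p \<and> Cm C p i = f"

definition cofibrant :: "('o, 'a) cat \<Rightarrow> 'a model \<Rightarrow> 'o \<Rightarrow> bool" where
  "cofibrant C M x \<longleftrightarrow> x \<in> Ob C \<and> (\<exists>i. initial_object C i \<and> hom C i x \<inter> Cof M \<noteq> {})"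

definition fibrant :: "('o, 'a) cat \<Rightarrow> 'a model \<Rightarrow> 'o \<Rightarrow> bool" where
  "fibrant C M x \<longleftrightarrow> x \<in> Ob C \<and> (\<exists>t. terminal_object C t \<and> hom C x t \<inter> Fib M \<noteq> {})"

locale quillen_adjunction =
  adjunction C D Lo La Ro Ra \<eta> + MC: model_structure C M + MD: model_structure D N
  for C :: "('o, 'a) cat" and M and D :: "('p, 'b) cat" and N and Lo La Ro Ra \<eta> +
  assumes left_Cof: "f \<in> Cof M \<Longrightarrow> La f \<in> Cof N"
    and left_triv_Cof: "f \<in> Cof M \<inter> WE M \<Longrightarrow> La f \<in> Cof N \<inter> WE N"

locale quillen_equivalence =
  quillen_adjunction C M D N Lo La Ro Ra \<eta>
  for C :: "('o, 'a) cat" and M and D :: "('p, 'b) cat" and N and Lo La Ro Ra \<eta> +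
  assumes transpose_WE: "\<lbrakk>cofibrant C M x; fibrant D N y; g \<in> hom D (Lo x) y\<rbrakk>
    \<Longrightarrow> g \<in> WE N \<longleftrightarrow> Cm C (Ra g) (\<eta> x) \<in> WE M"

text \<open>The model structure \<open>N\<close> on \<open>D\<close> is right-transferred from \<open>M\<close> along a functor
  with arrow map \<open>Ra\<close>; its cofibrations are then determined by lifting.\<close>

definition right_transferred ::
  "'a model \<Rightarrow> ('p, 'b) cat \<Rightarrow> ('b \<Rightarrow> 'a) \<Rightarrow> 'b model \<Rightarrow> bool" where
  "right_transferred M D Ra N \<longleftrightarrow> model_structure D N \<and>
    WE N = {f \<in> Ar D. Ra f \<in> WE M} \<and> Fib N = {f \<in> Ar D. Ra f \<in> Fib M}"


section \<open>Smallness\<close>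

text \<open>All cells are elements of a type \<open>'u\<close>, and a set of cells is small if its cardinality
  is less than a fixed uncountable regular cardinal \<open>\<kappa>\<close> on \<open>'u\<close>. For \<open>\<kappa>\<close> strongly
  inaccessible this is smallness with respect to a Grothendieck universe (up to replacing sets
  by equipotent ones); the strong limit property is not needed.\<close>

definition universe :: "'u rel \<Rightarrow> bool" where
  "universe \<kappa> \<longleftrightarrow> Card_order \<kappa> \<and> natLeq <o \<kappa> \<and> regularCard \<kappa>"

definition small :: "'u rel \<Rightarrow> 'u set \<Rightarrow> bool" where
  "small \<kappa> X \<longleftrightarrow> |X| <o \<kappa>"

text \<open>Tuples of cells are used as cells again through a coding. Both functions are meant only
  for types \<open>'a\<close> that embed into \<open>'u\<close>, such as finite powers of an infinite \<open>'u\<close>;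
  an injection then exists and \<open>dec (enc x) = x\<close>.\<close>

definition enc :: "'a \<Rightarrow> 'u" where
  "enc = (SOME e. inj e)"

definition dec :: "'u \<Rightarrow> 'a" where
  "dec = inv enc"


section \<open>Double categories\<close>

text \<open>The squares form the arrows of two categories: \<open>HSq\<close> has vertical morphisms as objects
  and horizontal composition, \<open>VSq\<close> has horizontal morphisms as objects and vertical
  composition. So a square \<open>s\<close> has left and right sides \<open>Dm HSq s\<close>, \<open>Cd HSq s\<close>, and top and
  bottom \<open>Dm VSq s\<close>, \<open>Cd VSq s\<close>; \<open>Cm HSq t s\<close> is \<open>s\<close> to the left of \<open>t\<close>, and \<open>Cm VSq t s\<close>
  is \<open>s\<close> above \<open>t\<close>.\<close>

record 'u dblcat =
  Hor :: "('u, 'u) cat"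
  Ver :: "('u, 'u) cat"
  HSq :: "('u, 'u) cat"
  VSq :: "('u, 'u) cat"

locale double_category =
  hor: category "Hor A" + ver: category "Ver A" + hsq: category "HSq A" + vsq: category "VSq A"
  for A :: "'u dblcat" +
  assumes Ob_Ver: "Ob (Ver A) = Ob (Hor A)"
    and Ob_HSq: "Ob (HSq A) = Ar (Ver A)"
    and Ob_VSq: "Ob (VSq A) = Ar (Hor A)"
    and Ar_VSq: "Ar (VSq A) = Ar (HSq A)"
    and corner_tl: "s \<in> Ar (HSq A) \<Longrightarrow> Dm (Ver A) (Dm (HSq A) s) = Dm (Hor A) (Dm (VSq A) s)"
    and corner_tr: "s \<in> Ar (HSq A) \<Longrightarrow> Dm (Ver A) (Cd (HSq A) s) = Cd (Hor A) (Dm (VSq A) s)"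
    and corner_bl: "s \<in> Ar (HSq A) \<Longrightarrow> Cd (Ver A) (Dm (HSq A) s) = Dm (Hor A) (Cd (VSq A) s)"
    and corner_br: "s \<in> Ar (HSq A) \<Longrightarrow> Cd (Ver A) (Cd (HSq A) s) = Cd (Hor A) (Cd (VSq A) s)"
    and top_Cm: "\<lbrakk>s \<in> Ar (HSq A); t \<in> Ar (HSq A); Cd (HSq A) s = Dm (HSq A) t\<rbrakk>
      \<Longrightarrow> Dm (VSq A) (Cm (HSq A) t s) = Cm (Hor A) (Dm (VSq A) t) (Dm (VSq A) s)"
    and bottom_Cm: "\<lbrakk>s \<in> Ar (HSq A); t \<in> Ar (HSq A); Cd (HSq A) s = Dm (HSq A) t\<rbrakk>
      \<Longrightarrow> Cd (VSq A) (Cm (HSq A) t s) = Cm (Hor A) (Cd (VSq A) t) (Cd (VSq A) s)"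
    and left_Cm: "\<lbrakk>s \<in> Ar (HSq A); t \<in> Ar (HSq A); Cd (VSq A) s = Dm (VSq A) t\<rbrakk>
      \<Longrightarrow> Dm (HSq A) (Cm (VSq A) t s) = Cm (Ver A) (Dm (HSq A) t) (Dm (HSq A) s)"
    and right_Cm: "\<lbrakk>s \<in> Ar (HSq A); t \<in> Ar (HSq A); Cd (VSq A) s = Dm (VSq A) t\<rbrakk>
      \<Longrightarrow> Cd (HSq A) (Cm (VSq A) t s) = Cm (Ver A) (Cd (HSq A) t) (Cd (HSq A) s)"
    and top_Idt: "u \<in> Ar (Ver A) \<Longrightarrow> Dm (VSq A) (Idt (HSq A) u) = Idt (Hor A) (Dm (Ver A) u)"
    and bottom_Idt: "u \<in> Ar (Ver A) \<Longrightarrow> Cd (VSq A) (Idt (HSq A) u) = Idt (Hor A) (Cd (Ver A) u)"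
    and left_Idt: "f \<in> Ar (Hor A) \<Longrightarrow> Dm (HSq A) (Idt (VSq A) f) = Idt (Ver A) (Dm (Hor A) f)"
    and right_Idt: "f \<in> Ar (Hor A) \<Longrightarrow> Cd (HSq A) (Idt (VSq A) f) = Idt (Ver A) (Cd (Hor A) f)"
    and Idt_Cm_Ver: "\<lbrakk>u \<in> Ar (Ver A); v \<in> Ar (Ver A); Cd (Ver A) u = Dm (Ver A) v\<rbrakk>
      \<Longrightarrow> Idt (HSq A) (Cm (Ver A) v u) = Cm (VSq A) (Idt (HSq A) v) (Idt (HSq A) u)"
    and Idt_Cm_Hor: "\<lbrakk>f \<in> Ar (Hor A); g \<in> Ar (Hor A); Cd (Hor A) f = Dm (Hor A) g\<rbrakk>
      \<Longrightarrow> Idt (VSq A) (Cm (Hor A) g f) = Cm (HSq A) (Idt (VSq A) g) (Idt (VSq A) f)"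
    and Idt_Idt: "x \<in> Ob (Hor A) \<Longrightarrow> Idt (HSq A) (Idt (Ver A) x) = Idt (VSq A) (Idt (Hor A) x)"
    and interchange: "\<lbrakk>s \<in> Ar (HSq A); t \<in> Ar (HSq A); s' \<in> Ar (HSq A); t' \<in> Ar (HSq A);
        Cd (HSq A) s = Dm (HSq A) t; Cd (HSq A) s' = Dm (HSq A) t';
        Cd (VSq A) s = Dm (VSq A) s'; Cd (VSq A) t = Dm (VSq A) t'\<rbrakk>
      \<Longrightarrow> Cm (VSq A) (Cm (HSq A) t' s') (Cm (HSq A) t s)
        = Cm (HSq A) (Cm (VSq A) t' t) (Cm (VSq A) s' s)"

text \<open>\<open>squares A f f' u v\<close>: the squares with top \<open>f\<close>, bottom \<open>f'\<close>, left \<open>u\<close> and right \<open>v\<close>.\<close>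

definition squares :: "'u dblcat \<Rightarrow> 'u \<Rightarrow> 'u \<Rightarrow> 'u \<Rightarrow> 'u \<Rightarrow> 'u set" where
  "squares A f f' u v = {s \<in> Ar (HSq A).
    Dm (VSq A) s = f \<and> Cd (VSq A) s = f' \<and> Dm (HSq A) s = u \<and> Cd (HSq A) s = v}"

definition companion_pair :: "'u dblcat \<Rightarrow> 'u \<Rightarrow> 'u \<Rightarrow> 'u \<Rightarrow> 'u \<Rightarrow> bool" where
  "companion_pair A f u \<phi> \<psi> \<longleftrightarrow> (\<exists>a b.
    f \<in> hom (Hor A) a b \<and> u \<in> hom (Ver A) a b \<and>
    \<phi> \<in> squares A f (Idt (Hor A) b) u (Idt (Ver A) b) \<and>
    \<psi> \<in> squares A (Idt (Hor A) a) f (Idt (Ver A) a) u \<and>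
    Cm (HSq A) \<phi> \<psi> = Idt (VSq A) f \<and> Cm (VSq A) \<phi> \<psi> = Idt (HSq A) u)"

definition conjoint_pair :: "'u dblcat \<Rightarrow> 'u \<Rightarrow> 'u \<Rightarrow> 'u \<Rightarrow> 'u \<Rightarrow> bool" where
  "conjoint_pair A f u \<phi> \<psi> \<longleftrightarrow> (\<exists>a b.
    f \<in> hom (Hor A) a b \<and> u \<in> hom (Ver A) b a \<and>
    \<phi> \<in> squares A (Idt (Hor A) b) f u (Idt (Ver A) b) \<and>
    \<psi> \<in> squares A f (Idt (Hor A) a) (Idt (Ver A) a) u \<and>
    Cm (HSq A) \<phi> \<psi> = Idt (VSq A) f \<and> Cm (VSq A) \<psi> \<phi> = Idt (HSq A) u)"

definition hor_has_companion :: "'u dblcat \<Rightarrow> 'u \<Rightarrow> bool" where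
  "hor_has_companion A f \<longleftrightarrow> (\<exists>u \<phi> \<psi>. companion_pair A f u \<phi> \<psi>)"

definition ver_has_companion :: "'u dblcat \<Rightarrow> 'u \<Rightarrow> bool" where
  "ver_has_companion A u \<longleftrightarrow> (\<exists>f \<phi> \<psi>. companion_pair A f u \<phi> \<psi>)"

definition hor_has_conjoint :: "'u dblcat \<Rightarrow> 'u \<Rightarrow> bool" where
  "hor_has_conjoint A f \<longleftrightarrow> (\<exists>u \<phi> \<psi>. conjoint_pair A f u \<phi> \<psi>)"

definition ver_has_conjoint :: "'u dblcat \<Rightarrow> 'u \<Rightarrow> bool" where
  "ver_has_conjoint A u \<longleftrightarrow> (\<exists>f \<phi> \<psi>. conjoint_pair A f u \<phi> \<psi>)"

record 'u dblfun =
  dsrc :: "'u dblcat"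
  dtgt :: "'u dblcat"
  dfo :: "'u \<Rightarrow> 'u"
  dfh :: "'u \<Rightarrow> 'u"
  dfv :: "'u \<Rightarrow> 'u"
  dfs :: "'u \<Rightarrow> 'u"

text \<open>The component maps are \<open>undefined\<close> off the carriers, so that double functors are equal
  iff they agree on all cells.\<close>

definition double_functor :: "'u dblfun \<Rightarrow> bool" where
  "double_functor F \<longleftrightarrow> double_category (dsrc F) \<and> double_category (dtgt F) \<and>
    is_functor (Hor (dsrc F)) (Hor (dtgt F)) (dfo F) (dfh F) \<and>
    is_functor (Ver (dsrc F)) (Ver (dtgt F)) (dfo F) (dfv F) \<and>
    is_functor (HSq (dsrc F)) (HSq (dtgt F)) (dfv F) (dfs F) \<and>
    is_functor (VSq (dsrc F)) (VSq (dtgt F)) (dfh F) (dfs F) \<and>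
    dfo F \<in> extensional (Ob (Hor (dsrc F))) \<and>
    dfh F \<in> extensional (Ar (Hor (dsrc F))) \<and>
    dfv F \<in> extensional (Ar (Ver (dsrc F))) \<and>
    dfs F \<in> extensional (Ar (HSq (dsrc F)))"

definition small_double_category :: "'u rel \<Rightarrow> 'u dblcat \<Rightarrow> bool" where
  "small_double_category \<kappa> A \<longleftrightarrow> double_category A \<and> small \<kappa> (Ob (Hor A)) \<and>
    small \<kappa> (Ar (Hor A)) \<and> small \<kappa> (Ar (Ver A)) \<and> small \<kappa> (Ar (HSq A))"

definition DblCat :: "'u rel \<Rightarrow> ('u dblcat, 'u dblfun) cat" where
  "DblCat \<kappa> = \<lparr>
    Ob = {A. small_double_category \<kappa> A},
    Ar = {F. double_functor F \<and>
      small_double_category \<kappa> (dsrc F) \<and> small_double_category \<kappa> (dtgt F)},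
    Dm = dsrc,
    Cd = dtgt,
    Idt = (\<lambda>A. \<lparr>dsrc = A, dtgt = A,
      dfo = restrict id (Ob (Hor A)), dfh = restrict id (Ar (Hor A)),
      dfv = restrict id (Ar (Ver A)), dfs = restrict id (Ar (HSq A))\<rparr>),
    Cm = (\<lambda>G F. \<lparr>dsrc = dsrc F, dtgt = dtgt G,
      dfo = compose (Ob (Hor (dsrc F))) (dfo G) (dfo F),
      dfh = compose (Ar (Hor (dsrc F))) (dfh G) (dfh F),
      dfv = compose (Ar (Ver (dsrc F))) (dfv G) (dfv F),
      dfs = compose (Ar (HSq (dsrc F))) (dfs G) (dfs F)\<rparr>)\<rparr>"

definition canonical_trivial_fibration :: "'u dblfun \<Rightarrow> bool" where
  "canonical_trivial_fibration F \<longleftrightarrow> (let A = dsrc F; B = dtgt F in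
    double_functor F \<and>
    dfo F ` Ob (Hor A) = Ob (Hor B) \<and>
    (\<forall>a\<in>Ob (Hor A). \<forall>b\<in>Ob (Hor A).
      dfh F ` hom (Hor A) a b = hom (Hor B) (dfo F a) (dfo F b) \<and>
      dfv F ` hom (Ver A) a b = hom (Ver B) (dfo F a) (dfo F b)) \<and>
    (\<forall>a b c d. \<forall>f\<in>hom (Hor A) a b. \<forall>f'\<in>hom (Hor A) c d.
     \<forall>u\<in>hom (Ver A) a c. \<forall>v\<in>hom (Ver A) b d.
      bij_betw (dfs F) (squares A f f' u v)
        (squares B (dfh F f) (dfh F f') (dfv F u) (dfv F v))))"


section \<open>2-categories\<close>

text \<open>\<open>One\<close> is the underlying category, \<open>VTwo\<close> has morphisms as objects and 2-morphisms as
  arrows under vertical composition, \<open>HTwo\<close> has the same objects as \<open>One\<close> and 2-morphisms as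
  arrows under horizontal composition.\<close>

record 'u twocat =
  One :: "('u, 'u) cat"
  VTwo :: "('u, 'u) cat"
  HTwo :: "('u, 'u) cat"

locale two_category =
  one: category "One A" + vtwo: category "VTwo A" + htwo: category "HTwo A"
  for A :: "'u twocat" +
  assumes Ob_HTwo: "Ob (HTwo A) = Ob (One A)"
    and Ob_VTwo: "Ob (VTwo A) = Ar (One A)"
    and Ar_HTwo: "Ar (HTwo A) = Ar (VTwo A)"
    and Dm_Dm: "\<alpha> \<in> Ar (VTwo A) \<Longrightarrow> Dm (One A) (Dm (VTwo A) \<alpha>) = Dm (HTwo A) \<alpha>"
    and Dm_Cd: "\<alpha> \<in> Ar (VTwo A) \<Longrightarrow> Dm (One A) (Cd (VTwo A) \<alpha>) = Dm (HTwo A) \<alpha>"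
    and Cd_Dm: "\<alpha> \<in> Ar (VTwo A) \<Longrightarrow> Cd (One A) (Dm (VTwo A) \<alpha>) = Cd (HTwo A) \<alpha>"
    and Cd_Cd: "\<alpha> \<in> Ar (VTwo A) \<Longrightarrow> Cd (One A) (Cd (VTwo A) \<alpha>) = Cd (HTwo A) \<alpha>"
    and Dm_Cm_HTwo: "\<lbrakk>\<alpha> \<in> Ar (VTwo A); \<beta> \<in> Ar (VTwo A); Cd (HTwo A) \<alpha> = Dm (HTwo A) \<beta>\<rbrakk>
      \<Longrightarrow> Dm (VTwo A) (Cm (HTwo A) \<beta> \<alpha>) = Cm (One A) (Dm (VTwo A) \<beta>) (Dm (VTwo A) \<alpha>)"
    and Cd_Cm_HTwo: "\<lbrakk>\<alpha> \<in> Ar (VTwo A); \<beta> \<in> Ar (VTwo A); Cd (HTwo A) \<alpha> = Dm (HTwo A) \<beta>\<rbrakk>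
      \<Longrightarrow> Cd (VTwo A) (Cm (HTwo A) \<beta> \<alpha>) = Cm (One A) (Cd (VTwo A) \<beta>) (Cd (VTwo A) \<alpha>)"
    and Idt_HTwo: "x \<in> Ob (One A) \<Longrightarrow> Idt (HTwo A) x = Idt (VTwo A) (Idt (One A) x)"
    and Idt_Cm_One: "\<lbrakk>f \<in> Ar (One A); g \<in> Ar (One A); Cd (One A) f = Dm (One A) g\<rbrakk>
      \<Longrightarrow> Idt (VTwo A) (Cm (One A) g f) = Cm (HTwo A) (Idt (VTwo A) g) (Idt (VTwo A) f)"
    and interchange: "\<lbrakk>\<alpha> \<in> Ar (VTwo A); \<beta> \<in> Ar (VTwo A); \<alpha>' \<in> Ar (VTwo A); \<beta>' \<in> Ar (VTwo A);
        Cd (HTwo A) \<alpha> = Dm (HTwo A) \<beta>; Cd (HTwo A) \<alpha>' = Dm (HTwo A) \<beta>';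
        Cd (VTwo A) \<alpha> = Dm (VTwo A) \<alpha>'; Cd (VTwo A) \<beta> = Dm (VTwo A) \<beta>'\<rbrakk>
      \<Longrightarrow> Cm (VTwo A) (Cm (HTwo A) \<beta>' \<alpha>') (Cm (HTwo A) \<beta> \<alpha>)
        = Cm (HTwo A) (Cm (VTwo A) \<beta>' \<beta>) (Cm (VTwo A) \<alpha>' \<alpha>)"

record 'u twofun =
  tsrc :: "'u twocat"
  ttgt :: "'u twocat"
  tf0 :: "'u \<Rightarrow> 'u"
  tf1 :: "'u \<Rightarrow> 'u"
  tf2 :: "'u \<Rightarrow> 'u"

definition two_functor :: "'u twofun \<Rightarrow> bool" where
  "two_functor F \<longleftrightarrow> two_category (tsrc F) \<and> two_category (ttgt F) \<and>
    is_functor (One (tsrc F)) (One (ttgt F)) (tf0 F) (tf1 F) \<and>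
    is_functor (VTwo (tsrc F)) (VTwo (ttgt F)) (tf1 F) (tf2 F) \<and>
    is_functor (HTwo (tsrc F)) (HTwo (ttgt F)) (tf0 F) (tf2 F) \<and>
    tf0 F \<in> extensional (Ob (One (tsrc F))) \<and>
    tf1 F \<in> extensional (Ar (One (tsrc F))) \<and>
    tf2 F \<in> extensional (Ar (VTwo (tsrc F)))"

definition small_two_category :: "'u rel \<Rightarrow> 'u twocat \<Rightarrow> bool" where
  "small_two_category \<kappa> A \<longleftrightarrow> two_category A \<and>
    small \<kappa> (Ob (One A)) \<and> small \<kappa> (Ar (One A)) \<and> small \<kappa> (Ar (VTwo A))"

definition TwoCat :: "'u rel \<Rightarrow> ('u twocat, 'u twofun) cat" where
  "TwoCat \<kappa> = \<lparr>
    Ob = {A. small_two_category \<kappa> A},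
    Ar = {F. two_functor F \<and> small_two_category \<kappa> (tsrc F) \<and> small_two_category \<kappa> (ttgt F)},
    Dm = tsrc,
    Cd = ttgt,
    Idt = (\<lambda>A. \<lparr>tsrc = A, ttgt = A,
      tf0 = restrict id (Ob (One A)), tf1 = restrict id (Ar (One A)),
      tf2 = restrict id (Ar (VTwo A))\<rparr>),
    Cm = (\<lambda>G F. \<lparr>tsrc = tsrc F, ttgt = ttgt G,
      tf0 = compose (Ob (One (tsrc F))) (tf0 G) (tf0 F),
      tf1 = compose (Ar (One (tsrc F))) (tf1 G) (tf1 F),
      tf2 = compose (Ar (VTwo (tsrc F))) (tf2 G) (tf2 F)\<rparr>)\<rparr>"


section \<open>The functor \<open>Sq\<close>\<close>

text \<open>A square of \<open>Sq A\<close> is the code of a tuple \<open>(f, f', u, v, \<alpha>)\<close> with top \<open>f\<close>,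
  bottom \<open>f'\<close>, left \<open>u\<close>, right \<open>v\<close> and \<open>\<alpha> : v f \<Rightarrow> f' u\<close>.\<close>

type_synonym 'u sqcell = "'u \<times> 'u \<times> 'u \<times> 'u \<times> 'u"

definition Sq_cells :: "'u twocat \<Rightarrow> 'u sqcell set" where
  "Sq_cells A = {(f, f', u, v, \<alpha>). \<exists>a b c d.
    f \<in> hom (One A) a b \<and> f' \<in> hom (One A) c d \<and> u \<in> hom (One A) a c \<and> v \<in> hom (One A) b d \<and>
    \<alpha> \<in> hom (VTwo A) (Cm (One A) v f) (Cm (One A) f' u)}"

definition Sq :: "'u twocat \<Rightarrow> 'u dblcat" where
  "Sq A = \<lparr>
    Hor = One A,
    Ver = One A,
    HSq = \<lparr>
      Ob = Ar (One A),
      Ar = enc ` Sq_cells A,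
      Dm = (\<lambda>s. case (dec s :: 'u sqcell) of (f, f', u, v, \<alpha>) \<Rightarrow> u),
      Cd = (\<lambda>s. case (dec s :: 'u sqcell) of (f, f', u, v, \<alpha>) \<Rightarrow> v),
      Idt = (\<lambda>u. enc (Idt (One A) (Dm (One A) u), Idt (One A) (Cd (One A) u), u, u, Idt (VTwo A) u)),
      Cm = (\<lambda>t s. case (dec s :: 'u sqcell, dec t :: 'u sqcell) of
        ((f, f', u, v, \<alpha>), (g, g', v', w, \<beta>)) \<Rightarrow>
          enc (Cm (One A) g f, Cm (One A) g' f', u, w,
            Cm (VTwo A) (Cm (HTwo A) (Idt (VTwo A) g') \<alpha>) (Cm (HTwo A) \<beta> (Idt (VTwo A) f))))\<rparr>,
    VSq = \<lparr>
      Ob = Ar (One A),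
      Ar = enc ` Sq_cells A,
      Dm = (\<lambda>s. case (dec s :: 'u sqcell) of (f, f', u, v, \<alpha>) \<Rightarrow> f),
      Cd = (\<lambda>s. case (dec s :: 'u sqcell) of (f, f', u, v, \<alpha>) \<Rightarrow> f'),
      Idt = (\<lambda>f. enc (f, f, Idt (One A) (Dm (One A) f), Idt (One A) (Cd (One A) f), Idt (VTwo A) f)),
      Cm = (\<lambda>t s. case (dec s :: 'u sqcell, dec t :: 'u sqcell) of
        ((f, f', u, v, \<alpha>), (g, g', u', v', \<beta>)) \<Rightarrow>
          enc (f, g', Cm (One A) u' u, Cm (One A) v' v,
            Cm (VTwo A) (Cm (HTwo A) \<beta> (Idt (VTwo A) u)) (Cm (HTwo A) (Idt (VTwo A) v') \<alpha>)))\<rparr>\<rparr>"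

definition Sq_fun :: "'u twofun \<Rightarrow> 'u dblfun" where
  "Sq_fun F = \<lparr>dsrc = Sq (tsrc F), dtgt = Sq (ttgt F),
    dfo = tf0 F, dfh = tf1 F, dfv = tf1 F,
    dfs = restrict (\<lambda>s. case (dec s :: 'u sqcell) of (f, f', u, v, \<alpha>) \<Rightarrow>
        enc (tf1 F f, tf1 F f', tf1 F u, tf1 F v, tf2 F \<alpha>))
      (Ar (HSq (Sq (tsrc F))))\<rparr>"


section \<open>The right adjoint of \<open>Sq\<close>\<close>

text \<open>A morphism of \<open>RR A\<close> is the code of a companion pair, and a 2-morphism is the code of a
  triple \<open>(p, p', s)\<close>, where \<open>p\<close> and \<open>p'\<close> are (codes of) its source and target.
  Companion pairs \<open>(f, u, \<phi>, \<psi>)\<close> and \<open>(g, v, \<phi>', \<psi>')\<close> compose by pasting: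
  \<open>\<phi> | e_g\<close> above \<open>\<phi>'\<close>, and \<open>\<psi>\<close> above \<open>e_f | \<psi>'\<close>.\<close>

type_synonym 'u comp_pair = "'u \<times> 'u \<times> 'u \<times> 'u"
type_synonym 'u comp_cell = "'u \<times> 'u \<times> 'u"

definition RR_mor :: "'u dblcat \<Rightarrow> 'u comp_pair set" where
  "RR_mor A = {(f, u, \<phi>, \<psi>). companion_pair A f u \<phi> \<psi>}"

definition pair_hor :: "'u \<Rightarrow> 'u" where
  "pair_hor p = (case (dec p :: 'u comp_pair) of (f, u, \<phi>, \<psi>) \<Rightarrow> f)"

definition RR_cells :: "'u dblcat \<Rightarrow> 'u comp_cell set" where
  "RR_cells A = {(p, p', s). p \<in> enc ` RR_mor A \<and> p' \<in> enc ` RR_mor A \<and>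
    (\<exists>a b. pair_hor p \<in> hom (Hor A) a b \<and> pair_hor p' \<in> hom (Hor A) a b \<and>
      s \<in> squares A (pair_hor p) (pair_hor p') (Idt (Ver A) a) (Idt (Ver A) b))}"

definition RR_id :: "'u dblcat \<Rightarrow> 'u \<Rightarrow> 'u" where
  "RR_id A a = enc (Idt (Hor A) a, Idt (Ver A) a,
    Idt (VSq A) (Idt (Hor A) a), Idt (VSq A) (Idt (Hor A) a))"

definition RR_comp :: "'u dblcat \<Rightarrow> 'u \<Rightarrow> 'u \<Rightarrow> 'u" where
  "RR_comp A q p = (case (dec p :: 'u comp_pair, dec q :: 'u comp_pair) of
    ((f, u, \<phi>, \<psi>), (g, v, \<phi>', \<psi>')) \<Rightarrow>
      enc (Cm (Hor A) g f, Cm (Ver A) v u,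
        Cm (VSq A) \<phi>' (Cm (HSq A) (Idt (VSq A) g) \<phi>),
        Cm (VSq A) (Cm (HSq A) \<psi>' (Idt (VSq A) f)) \<psi>))"

definition RR :: "'u dblcat \<Rightarrow> 'u twocat" where
  "RR A = \<lparr>
    One = \<lparr>
      Ob = Ob (Hor A),
      Ar = enc ` RR_mor A,
      Dm = (\<lambda>p. Dm (Hor A) (pair_hor p)),
      Cd = (\<lambda>p. Cd (Hor A) (pair_hor p)),
      Idt = RR_id A,
      Cm = RR_comp A\<rparr>,
    VTwo = \<lparr>
      Ob = enc ` RR_mor A,
      Ar = enc ` RR_cells A,
      Dm = (\<lambda>c. case (dec c :: 'u comp_cell) of (p, p', s) \<Rightarrow> p),
      Cd = (\<lambda>c. case (dec c :: 'u comp_cell) of (p, p', s) \<Rightarrow> p'),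
      Idt = (\<lambda>p. enc (p, p, Idt (VSq A) (pair_hor p))),
      Cm = (\<lambda>d c. case (dec c :: 'u comp_cell, dec d :: 'u comp_cell) of
        ((p, p', s), (q, q', t)) \<Rightarrow> enc (p, q', Cm (VSq A) t s))\<rparr>,
    HTwo = \<lparr>
      Ob = Ob (Hor A),
      Ar = enc ` RR_cells A,
      Dm = (\<lambda>c. case (dec c :: 'u comp_cell) of (p, p', s) \<Rightarrow> Dm (Hor A) (pair_hor p)),
      Cd = (\<lambda>c. case (dec c :: 'u comp_cell) of (p, p', s) \<Rightarrow> Cd (Hor A) (pair_hor p)),
      Idt = (\<lambda>a. enc (RR_id A a, RR_id A a, Idt (VSq A) (Idt (Hor A) a))),
      Cm = (\<lambda>d c. case (dec c :: 'u comp_cell, dec d :: 'u comp_cell) of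
        ((p, p', s), (q, q', t)) \<Rightarrow>
          enc (RR_comp A q p, RR_comp A q' p', Cm (HSq A) t s))\<rparr>\<rparr>"

definition RR_pair_map :: "'u dblfun \<Rightarrow> 'u \<Rightarrow> 'u" where
  "RR_pair_map F p = (case (dec p :: 'u comp_pair) of (f, u, \<phi>, \<psi>) \<Rightarrow>
    enc (dfh F f, dfv F u, dfs F \<phi>, dfs F \<psi>))"

definition RR_fun :: "'u dblfun \<Rightarrow> 'u twofun" where
  "RR_fun F = \<lparr>tsrc = RR (dsrc F), ttgt = RR (dtgt F),
    tf0 = dfo F,
    tf1 = restrict (RR_pair_map F) (Ar (One (RR (dsrc F)))),
    tf2 = restrict (\<lambda>c. case (dec c :: 'u comp_cell) of (p, p', s) \<Rightarrow>
        enc (RR_pair_map F p, RR_pair_map F p', dfs F s))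
      (Ar (VTwo (RR (dsrc F))))\<rparr>"

text \<open>The unit \<open>A \<rightarrow> RR (Sq A)\<close> of the adjunction between \<open>Sq\<close> and \<open>RR\<close> sends \<open>f\<close> to the
  companion pair \<open>(f, f, id_f, id_f)\<close> of \<open>Sq A\<close>.\<close>

definition Sq_pair :: "'u twocat \<Rightarrow> 'u \<Rightarrow> 'u" where
  "Sq_pair A f = (let a = Idt (One A) (Dm (One A) f); b = Idt (One A) (Cd (One A) f) in
    enc (f, f, enc (f, b, f, b, Idt (VTwo A) f) :: 'u, enc (a, f, a, f, Idt (VTwo A) f) :: 'u))"

definition Sq_RR_unit :: "'u twocat \<Rightarrow> 'u twofun" where
  "Sq_RR_unit A = \<lparr>tsrc = A, ttgt = RR (Sq A),
    tf0 = restrict id (Ob (One A)),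
    tf1 = restrict (Sq_pair A) (Ar (One A)),
    tf2 = restrict (\<lambda>\<alpha>. let f = Dm (VTwo A) \<alpha>; f' = Cd (VTwo A) \<alpha> in
        enc (Sq_pair A f, Sq_pair A f',
          enc (f, f', Idt (One A) (Dm (One A) f), Idt (One A) (Cd (One A) f), \<alpha>) :: 'u))
      (Ar (VTwo A))\<rparr>"


section \<open>The model structures on double categories\<close>

definition is_DblCat_tr_ladj :: "'u rel \<Rightarrow> 'u dblfun model \<Rightarrow> bool" where
  "is_DblCat_tr_ladj \<kappa> M \<longleftrightarrow> model_structure (DblCat \<kappa>) M \<and>
    Fib M \<inter> WE M = {F \<in> Ar (DblCat \<kappa>). canonical_trivial_fibration F} \<and>
    (\<forall>A\<in>Ob (DblCat \<kappa>). fibrant (DblCat \<kappa>) M A \<longleftrightarrow>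
      (\<forall>f\<in>Ar (Hor A). hor_has_companion A f \<and> hor_has_conjoint A f) \<and>
      (\<forall>u\<in>Ar (Ver A). ver_has_companion A u))"

definition is_DblCat_tr_adj :: "'u rel \<Rightarrow> 'u dblfun model \<Rightarrow> bool" where
  "is_DblCat_tr_adj \<kappa> M \<longleftrightarrow> model_structure (DblCat \<kappa>) M \<and>
    Fib M \<inter> WE M = {F \<in> Ar (DblCat \<kappa>). canonical_trivial_fibration F} \<and>
    (\<forall>A\<in>Ob (DblCat \<kappa>). fibrant (DblCat \<kappa>) M A \<longleftrightarrow>
      (\<forall>f\<in>Ar (Hor A). hor_has_companion A f \<and> hor_has_conjoint A f) \<and>
      (\<forall>u\<in>Ar (Ver A). ver_has_companion A u \<and> ver_has_conjoint A u))"

definition is_TwoCat_transferred :: "'u rel \<Rightarrow> 'u dblfun model \<Rightarrow> 'u twofun model \<Rightarrow> bool" where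
  "is_TwoCat_transferred \<kappa> M N \<longleftrightarrow> right_transferred M (TwoCat \<kappa>) Sq_fun N"

end

theory Submission
  imports Defs
begin

text \<open>Write \<open>L\<close> for the left adjoint of \<open>Sq\<close>. The counit \<open>Sq (RR A) \<rightarrow> A\<close> is fully faithful on
  squares, because squares transpose along companions, and it is a canonical trivial fibration as
  soon as all horizontal and vertical morphisms of \<open>A\<close> have companions. This holds for fibrant \<open>A\<close>,
  and \<open>Sq\<close> preserves and reflects weak equivalences, so \<open>Sq\<close> and \<open>RR\<close> form a Quillen equivalence.
  It also holds for \<open>A = Sq Z\<close>, so that \<open>RR (Sq Z)\<close> is a path object for \<open>Z\<close>. Every double functor
  \<open>Sq W \<rightarrow> Sq Z\<close> is right homotopic, through \<open>Sq (RR (Sq Z))\<close>, to the image under \<open>Sq\<close> of a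
  2-functor; applied to the unit of \<open>L\<close> and \<open>Sq\<close> at \<open>Sq W\<close> this shows that the counit
  \<open>L (Sq W) \<rightarrow> W\<close> is a weak equivalence. For cofibrant \<open>X\<close>, a fibrant replacement of \<open>X\<close> lifts along
  the counit of \<open>Sq\<close> and \<open>RR\<close> to a weak equivalence \<open>X \<rightarrow> Sq Z\<close>, and Ken Brown's lemma applied to it
  shows that the unit \<open>X \<rightarrow> Sq (L X)\<close> is a weak equivalence.\<close>

section \<open>Categories and lifting\<close>

text \<open>The functor \<open>L\<close> is given only by its universal property. There is no
  formula from which \<open>L (Sq W)\<close> could be computed, so the comparison with
  \<open>W\<close> has to come from extending a homotopy along the adjunction. A double functor
  \<open>Sq W \<rightarrow> Sq Z\<close> may send a 1-cell of \<open>W\<close> to different 1-cells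
  according to whether it is taken as horizontal or as vertical. It preserves the canonical
  companion pairs, so the two values are joined by an invertible 2-cell, coherently in the 1-cell.
  The horizontal values alone form a 2-functor, and the invertible 2-cells form the homotopy;
  \<open>straighten\<close> is the universal case of this. Weak equivalences of double categories
  are explicit only among the fibrations. All others are reached by two-of-three, retracts and
  factorizations. Since \<open>model_structure\<close> provides no limits or colimits, arguments
  with coproducts or cylinders are replaced by sections and idempotents.\<close>

context category
begin

lemma homD: "f \<in> hom C x y \<Longrightarrow> f \<in> Ar C \<and> Dm C f = x \<and> Cd C f = y"
  by (simp add: hom_def)

lemma hom_obs: "f \<in> hom C x y \<Longrightarrow> x \<in> Ob C \<and> y \<in> Ob C"
  using Dm_in Cd_in by (auto simp: hom_def)

lemma Ar_hom: "f \<in> Ar C \<Longrightarrow> f \<in> hom C (Dm C f) (Cd C f)"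
  by (simp add: hom_def)

lemma Cm_hom: "\<lbrakk>f \<in> hom C x y; g \<in> hom C y z\<rbrakk> \<Longrightarrow> Cm C g f \<in> hom C x z"
  by (simp add: hom_def Cm_in Dm_Cm Cd_Cm)

lemma Idt_hom: "x \<in> Ob C \<Longrightarrow> Idt C x \<in> hom C x x"
  by (simp add: hom_def Idt_in Dm_Idt Cd_Idt)

lemma Cm_Idt_hom: "f \<in> hom C x y \<Longrightarrow> Cm C f (Idt C x) = f"
  using Cm_Idt by (auto simp: hom_def)

lemma Idt_Cm_hom: "f \<in> hom C x y \<Longrightarrow> Cm C (Idt C y) f = f"
  using Idt_Cm by (auto simp: hom_def)

lemma Cm_assoc_hom: "\<lbrakk>f \<in> hom C x y; g \<in> hom C y z; h \<in> hom C z w\<rbrakk>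
    \<Longrightarrow> Cm C h (Cm C g f) = Cm C (Cm C h g) f"
  using Cm_assoc by (auto simp: hom_def)

lemma is_retractI:
  assumes "f \<in> hom C x y" "g \<in> hom C z w"
    and "i \<in> hom C x z" "r \<in> hom C z x" "j \<in> hom C y w" "s \<in> hom C w y"
    and "Cm C r i = Idt C x" "Cm C s j = Idt C y" "Cm C g i = Cm C j f" "Cm C f r = Cm C s g"
  shows "is_retract C f g"
proof -
  have "f \<in> Ar C \<and> g \<in> Ar C \<and> Dm C f = x \<and> Cd C f = y \<and> Dm C g = z \<and> Cd C g = w"
    using assms(1,2) by (auto simp: hom_def)
  then show ?thesis
    unfolding is_retract_def using assms(3-) by blast
qed

lemma has_liftingD:
  assumes "has_lifting C i p" "i \<in> hom C x y" "p \<in> hom C z w"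
    and "a \<in> hom C x z" "b \<in> hom C y w" "Cm C p a = Cm C b i"
  shows "\<exists>l\<in>hom C y z. Cm C l i = a \<and> Cm C p l = b"
proof -
  have "Dm C i = x" "Cd C i = y" "Dm C p = z" "Cd C p = w"
    using assms(2,3) by (auto simp: hom_def)
  then show ?thesis using assms unfolding has_lifting_def by blast
qed

lemma has_lifting_Cm:
  assumes "has_lifting C i p" "has_lifting C j p"
    and i: "i \<in> hom C x y" and j: "j \<in> hom C y z" and p: "p \<in> Ar C"
  shows "has_lifting C (Cm C j i) p"
  unfolding has_lifting_def
proof (intro ballI impI)
  fix a b
  assume a: "a \<in> hom C (Dm C (Cm C j i)) (Dm C p)"
    and b: "b \<in> hom C (Cd C (Cm C j i)) (Cd C p)" and eq: "Cm C p a = Cm C b (Cm C j i)"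
  have p: "p \<in> hom C (Dm C p) (Cd C p)"
    by (rule Ar_hom [OF p])
  have ji: "Dm C (Cm C j i) = x" "Cd C (Cm C j i) = z"
    using Cm_hom [OF i j] by (auto simp: hom_def)
  note a = a [unfolded ji] and b = b [unfolded ji]
  have "Cm C p a = Cm C (Cm C b j) i"
    using eq Cm_assoc_hom [OF i j b] by simp
  then obtain l where l: "l \<in> hom C y (Dm C p)" "Cm C l i = a" "Cm C p l = Cm C b j"
    using has_liftingD [OF assms(1) i p a Cm_hom [OF j b]] by blast
  obtain m where m: "m \<in> hom C z (Dm C p)" "Cm C m j = l" "Cm C p m = b"
    using has_liftingD [OF assms(2) j p l(1) b l(3)] by blast
  have "Cm C m (Cm C j i) = a"
    using Cm_assoc_hom [OF i j m(1)] m l by simp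
  then show "\<exists>l\<in>hom C (Cd C (Cm C j i)) (Dm C p). Cm C l (Cm C j i) = a \<and> Cm C p l = b"
    using m ji by auto
qed

end

section \<open>Model structures\<close>

context model_structure
begin

lemma WE_Ar: "f \<in> WE M \<Longrightarrow> f \<in> Ar C" and Cof_Ar: "f \<in> Cof M \<Longrightarrow> f \<in> Ar C"
  and Fib_Ar: "f \<in> Fib M \<Longrightarrow> f \<in> Ar C"
  using WE_sub Cof_sub Fib_sub by auto

lemma factor_Cof_hom:
  assumes "f \<in> hom C x y"
  obtains i p z where "i \<in> hom C x z" "i \<in> Cof M" "p \<in> hom C z y" "p \<in> Fib M" "p \<in> WE M"
    "Cm C p i = f"
proof -
  obtain i p where ip: "i \<in> Cof M" "p \<in> Fib M \<inter> WE M" "Cd C i = Dm C p" "Cm C p i = f"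
    using factor_Cof [of f] homD [OF assms] by blast
  have "i \<in> Ar C" "p \<in> Ar C" using ip Cof_Ar WE_Ar by auto
  then have "i \<in> hom C x (Dm C p)" "p \<in> hom C (Dm C p) y"
    using ip assms Dm_Cm [of i p] Cd_Cm [of i p] by (auto simp: hom_def)
  then show thesis using that ip by blast
qed

lemma factor_triv_Cof_hom:
  assumes "f \<in> hom C x y"
  obtains i p z where "i \<in> hom C x z" "i \<in> Cof M" "i \<in> WE M" "p \<in> hom C z y" "p \<in> Fib M"
    "Cm C p i = f"
proof -
  obtain i p where ip: "i \<in> Cof M \<inter> WE M" "p \<in> Fib M" "Cd C i = Dm C p" "Cm C p i = f"
    using factor_triv_Cof [of f] homD [OF assms] by blast
  have "i \<in> Ar C" "p \<in> Ar C" using ip Fib_Ar WE_Ar by auto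
  then have "i \<in> hom C x (Dm C p)" "p \<in> hom C (Dm C p) y"
    using ip assms Dm_Cm [of i p] Cd_Cm [of i p] by (auto simp: hom_def)
  then show thesis using that ip by blast
qed

lemma WE_Cm: "\<lbrakk>f \<in> hom C x y; g \<in> hom C y z; f \<in> WE M; g \<in> WE M\<rbrakk> \<Longrightarrow> Cm C g f \<in> WE M"
  using two_of_three [of f g] by (auto simp: hom_def)

lemma WE_cancel_right:
  "\<lbrakk>f \<in> hom C x y; g \<in> hom C y z; f \<in> WE M; Cm C g f \<in> WE M\<rbrakk> \<Longrightarrow> g \<in> WE M"
  using two_of_three [of f g] by (auto simp: hom_def)

lemma WE_cancel_left:
  "\<lbrakk>f \<in> hom C x y; g \<in> hom C y z; g \<in> WE M; Cm C g f \<in> WE M\<rbrakk> \<Longrightarrow> f \<in> WE M"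
  using two_of_three [of f g] by (auto simp: hom_def)

text \<open>Identities are not mentioned in the axioms for weak equivalences. A factorization
  supplies some weak equivalence \<open>p\<close> ending in \<open>x\<close>, and the identity after
  \<open>p\<close> is \<open>p\<close>, so two-of-three applies.\<close>

lemma Idt_WE:
  assumes "x \<in> Ob C"
  shows "Idt C x \<in> WE M"
proof -
  obtain i p z where p: "p \<in> hom C z x" "p \<in> WE M"
    using factor_Cof_hom [OF Idt_hom [OF assms]] by metis
  show ?thesis
    by (rule WE_cancel_right [OF p(1) Idt_hom [OF assms] p(2)]) (simp add: Idt_Cm_hom [OF p(1)] p)
qed

text \<open>Retract argument: a filler of the square with \<open>i\<close> on top and an identity at
  the bottom is a section of \<open>p\<close> that carries \<open>f\<close> to
  \<open>i\<close>.\<close>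

lemma retract_of_lift:
  assumes i: "i \<in> hom C x z" and p: "p \<in> hom C z y" and "Cm C p i = f"
    and lift: "has_lifting C f p"
  shows "is_retract C f i"
proof -
  have f: "f \<in> hom C x y"
    using Cm_hom [OF i p] assms by simp
  have y: "y \<in> Ob C" and x: "x \<in> Ob C"
    using hom_obs [OF f] by auto
  obtain l where l: "l \<in> hom C y z" "Cm C l f = i" "Cm C p l = Idt C y"
    using has_liftingD [OF lift f p i Idt_hom [OF y]] assms Idt_Cm_hom [OF f] by auto
  show ?thesis
    by (rule is_retractI [OF f i Idt_hom [OF x] Idt_hom [OF x] l(1) p])
      (use l assms Cm_Idt_hom [OF i] Cm_Idt_hom [OF f] Cm_Idt_hom [OF Idt_hom [OF x]] in auto)
qed

text \<open>Factoring \<open>f\<close> as a cofibration followed by a trivial fibration makes it a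
  retract of that cofibration. This converse of \<open>lift_Cof\<close> is how cofibrations are
  recognized below.\<close>

lemma CofI:
  assumes f: "f \<in> Ar C" and lift: "\<And>p. p \<in> Fib M \<inter> WE M \<Longrightarrow> has_lifting C f p"
  shows "f \<in> Cof M"
proof -
  obtain i p z where ip: "i \<in> hom C (Dm C f) z" "i \<in> Cof M" "p \<in> hom C z (Cd C f)"
    "p \<in> Fib M" "p \<in> WE M" "Cm C p i = f"
    using factor_Cof_hom [OF Ar_hom [OF f]] by metis
  show ?thesis
    using retract_Cof [OF retract_of_lift [OF ip(1,3,6) lift] ip(2)] ip by simp
qed

lemma triv_CofI:
  assumes f: "f \<in> Ar C" and lift: "\<And>p. p \<in> Fib M \<Longrightarrow> has_lifting C f p"
  shows "f \<in> Cof M \<inter> WE M"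
proof -
  obtain i p z where ip: "i \<in> hom C (Dm C f) z" "i \<in> Cof M" "i \<in> WE M" "p \<in> hom C z (Cd C f)"
    "p \<in> Fib M" "Cm C p i = f"
    using factor_triv_Cof_hom [OF Ar_hom [OF f]] by metis
  have "is_retract C f i"
    using retract_of_lift [OF ip(1,4,6) lift] ip by simp
  then show ?thesis
    using retract_Cof retract_WE ip by blast
qed

lemma Cof_Cm: "\<lbrakk>f \<in> hom C x y; g \<in> hom C y z; f \<in> Cof M; g \<in> Cof M\<rbrakk> \<Longrightarrow> Cm C g f \<in> Cof M"
  by (rule CofI, use Cm_hom homD in blast, rule has_lifting_Cm [OF lift_Cof lift_Cof])
    (auto dest: Fib_Ar)

lemma cofibrant_target:
  assumes x: "cofibrant C M x" and f: "f \<in> hom C x y" "f \<in> Cof M"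
  shows "cofibrant C M y"
proof -
  obtain i j where i: "initial_object C i" "j \<in> hom C i x" "j \<in> Cof M"
    using x unfolding cofibrant_def by auto
  show ?thesis
    unfolding cofibrant_def using i f Cof_Cm [OF i(2) f(1) i(3) f(2)] Cm_hom [OF i(2) f(1)]
      hom_obs [OF f(1)] by blast
qed

text \<open>The square to be filled starts at the initial object, so it commutes
  automatically.\<close>

lemma cofibrant_lift:
  assumes x: "cofibrant C M x" and p: "p \<in> hom C z y" "p \<in> Fib M" "p \<in> WE M"
    and b: "b \<in> hom C x y"
  obtains l where "l \<in> hom C x z" "Cm C p l = b"
proof -
  obtain i j where i: "initial_object C i" "j \<in> hom C i x" "j \<in> Cof M"
    using x unfolding cofibrant_def by auto
  obtain a where a: "a \<in> hom C i z"
    using i(1) hom_obs [OF p(1)] unfolding initial_object_def by blast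
  have "Cm C p a = Cm C b j"
    using Cm_hom [OF a p(1)] Cm_hom [OF i(2) b] i(1) hom_obs [OF p(1)]
    unfolding initial_object_def by blast
  then show thesis
    using has_liftingD [OF lift_Cof i(2) p(1) a b] i p that by blast
qed

lemma cofibrant_section:
  assumes "cofibrant C M y" "p \<in> hom C z y" "p \<in> Fib M" "p \<in> WE M"
  obtains s where "s \<in> hom C y z" "Cm C p s = Idt C y"
  by (rule cofibrant_lift [OF assms Idt_hom]) (use hom_obs [OF assms(2)] in blast)+

text \<open>The map \<open>e\<close> is a retract of the idempotent \<open>Cm C g e\<close>, with
  identities between the sources and \<open>g\<close>, \<open>e\<close> between the targets. This
  takes the place of an argument with homotopy inverses.\<close>

lemma WE_of_inverse:
  assumes g: "g \<in> hom C x y" and e: "e \<in> hom C y x"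
    and eg: "Cm C e g = Idt C x" and ge: "Cm C g e \<in> WE M"
  shows "e \<in> WE M"
proof -
  have y: "y \<in> Ob C" using hom_obs [OF g] by blast
  have ge': "Cm C g e \<in> hom C y y" using Cm_hom [OF e g] .
  have "Cm C e (Cm C g e) = e"
    using Cm_assoc_hom [OF e g e] eg Idt_Cm_hom [OF e] by simp
  then have "is_retract C e (Cm C g e)"
    by (intro is_retractI [OF e ge' Idt_hom [OF y] Idt_hom [OF y] g e])
      (simp_all add: eg Cm_Idt_hom [OF Idt_hom [OF y]] Cm_Idt_hom [OF ge'] Cm_Idt_hom [OF e])
  then show ?thesis using retract_WE ge by blast
qed

text \<open>After \<open>b\<close> is replaced by the fibration \<open>p\<close>, it suffices that
  \<open>p\<close> has a section \<open>s\<close> with \<open>Cm C s p\<close> a weak equivalence.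
  The section is built from a section of the trivial fibration \<open>t\<close>, which exists
  because \<open>y\<close> is cofibrant; the idempotent is a weak equivalence because
  \<open>Cm C c p\<close> absorbs it.\<close>

lemma two_of_six:
  assumes a: "a \<in> hom C w x" and b: "b \<in> hom C x y" and c: "c \<in> hom C y z"
    and ba: "Cm C b a \<in> WE M" and cb: "Cm C c b \<in> WE M" and y: "cofibrant C M y"
  shows "b \<in> WE M"
proof -
  obtain i p e where ip: "i \<in> hom C x e" "i \<in> Cof M" "i \<in> WE M" "p \<in> hom C e y" "p \<in> Fib M"
    "Cm C p i = b"
    using factor_triv_Cof_hom [OF b] by metis
  obtain k t v where kt: "k \<in> hom C w v" "k \<in> Cof M" "k \<in> WE M" "t \<in> hom C v y" "t \<in> Fib M"
    "Cm C t k = Cm C b a"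
    using factor_triv_Cof_hom [OF Cm_hom [OF a b]] by metis
  have t: "t \<in> WE M"
    using WE_cancel_right [OF kt(1,4,3)] kt(6) ba by simp
  \<comment> \<open>Both sides are \<open>Cm C b a\<close>. Lifting \<open>k\<close> against
    \<open>p\<close> in this square gives a map \<open>v \<rightarrow> e\<close> over
    \<open>y\<close>, which carries sections of \<open>t\<close> to sections of
    \<open>p\<close>.\<close>
  have "Cm C p (Cm C i a) = Cm C t k"
    using Cm_assoc_hom [OF a ip(1,4)] ip kt by simp
  then obtain m where m: "m \<in> hom C v e" "Cm C p m = t"
    using has_liftingD [OF lift_triv_Cof kt(1) ip(4) Cm_hom [OF a ip(1)] kt(4)] kt ip by blast
  obtain r where r: "r \<in> hom C y v" "Cm C t r = Idt C y"
    using cofibrant_section [OF y kt(4,5) t] by metis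
  define s where "s = Cm C m r"
  have s: "s \<in> hom C y e" and ps: "Cm C p s = Idt C y"
    unfolding s_def using Cm_hom [OF r(1) m(1)] Cm_assoc_hom [OF r(1) m(1) ip(4)] m r by auto
  have cp: "Cm C c p \<in> hom C e z"
    by (rule Cm_hom [OF ip(4) c])
  have "Cm C (Cm C c p) i \<in> WE M"
    using Cm_assoc_hom [OF ip(1,4) c] ip cb by simp
  then have cpW: "Cm C c p \<in> WE M"
    using WE_cancel_right [OF ip(1) cp ip(3)] by simp
  have sp: "Cm C s p \<in> hom C e e"
    by (rule Cm_hom [OF ip(4) s])
  have "Cm C (Cm C c p) (Cm C s p) = Cm C (Cm C c (Cm C p s)) p"
    using Cm_assoc_hom [OF ip(4) s cp] Cm_assoc_hom [OF s ip(4) c] by simp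
  also have "\<dots> = Cm C c p"
    using ps Cm_Idt_hom [OF c] by simp
  finally have "Cm C s p \<in> WE M"
    using WE_cancel_left [OF sp cp cpW] cpW by simp
  then have "p \<in> WE M"
    using WE_of_inverse [OF s ip(4) ps] by simp
  then show ?thesis
    using WE_Cm [OF ip(1,4,3)] ip by simp
qed

end

section \<open>Quillen adjunctions\<close>

context is_functor
begin

lemma Fa_hom: "f \<in> hom C x y \<Longrightarrow> Fa f \<in> hom D (Fo x) (Fo y)"
  using Fa_in Fa_Dm Fa_Cd by (auto simp: hom_def)

lemma Fa_Cm_hom: "\<lbrakk>f \<in> hom C x y; g \<in> hom C y z\<rbrakk> \<Longrightarrow> Fa (Cm C g f) = Cm D (Fa g) (Fa f)"
  using Fa_Cm by (auto simp: hom_def)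

end

section \<open>Transposing arrows and lifting problems across an adjunction\<close>

context adjunction
begin

definition transpose :: "'b \<Rightarrow> 'o \<Rightarrow> 'a" where
  "transpose g x = Cm C (Ra g) (\<eta> x)"

lemma transpose_hom: "\<lbrakk>x \<in> Ob C; g \<in> hom D (Lo x) y\<rbrakk> \<Longrightarrow> transpose g x \<in> hom C x (Ro y)"
  unfolding transpose_def using unit_in right.Fa_hom left.dom.Cm_hom by blast

lemma transpose_inj:
  assumes "x \<in> Ob C" "g \<in> hom D (Lo x) y" "h \<in> hom D (Lo x) y" "transpose g x = transpose h x"
  shows "g = h"
  using unit_universal [OF assms(1) _ transpose_hom [OF assms(1,2)]] assms
    left.cod.hom_obs [OF assms(2)]
  unfolding transpose_def by metis

lemma transpose_surj:
  assumes "f \<in> hom C x (Ro y)" "y \<in> Ob D"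
  obtains g where "g \<in> hom D (Lo x) y" "transpose g x = f"
  using unit_universal [OF _ assms(2,1)] left.dom.hom_obs [OF assms(1)] that
  unfolding transpose_def by metis

lemma transpose_Cm_right:
  assumes "x \<in> Ob C" "g \<in> hom D (Lo x) y" "h \<in> hom D y z"
  shows "transpose (Cm D h g) x = Cm C (Ra h) (transpose g x)"
  unfolding transpose_def
  using right.Fa_Cm_hom [OF assms(2,3)]
    left.dom.Cm_assoc_hom [OF unit_in [OF assms(1)] right.Fa_hom [OF assms(2)] right.Fa_hom [OF assms(3)]]
  by simp

lemma transpose_Cm_left:
  assumes f: "f \<in> hom C x' x" and g: "g \<in> hom D (Lo x) y"
  shows "transpose (Cm D g (La f)) x' = Cm C (transpose g x) f"
proof -
  have x: "x \<in> Ob C" "x' \<in> Ob C" using left.dom.hom_obs [OF f] by auto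
  have "transpose (Cm D g (La f)) x' = Cm C (Ra g) (Cm C (Ra (La f)) (\<eta> x'))"
    unfolding transpose_def
    using right.Fa_Cm_hom [OF left.Fa_hom [OF f] g]
      left.dom.Cm_assoc_hom [OF unit_in [OF x(2)] right.Fa_hom [OF left.Fa_hom [OF f]] right.Fa_hom [OF g]]
    by simp
  also have "Cm C (Ra (La f)) (\<eta> x') = Cm C (\<eta> x) f"
    using unit_natural f by (auto simp: hom_def)
  also have "Cm C (Ra g) (Cm C (\<eta> x) f) = Cm C (transpose g x) f"
    unfolding transpose_def
    using left.dom.Cm_assoc_hom [OF f unit_in [OF x(1)] right.Fa_hom [OF g]] by simp
  finally show ?thesis .
qed

text \<open>A square from \<open>La i\<close> to \<open>p\<close> transposes to one from
  \<open>i\<close> to \<open>Ra p\<close>. Its filler transposes back, and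
  \<open>transpose_inj\<close> carries the two triangles across.\<close>

lemma transpose_lifting:
  assumes i: "i \<in> Ar C" and p: "p \<in> Ar D" and lift: "has_lifting C i (Ra p)"
  shows "has_lifting D (La i) p"
  unfolding has_lifting_def
proof (intro ballI impI)
  fix a b
  assume a: "a \<in> hom D (Dm D (La i)) (Dm D p)" and b: "b \<in> hom D (Cd D (La i)) (Cd D p)"
    and eq: "Cm D p a = Cm D b (La i)"
  define x x' y y' where defs: "x = Dm C i" "x' = Cd C i" "y = Dm D p" "y' = Cd D p"
  have i: "i \<in> hom C x x'" and p: "p \<in> hom D y y'"
    using left.dom.Ar_hom [OF i] left.cod.Ar_hom [OF p] defs by auto
  have La: "La i \<in> hom D (Lo x) (Lo x')" by (rule left.Fa_hom [OF i])
  then have a: "a \<in> hom D (Lo x) y" and b: "b \<in> hom D (Lo x') y'"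
    using a b defs by (auto simp: hom_def)
  have x: "x \<in> Ob C" "x' \<in> Ob C" and y: "y \<in> Ob D"
    using left.dom.hom_obs [OF i] left.cod.hom_obs [OF p] by auto
  have "Cm C (Ra p) (transpose a x) = Cm C (transpose b x') i"
    using transpose_Cm_right [OF x(1) a p] transpose_Cm_left [OF i b] eq by simp
  then obtain l where l: "l \<in> hom C x' (Ro y)" "Cm C l i = transpose a x"
      "Cm C (Ra p) l = transpose b x'"
    using left.dom.has_liftingD [OF lift i right.Fa_hom [OF p] transpose_hom [OF x(1) a]
        transpose_hom [OF x(2) b]] by blast
  obtain m where m: "m \<in> hom D (Lo x') y" "transpose m x' = l"
    using transpose_surj [OF l(1) y] by metis
  have "Cm D m (La i) = a"
    by (rule transpose_inj [OF x(1) left.cod.Cm_hom [OF La m(1)] a])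
      (simp add: transpose_Cm_left [OF i m(1)] m l)
  moreover have "Cm D p m = b"
    by (rule transpose_inj [OF x(2) left.cod.Cm_hom [OF m(1) p] b])
      (simp add: transpose_Cm_right [OF x(2) m(1) p] m l)
  ultimately show "\<exists>l\<in>hom D (Cd D (La i)) (Dm D p). Cm D l (La i) = a \<and> Cm D p l = b"
    using m(1) La defs by (auto simp: hom_def)
qed

lemma left_initial:
  assumes "initial_object C i"
  shows "initial_object D (Lo i)"
  unfolding initial_object_def
proof (intro conjI ballI)
  have i: "i \<in> Ob C" using assms by (simp add: initial_object_def)
  then show "Lo i \<in> Ob D" by (rule left.Fo_in)
  fix y assume y: "y \<in> Ob D"
  then obtain f where f: "f \<in> hom C i (Ro y)"
      "\<And>g. g \<in> hom C i (Ro y) \<Longrightarrow> g = f"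
    using assms right.Fo_in [OF y] unfolding initial_object_def by blast
  obtain g where "g \<in> hom D (Lo i) y"
    using transpose_surj [OF f(1) y] by metis
  then show "\<exists>!f. f \<in> hom D (Lo i) y"
    using f(2) transpose_hom [OF i] transpose_inj [OF i] by metis
qed

lemma right_terminal:
  assumes "terminal_object D t"
  shows "terminal_object C (Ro t)"
  unfolding terminal_object_def
proof (intro conjI ballI)
  have t: "t \<in> Ob D" using assms by (simp add: terminal_object_def)
  then show "Ro t \<in> Ob C" by (rule right.Fo_in)
  fix x assume x: "x \<in> Ob C"
  then obtain g where g: "g \<in> hom D (Lo x) t" "\<And>h. h \<in> hom D (Lo x) t \<Longrightarrow> h = g"
    using assms left.Fo_in [OF x] unfolding terminal_object_def by blast
  show "\<exists>!f. f \<in> hom C x (Ro t)"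
    using transpose_hom [OF x g(1)] g(2) transpose_surj [OF _ t] by metis
qed

end

section \<open>Left Quillen functors on cofibrant objects\<close>

context quillen_adjunction
begin

lemma left_cofibrant:
  assumes "cofibrant C M x"
  shows "cofibrant D N (Lo x)"
proof -
  obtain i j where i: "initial_object C i" "j \<in> hom C i x" "j \<in> Cof M"
    using assms unfolding cofibrant_def by auto
  then show ?thesis
    unfolding cofibrant_def
    using left_initial left.Fa_hom [OF i(2)] left_Cof left.cod.hom_obs [OF left.Fa_hom [OF i(2)]]
    by blast
qed

text \<open>Ken Brown's lemma, with the usual coproduct replaced by an appeal to the two-of-six property.\<close>

lemma left_triv_Fib:
  assumes t: "t \<in> hom C x y" "t \<in> Fib M" "t \<in> WE M"
    and x: "cofibrant C M x" and y: "cofibrant C M y"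
  shows "La t \<in> WE N"
proof -
  \<comment> \<open>A section is taken twice, each time split into a cofibration and a trivial
    fibration: first the section of \<open>t\<close> through \<open>t1\<close>, then the section of
    \<open>t1\<close> through \<open>t2\<close>. This puts \<open>t1\<close> in the middle of the
    chain \<open>t2\<close>, \<open>t1\<close>, \<open>t\<close>.\<close>
  obtain s where s: "s \<in> hom C y x" "Cm C t s = Idt C y"
    using MC.cofibrant_section [OF y t] by metis
  obtain i t1 x1 where i: "i \<in> hom C y x1" "i \<in> Cof M" and
      t1: "t1 \<in> hom C x1 x" "t1 \<in> Fib M" "t1 \<in> WE M" "Cm C t1 i = s"
    using MC.factor_Cof_hom [OF s(1)] by metis
  obtain r where r: "r \<in> hom C x x1" "Cm C t1 r = Idt C x"
    using MC.cofibrant_section [OF x t1(1-3)] by metis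
  obtain j t2 x2 where j: "j \<in> hom C x x2" "j \<in> Cof M" and
      t2: "t2 \<in> hom C x2 x1" "t2 \<in> Fib M" "t2 \<in> WE M" "Cm C t2 j = r"
    using MC.factor_Cof_hom [OF r(1)] by metis
  \<comment> \<open>The cofibration \<open>k\<close> is a section of the weak equivalence
    \<open>Cm C p q\<close>, hence a trivial cofibration. So its image is a weak equivalence, and by
    two-of-three so is the image of \<open>Cm C p q\<close>.\<close>
  have *: "La (Cm C p q) \<in> WE N"
    if p: "p \<in> hom C v u" "p \<in> WE M" and q: "q \<in> hom C w v" "q \<in> WE M"
      and k: "k \<in> hom C u w" "k \<in> Cof M" and eq: "Cm C p (Cm C q k) = Idt C u" for p q k u v w
  proof -
    have pq: "Cm C p q \<in> hom C w u" and pqW: "Cm C p q \<in> WE M"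
      using left.dom.Cm_hom [OF q(1) p(1)] MC.WE_Cm [OF q(1) p(1)] p q by auto
    have u: "u \<in> Ob C" using left.dom.hom_obs [OF k(1)] by auto
    have eq': "Cm C (Cm C p q) k = Idt C u"
      using eq left.dom.Cm_assoc_hom [OF k(1) q(1) p(1)] by simp
    then have "k \<in> WE M"
      using MC.WE_cancel_left [OF k(1) pq pqW] MC.Idt_WE [OF u] by simp
    then have "La k \<in> WE N" using left_triv_Cof k by auto
    moreover have "Cm D (La (Cm C p q)) (La k) = Idt D (Lo u)"
      using left.Fa_Cm_hom [OF k(1) pq] eq' left.Fa_Idt [OF u] by simp
    ultimately show ?thesis
      using MD.WE_cancel_right [OF left.Fa_hom [OF k(1)] left.Fa_hom [OF pq]]
        MD.Idt_WE [OF left.Fo_in [OF u]] by simp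
  qed
  have "La t1 \<in> WE N"
  proof (rule MD.two_of_six [OF left.Fa_hom [OF t2(1)] left.Fa_hom [OF t1(1)] left.Fa_hom [OF t(1)]])
    show "Cm D (La t1) (La t2) \<in> WE N"
      using * [OF t1(1,3) t2(1,3) j] t2 r left.Fa_Cm_hom [OF t2(1) t1(1)] by simp
    show "Cm D (La t) (La t1) \<in> WE N"
      using * [OF t(1,3) t1(1,3) i] t1 s left.Fa_Cm_hom [OF t1(1) t(1)] by simp
    show "cofibrant D N (Lo x)" by (rule left_cofibrant [OF x])
  qed
  moreover have "Cm D (La t) (La t1) \<in> WE N"
    using * [OF t(1,3) t1(1,3) i] t1 s left.Fa_Cm_hom [OF t1(1) t(1)] by simp
  ultimately show ?thesis
    using MD.WE_cancel_right [OF left.Fa_hom [OF t1(1)] left.Fa_hom [OF t(1)]] by simp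
qed

text \<open>Both halves of a factorization of \<open>f\<close> are weak equivalences. The trivial
  cofibration is preserved by assumption, the trivial fibration by \<open>left_triv_Fib\<close>; the
  middle object is cofibrant, as it receives a cofibration from \<open>x\<close>.\<close>

lemma left_WE:
  assumes f: "f \<in> hom C x y" "f \<in> WE M" and x: "cofibrant C M x" and y: "cofibrant C M y"
  shows "La f \<in> WE N"
proof -
  obtain i p z where ip: "i \<in> hom C x z" "i \<in> Cof M" "p \<in> hom C z y" "p \<in> Fib M" "p \<in> WE M"
    "Cm C p i = f"
    using MC.factor_Cof_hom [OF f(1)] by metis
  have "i \<in> WE M"
    using MC.WE_cancel_left [OF ip(1,3,5)] ip f by simp
  then have "La i \<in> WE N" using left_triv_Cof ip by auto
  moreover have "La p \<in> WE N"
    using left_triv_Fib [OF ip(3-5) MC.cofibrant_target [OF x ip(1,2)] y] .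
  ultimately show ?thesis
    using MD.WE_Cm [OF left.Fa_hom [OF ip(1)] left.Fa_hom [OF ip(3)]]
      left.Fa_Cm_hom [OF ip(1,3)] ip by simp
qed

end

section \<open>Quillen equivalences along a right-transferred model structure\<close>

text \<open>In the application \<open>D\<close> is \<open>TwoCat\<close>, \<open>C\<close> is
  \<open>DblCat\<close>, \<open>So\<close> is \<open>Sq\<close> and \<open>Ro\<close> is
  \<open>RR\<close>. Because weak equivalences and fibrations of \<open>D\<close> are created by
  \<open>Sa\<close>, the concrete input reduces to certain maps being trivial fibrations of
  \<open>C\<close>: the counits at fibrant objects and at objects \<open>So z\<close>, and the maps
  \<open>Sa (Ra p)\<close>.\<close>

locale transferred_adjunction =
  adjunction D C So Sa Ro Ra u + MC: model_structure C M
  for D :: "('p, 'b) cat" and C :: "('o, 'a) cat" and So Sa Ro Ra u M +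
  fixes N :: "'b model" and \<epsilon> :: "'o \<Rightarrow> 'a"
  assumes transferred: "right_transferred M D Sa N"
    and triv_Fib: "p \<in> Fib M \<inter> WE M \<Longrightarrow> Sa (Ra p) \<in> Fib M \<inter> WE M"
    and counit_hom: "y \<in> Ob C \<Longrightarrow> \<epsilon> y \<in> hom C (So (Ro y)) y"
    and counit_transpose: "y \<in> Ob C \<Longrightarrow> Cm D (Ra (\<epsilon> y)) (u (Ro y)) = Idt D (Ro y)"
    and counit_fibrant: "fibrant C M y \<Longrightarrow> \<epsilon> y \<in> Fib M \<inter> WE M"
    and counit_image: "z \<in> Ob D \<Longrightarrow> \<epsilon> (So z) \<in> Fib M \<inter> WE M"
begin

sublocale MD: model_structure D N
  using transferred by (simp add: right_transferred_def)

lemma WE_N: "f \<in> WE N \<longleftrightarrow> f \<in> Ar D \<and> Sa f \<in> WE M"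
  and Fib_N: "f \<in> Fib N \<longleftrightarrow> f \<in> Ar D \<and> Sa f \<in> Fib M"
  using transferred by (auto simp: right_transferred_def)

text \<open>Lifting \<open>Sa f\<close> against a trivial fibration \<open>p\<close> transposes to
  lifting \<open>f\<close> against \<open>Ra p\<close>, which \<open>triv_Fib\<close> makes a
  trivial fibration of the transferred structure.\<close>

lemma S_Cof:
  assumes "f \<in> Cof N"
  shows "Sa f \<in> Cof M"
proof (rule MC.CofI)
  have f: "f \<in> Ar D" using assms by (rule MD.Cof_Ar)
  then show "Sa f \<in> Ar C" by (rule left.Fa_in)
  fix p assume p: "p \<in> Fib M \<inter> WE M"
  then have "p \<in> Ar C" by (auto intro: MC.Fib_Ar)
  moreover have "Ra p \<in> Fib N \<inter> WE N"
    using triv_Fib [OF p] right.Fa_in [OF \<open>p \<in> Ar C\<close>] by (simp add: WE_N Fib_N)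
  ultimately show "has_lifting C (Sa f) p"
    using transpose_lifting [OF f] MD.lift_Cof [OF assms] by blast
qed

lemma S_quillen: "quillen_adjunction D N C M So Sa Ro Ra u"
proof (unfold_locales, goal_cases)
  case (1 f) then show ?case by (rule S_Cof)
next
  case (2 f) then show ?case using S_Cof WE_N by auto
qed

sublocale QS: quillen_adjunction D N C M So Sa Ro Ra u
  by (rule S_quillen)

lemma counit_transpose': "y \<in> Ob C \<Longrightarrow> transpose (\<epsilon> y) (Ro y) = Idt D (Ro y)"
  using counit_transpose by (simp add: transpose_def)

lemma counit_factor:
  assumes y: "y \<in> Ob C" and g: "g \<in> hom C (So x) y" and x: "x \<in> Ob D"
  shows "Cm C (\<epsilon> y) (Sa (transpose g x)) = g"
proof -
  have t: "transpose g x \<in> hom D x (Ro y)" by (rule transpose_hom [OF x g])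
  show ?thesis
    by (rule transpose_inj [OF x left.cod.Cm_hom [OF left.Fa_hom [OF t] counit_hom [OF y]] g])
      (simp add: transpose_Cm_left [OF t counit_hom [OF y]] counit_transpose' [OF y]
        left.dom.Idt_Cm_hom [OF t])
qed

text \<open>By a triangle identity \<open>Sa (u z)\<close> is a section of the trivial fibration
  \<open>\<epsilon> (So z)\<close>, and \<open>Sa\<close> detects weak equivalences.\<close>

lemma unit_WE:
  assumes z: "z \<in> Ob D"
  shows "u z \<in> WE N"
proof -
  have Sz: "So z \<in> Ob C" by (rule left.Fo_in [OF z])
  have u: "u z \<in> hom D z (Ro (So z))" by (rule unit_in [OF z])
  have "transpose (Idt C (So z)) z = u z"
    unfolding transpose_def using right.Fa_Idt [OF Sz] left.dom.Idt_Cm_hom [OF u] by simp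
  then have "Cm C (\<epsilon> (So z)) (Sa (u z)) = Idt C (So z)"
    using counit_factor [OF Sz left.cod.Idt_hom [OF Sz] z] by simp
  then have "Sa (u z) \<in> WE M"
    using MC.WE_cancel_left [OF left.Fa_hom [OF u] counit_hom [OF Sz]] counit_image [OF z]
      MC.Idt_WE [OF Sz] by auto
  then show ?thesis using u by (simp add: WE_N hom_def)
qed

text \<open>Every \<open>g\<close> is \<open>\<epsilon> y\<close> after \<open>Sa\<close> of its
  transpose. For fibrant \<open>y\<close> the first factor is a weak equivalence, so two-of-three
  compares \<open>g\<close> with its transpose.\<close>

lemma S_quillen_equivalence: "quillen_equivalence D N C M So Sa Ro Ra u"
proof (unfold_locales, goal_cases)
  case (1 x y g)
  have x: "x \<in> Ob D" and y: "y \<in> Ob C"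
    using 1 by (auto simp: cofibrant_def fibrant_def)
  have t: "transpose g x \<in> hom D x (Ro y)" by (rule transpose_hom [OF x 1(3)])
  have \<epsilon>: "\<epsilon> y \<in> hom C (So (Ro y)) y" "\<epsilon> y \<in> WE M"
    using counit_hom [OF y] counit_fibrant [OF 1(2)] by auto
  note St = left.Fa_hom [OF t]
  have "g \<in> WE M \<longleftrightarrow> Sa (transpose g x) \<in> WE M"
    using counit_factor [OF y 1(3) x] MC.WE_Cm [OF St \<epsilon>(1) _ \<epsilon>(2)]
      MC.WE_cancel_left [OF St \<epsilon>] by auto
  also have "\<dots> \<longleftrightarrow> transpose g x \<in> WE N"
    using t by (simp add: WE_N hom_def)
  finally show ?case by (simp add: transpose_def)
qed

end

text \<open>The 2-functors \<open>\<pi>h\<close>, \<open>\<pi>v\<close> and the double functor \<open>\<delta>\<close> say that the object \<open>Ro (So z)\<close> of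
  companion pairs is a path object, through which every morphism \<open>So x \<rightarrow> So z\<close> is right homotopic
  to one in the image of \<open>Sa\<close>.\<close>

locale strictified_adjunction =
  transferred_adjunction D C So Sa Ro Ra u M N \<epsilon>
  for D :: "('p, 'b) cat" and C :: "('o, 'a) cat" and So Sa Ro Ra u M N \<epsilon> +
  fixes \<pi>h \<pi>v :: "'p \<Rightarrow> 'b" and \<delta> :: "'p \<Rightarrow> 'a"
  assumes pi_h_hom: "z \<in> Ob D \<Longrightarrow> \<pi>h z \<in> hom D (Ro (So z)) z"
    and pi_v_hom: "z \<in> Ob D \<Longrightarrow> \<pi>v z \<in> hom D (Ro (So z)) z"
    and pi_h_unit: "z \<in> Ob D \<Longrightarrow> Cm D (\<pi>h z) (u z) = Idt D z"
    and pi_v_unit: "z \<in> Ob D \<Longrightarrow> Cm D (\<pi>v z) (u z) = Idt D z"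
    and pi_h_natural: "f \<in> hom D y z \<Longrightarrow> Cm D (\<pi>h z) (Ra (Sa f)) = Cm D f (\<pi>h y)"
    and delta_hom: "z \<in> Ob D \<Longrightarrow> \<delta> z \<in> hom C (So (Ro (So z))) (So (Ro (So z)))"
    and delta_v: "z \<in> Ob D \<Longrightarrow> Cm C (Sa (\<pi>v z)) (\<delta> z) = \<epsilon> (So z)"
    and delta_h: "z \<in> Ob D \<Longrightarrow> Cm C (Sa (\<pi>h z)) (\<delta> z) = Sa (\<pi>h z)"
begin

text \<open>Both projections are left inverse to the weak equivalence \<open>u z\<close>.\<close>

lemma pi_WE:
  assumes "z \<in> Ob D"
  shows "\<pi>h z \<in> WE N" and "\<pi>v z \<in> WE N"
  using MD.WE_cancel_right [OF unit_in [OF assms] _ unit_WE [OF assms]] MD.Idt_WE [OF assms]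
    pi_h_hom [OF assms] pi_h_unit [OF assms] pi_v_hom [OF assms] pi_v_unit [OF assms]
  by metis+

text \<open>Fibrations and weak equivalences of \<open>N\<close> are created by \<open>Sa\<close>,
  so lifting problems for \<open>La f\<close> transpose to lifting problems for \<open>f\<close> in
  \<open>C\<close>.\<close>

lemma left_quillen:
  assumes "adjunction C D Lo La So Sa \<eta>"
  shows "quillen_adjunction C M D N Lo La So Sa \<eta>"
proof -
  interpret L: adjunction C D Lo La So Sa \<eta> by (rule assms)
  show ?thesis
  proof (unfold_locales, goal_cases)
    case (1 f)
    have f: "f \<in> Ar C" using 1 by (rule MC.Cof_Ar)
    show ?case
    proof (rule MD.CofI [OF L.left.Fa_in [OF f]])
      fix p assume "p \<in> Fib N \<inter> WE N"
      then show "has_lifting D (La f) p"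
        using L.transpose_lifting [OF f] MC.lift_Cof [OF 1] by (simp add: Fib_N WE_N)
    qed
  next
    case (2 f)
    have f: "f \<in> Ar C" using 2 MC.Cof_Ar by blast
    show ?case
    proof (rule MD.triv_CofI [OF L.left.Fa_in [OF f]])
      fix p assume "p \<in> Fib N"
      then show "has_lifting D (La f) p"
        using L.transpose_lifting [OF f] MC.lift_triv_Cof [OF 2] by (simp add: Fib_N)
    qed
  qed
qed

text \<open>Put \<open>v = Lo (So w)\<close>. The unit \<open>So w \<rightarrow> So v\<close> need
  not be the image of an arrow \<open>w \<rightarrow> v\<close>, but it is homotopic to
  \<open>Sa g\<close>, where \<open>g\<close> is its horizontal part. The homotopy transposes to a
  homotopy \<open>H\<close> between \<open>Cm D g e\<close> and the identity of \<open>v\<close>,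
  while \<open>Cm D e g\<close> is an identity on the nose. So \<open>WE_of_inverse\<close>
  applies.\<close>

lemma left_counit_WE:
  assumes "adjunction C D Lo La So Sa \<eta>" and w: "w \<in> Ob D"
    and e: "e \<in> hom D (Lo (So w)) w" and e_transpose: "Cm C (Sa e) (\<eta> (So w)) = Idt C (So w)"
  shows "e \<in> WE N"
proof -
  interpret L: adjunction C D Lo La So Sa \<eta> by (rule assms)
  have Sw: "So w \<in> Ob C" by (rule left.Fo_in [OF w])
  define v where "v = Lo (So w)"
  have v: "v \<in> Ob D" and Sv: "So v \<in> Ob C"
    unfolding v_def using L.left.Fo_in [OF Sw] left.Fo_in by auto
  have e: "e \<in> hom D v w" using e by (simp add: v_def)
  have \<eta>: "\<eta> (So w) \<in> hom C (So w) (So v)" using L.unit_in [OF Sw] by (simp add: v_def)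
  define n where "n = transpose (\<eta> (So w)) w"
  have n: "n \<in> hom D w (Ro (So v))"
    unfolding n_def by (rule transpose_hom [OF w \<eta>])
  have \<epsilon>n: "Cm C (\<epsilon> (So v)) (Sa n) = \<eta> (So w)"
    unfolding n_def by (rule counit_factor [OF Sv \<eta> w])
  define g where "g = Cm D (\<pi>h v) n"
  have g: "g \<in> hom D w v"
    unfolding g_def by (rule left.dom.Cm_hom [OF n pi_h_hom [OF v]])
  note Sn = left.Fa_hom [OF n]
  \<comment> \<open>The homotopy: its composites with \<open>Sa (\<pi>h v)\<close> and
    \<open>Sa (\<pi>v v)\<close> are \<open>Sa g\<close> and the unit. It starts at
    \<open>So w\<close>, so it transposes to an arrow out of \<open>v\<close>.\<close>
  have K: "Cm C (\<delta> v) (Sa n) \<in> hom C (So w) (So (Ro (So v)))"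
    by (rule left.cod.Cm_hom [OF Sn delta_hom [OF v]])
  have T: "Ro (So v) \<in> Ob D" by (rule right.Fo_in [OF Sv])
  obtain H where H: "H \<in> hom D v (Ro (So v))" "L.transpose H (So w) = Cm C (\<delta> v) (Sa n)"
    using L.transpose_surj [OF K T] by (auto simp: v_def)
  have pv: "Cm D (\<pi>v v) H = Idt D v"
  proof (rule L.transpose_inj [OF Sw, folded v_def])
    show "Cm D (\<pi>v v) H \<in> hom D v v" by (rule left.dom.Cm_hom [OF H(1) pi_v_hom [OF v]])
    show "Idt D v \<in> hom D v v" by (rule left.dom.Idt_hom [OF v])
    have "L.transpose (Cm D (\<pi>v v) H) (So w) = Cm C (Sa (\<pi>v v)) (Cm C (\<delta> v) (Sa n))"
      using L.transpose_Cm_right [OF Sw _ pi_v_hom [OF v], of H] H by (simp add: v_def)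
    also have "\<dots> = \<eta> (So w)"
      using left.cod.Cm_assoc_hom [OF Sn delta_hom [OF v] left.Fa_hom [OF pi_v_hom [OF v]]]
        delta_v [OF v] \<epsilon>n by simp
    also have "\<dots> = L.transpose (Idt D v) (So w)"
      unfolding L.transpose_def
      using left.Fa_Idt [OF v] left.cod.Idt_Cm_hom [OF \<eta>] by simp
    finally show "L.transpose (Cm D (\<pi>v v) H) (So w) = L.transpose (Idt D v) (So w)" .
  qed
  have ph: "Cm D (\<pi>h v) H = Cm D g e"
  proof (rule L.transpose_inj [OF Sw, folded v_def])
    show "Cm D (\<pi>h v) H \<in> hom D v v" by (rule left.dom.Cm_hom [OF H(1) pi_h_hom [OF v]])
    show "Cm D g e \<in> hom D v v" by (rule left.dom.Cm_hom [OF e g])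
    have "L.transpose (Cm D (\<pi>h v) H) (So w) = Cm C (Sa (\<pi>h v)) (Cm C (\<delta> v) (Sa n))"
      using L.transpose_Cm_right [OF Sw _ pi_h_hom [OF v], of H] H by (simp add: v_def)
    also have "\<dots> = Sa g"
      using left.cod.Cm_assoc_hom [OF Sn delta_hom [OF v] left.Fa_hom [OF pi_h_hom [OF v]]]
        delta_h [OF v] left.Fa_Cm_hom [OF n pi_h_hom [OF v]] by (simp add: g_def)
    also have "\<dots> = Cm C (Sa g) (L.transpose e (So w))"
      using e_transpose left.cod.Cm_Idt_hom [OF left.Fa_hom [OF g]] by (simp add: L.transpose_def)
    also have "\<dots> = L.transpose (Cm D g e) (So w)"
      using L.transpose_Cm_right [OF Sw _ g, of e] e by (simp add: v_def)
    finally show "L.transpose (Cm D (\<pi>h v) H) (So w) = L.transpose (Cm D g e) (So w)" .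
  qed
  \<comment> \<open>As a section of the weak equivalence \<open>\<pi>v v\<close>, the path
    \<open>H\<close> is a weak equivalence; composing with the other projection transfers this to
    \<open>Cm D g e\<close>.\<close>
  have "H \<in> WE N"
    using MD.WE_cancel_left [OF H(1) pi_v_hom [OF v] pi_WE(2) [OF v]] pv MD.Idt_WE [OF v] by simp
  then have ge: "Cm D g e \<in> WE N"
    using MD.WE_Cm [OF H(1) pi_h_hom [OF v] _ pi_WE(1) [OF v]] ph by simp
  have RSe: "Ra (Sa e) \<in> hom D (Ro (So v)) (Ro (So w))"
    by (rule right.Fa_hom [OF left.Fa_hom [OF e]])
  \<comment> \<open>Naturality of \<open>\<pi>h\<close> moves \<open>e\<close> inside, where
    \<open>Sa e\<close> cancels the unit of \<open>Lo\<close> and \<open>So\<close>. What remains is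
    \<open>\<pi>h w\<close> after \<open>u w\<close>.\<close>
  have "Cm D e g = Cm D (Cm D (\<pi>h w) (Ra (Sa e))) n"
    using left.dom.Cm_assoc_hom [OF n pi_h_hom [OF v] e] pi_h_natural [OF e] by (simp add: g_def)
  also have "\<dots> = Cm D (\<pi>h w) (Cm D (Ra (Sa e)) n)"
    using left.dom.Cm_assoc_hom [OF n RSe pi_h_hom [OF w]] by simp
  also have "Cm D (Ra (Sa e)) n = transpose (Idt C (So w)) w"
    using transpose_Cm_right [OF w \<eta> left.Fa_hom [OF e]] e_transpose by (simp add: n_def)
  also have "\<dots> = u w"
    unfolding transpose_def
    using right.Fa_Idt [OF Sw] left.dom.Idt_Cm_hom [OF unit_in [OF w]] by simp
  finally have "Cm D e g = Idt D w" using pi_h_unit [OF w] by simp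
  then show ?thesis
    using MD.WE_of_inverse [OF g e _ ge] by simp
qed

lemma left_unit_WE:
  assumes adj: "adjunction C D Lo La So Sa \<eta>" and x: "cofibrant C M x"
    and t: "terminal_object D t"
  shows "\<eta> x \<in> WE M"
proof -
  interpret L: quillen_adjunction C M D N Lo La So Sa \<eta> by (rule left_quillen [OF adj])
  have xO: "x \<in> Ob C" using x by (simp add: cofibrant_def)
  \<comment> \<open>Fibrancy in \<open>C\<close> refers to a terminal object of \<open>C\<close>.
    The right adjoint \<open>So\<close> provides one.\<close>
  have St: "terminal_object C (So t)" by (rule L.right_terminal [OF t])
  obtain b where b: "b \<in> hom C x (So t)"
    using St xO unfolding terminal_object_def by blast
  obtain j y q where j: "j \<in> hom C x y" "j \<in> WE M" and q: "q \<in> hom C y (So t)" "q \<in> Fib M"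
    using MC.factor_triv_Cof_hom [OF b] by metis
  have y: "y \<in> Ob C" using left.cod.hom_obs [OF j(1)] by blast
  have "fibrant C M y"
    unfolding fibrant_def using y St q by blast
  then have \<epsilon>: "\<epsilon> y \<in> Fib M" "\<epsilon> y \<in> WE M" using counit_fibrant by auto
  obtain k where k: "k \<in> hom C x (So (Ro y))" "Cm C (\<epsilon> y) k = j"
    using MC.cofibrant_lift [OF x counit_hom [OF y] \<epsilon> j(1)] by metis
  have kW: "k \<in> WE M"
    using MC.WE_cancel_left [OF k(1) counit_hom [OF y] \<epsilon>(2)] k j by simp
  obtain h where h: "h \<in> hom D (Lo x) (Ro y)" "L.transpose h x = k"
    using L.transpose_surj [OF k(1) right.Fo_in [OF y]] by metis
  \<comment> \<open>Ken Brown's lemma needs a cofibrant target, which \<open>So (Ro y)\<close> may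
    fail to be. The object \<open>w\<close> repairs this: it is cofibrant because
    \<open>Lo x\<close> is, and \<open>So\<close> preserves cofibrant objects, being a left Quillen
    functor too.\<close>
  obtain i p w where ip: "i \<in> hom D (Lo x) w" "i \<in> Cof N" "p \<in> hom D w (Ro y)" "p \<in> WE N"
      "Cm D p i = h"
    using MD.factor_Cof_hom [OF h(1)] by metis
  have w: "w \<in> Ob D" and Sw: "So w \<in> Ob C"
    using left.dom.hom_obs [OF ip(1)] left.Fo_in by auto
  have cw: "cofibrant C M (So w)"
    by (intro QS.left_cofibrant MD.cofibrant_target [OF _ ip(1,2)] L.left_cofibrant x)
  define k' where "k' = L.transpose i x"
  have k': "k' \<in> hom C x (So w)"
    unfolding k'_def by (rule L.transpose_hom [OF xO ip(1)])
  have "Cm C (Sa p) k' = k"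
    using L.transpose_Cm_right [OF xO ip(1,3)] ip h by (simp add: k'_def)
  moreover have "Sa p \<in> WE M" using ip by (simp add: WE_N)
  ultimately have k'W: "k' \<in> WE M"
    using MC.WE_cancel_left [OF k' left.Fa_hom [OF ip(3)]] kW by simp
  obtain e where e: "e \<in> hom D (Lo (So w)) w" "L.transpose e (So w) = Idt C (So w)"
    using L.transpose_surj [OF left.cod.Idt_hom [OF Sw] w] by metis
  have eW: "e \<in> WE N"
    using left_counit_WE [OF adj w e(1)] e(2) by (simp add: L.transpose_def)
  have Lk': "La k' \<in> hom D (Lo x) (Lo (So w))" "La k' \<in> WE N"
    using L.left.Fa_hom [OF k'] L.left_WE [OF k' k'W x cw] by auto
  \<comment> \<open>The arrow \<open>i\<close> with transpose \<open>k'\<close> is the counit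
    \<open>e\<close> after \<open>La k'\<close>, and both factors are weak equivalences. Conversely
    \<open>k'\<close> is \<open>Sa i\<close> after \<open>\<eta> x\<close>, so two-of-three then
    reaches \<open>\<eta> x\<close>.\<close>
  have "Cm D e (La k') = i"
    by (rule L.transpose_inj [OF xO left.dom.Cm_hom [OF Lk'(1) e(1)] ip(1)])
      (simp add: L.transpose_Cm_left [OF k' e(1)] e left.cod.Idt_Cm_hom [OF k'] k'_def [symmetric])
  then have "i \<in> WE N"
    using MD.WE_Cm [OF Lk'(1) e(1) Lk'(2) eW] by simp
  then have "Sa i \<in> WE M" by (simp add: WE_N)
  then show ?thesis
    using MC.WE_cancel_left [OF L.unit_in [OF xO] left.Fa_hom [OF ip(1)]] k'W
    by (simp add: k'_def L.transpose_def)
qed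

lemma left_quillen_equivalence:
  assumes adj: "adjunction C D Lo La So Sa \<eta>"
  shows "quillen_equivalence C M D N Lo La So Sa \<eta>"
proof -
  interpret L: quillen_adjunction C M D N Lo La So Sa \<eta> by (rule left_quillen [OF adj])
  show ?thesis
  proof (unfold_locales, goal_cases)
    case (1 x y g)
    have x: "x \<in> Ob C" using 1 by (simp add: cofibrant_def)
    \<comment> \<open>The terminal object needed by \<open>left_unit_WE\<close> is the witness
      contained in the fibrancy of \<open>y\<close>.\<close>
    obtain t where "terminal_object D t" using 1 unfolding fibrant_def by blast
    then have \<eta>: "\<eta> x \<in> WE M" by (rule left_unit_WE [OF adj 1(1)])
    note Sg = left.Fa_hom [OF 1(3)] and \<eta>' = L.unit_in [OF x]
    have "g \<in> WE N \<longleftrightarrow> Sa g \<in> WE M" using 1(3) by (simp add: WE_N hom_def)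
    also have "\<dots> \<longleftrightarrow> Cm C (Sa g) (\<eta> x) \<in> WE M"
      using MC.WE_Cm [OF \<eta>' Sg \<eta>] MC.WE_cancel_right [OF \<eta>' Sg \<eta>] by blast
    finally show ?case .
  qed
qed

end

section \<open>The categories of double categories and of 2-categories\<close>

lemmas is_functor_intros = is_functor.intro is_functor_axioms.intro

text \<open>The sets \<open>S\<close> and \<open>T\<close> are kept apart from the carriers: a
  component map of a double functor or 2-functor is cut off at one named carrier, but also acts on
  another category whose carrier is only provably the same.\<close>

lemma is_functor_compose:
  assumes "is_functor C D Fo Fa" "is_functor D E Go Ga" "S = Ob C" "T = Ar C"
  shows "is_functor C E (compose S Go Fo) (compose T Ga Fa)"
proof -
  interpret F: is_functor C D Fo Fa by fact
  interpret G: is_functor D E Go Ga by fact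
  show ?thesis
    by unfold_locales
      (auto simp: assms compose_def F.dom.Dm_in F.dom.Cd_in F.dom.Idt_in F.dom.Cm_in F.Fo_in F.Fa_in
        F.Fa_Dm F.Fa_Cd F.Fa_Idt F.Fa_Cm G.Fo_in G.Fa_in G.Fa_Dm G.Fa_Cd G.Fa_Idt G.Fa_Cm)
qed

lemma is_functor_restrict_id:
  assumes "category C" "S = Ob C" "T = Ar C"
  shows "is_functor C C (restrict id S) (restrict id T)"
proof -
  interpret category C by fact
  show ?thesis
    by unfold_locales (auto simp: assms Dm_in Cd_in Idt_in Cm_in)
qed

lemma DblCat_simps [simp]:
  "A \<in> Ob (DblCat \<kappa>) \<longleftrightarrow> small_double_category \<kappa> A"
  "F \<in> Ar (DblCat \<kappa>) \<longleftrightarrow> double_functor F \<and>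
    small_double_category \<kappa> (dsrc F) \<and> small_double_category \<kappa> (dtgt F)"
  "Dm (DblCat \<kappa>) = dsrc" "Cd (DblCat \<kappa>) = dtgt"
  by (simp_all add: DblCat_def)

lemma TwoCat_simps [simp]:
  "A \<in> Ob (TwoCat \<kappa>) \<longleftrightarrow> small_two_category \<kappa> A"
  "F \<in> Ar (TwoCat \<kappa>) \<longleftrightarrow> two_functor F \<and>
    small_two_category \<kappa> (tsrc F) \<and> small_two_category \<kappa> (ttgt F)"
  "Dm (TwoCat \<kappa>) = tsrc" "Cd (TwoCat \<kappa>) = ttgt"
  by (simp_all add: TwoCat_def)

lemma DblCat_Idt_simps [simp]:
  "dsrc (Idt (DblCat \<kappa>) A) = A" "dtgt (Idt (DblCat \<kappa>) A) = A"
  "dfo (Idt (DblCat \<kappa>) A) = restrict id (Ob (Hor A))"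
  "dfh (Idt (DblCat \<kappa>) A) = restrict id (Ar (Hor A))"
  "dfv (Idt (DblCat \<kappa>) A) = restrict id (Ar (Ver A))"
  "dfs (Idt (DblCat \<kappa>) A) = restrict id (Ar (HSq A))"
  by (simp_all add: DblCat_def)

lemma DblCat_Cm_simps [simp]:
  "dsrc (Cm (DblCat \<kappa>) G F) = dsrc F" "dtgt (Cm (DblCat \<kappa>) G F) = dtgt G"
  "dfo (Cm (DblCat \<kappa>) G F) = compose (Ob (Hor (dsrc F))) (dfo G) (dfo F)"
  "dfh (Cm (DblCat \<kappa>) G F) = compose (Ar (Hor (dsrc F))) (dfh G) (dfh F)"
  "dfv (Cm (DblCat \<kappa>) G F) = compose (Ar (Ver (dsrc F))) (dfv G) (dfv F)"
  "dfs (Cm (DblCat \<kappa>) G F) = compose (Ar (HSq (dsrc F))) (dfs G) (dfs F)"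
  by (simp_all add: DblCat_def)

lemma TwoCat_Idt_simps [simp]:
  "tsrc (Idt (TwoCat \<kappa>) A) = A" "ttgt (Idt (TwoCat \<kappa>) A) = A"
  "tf0 (Idt (TwoCat \<kappa>) A) = restrict id (Ob (One A))"
  "tf1 (Idt (TwoCat \<kappa>) A) = restrict id (Ar (One A))"
  "tf2 (Idt (TwoCat \<kappa>) A) = restrict id (Ar (VTwo A))"
  by (simp_all add: TwoCat_def)

lemma TwoCat_Cm_simps [simp]:
  "tsrc (Cm (TwoCat \<kappa>) G F) = tsrc F" "ttgt (Cm (TwoCat \<kappa>) G F) = ttgt G"
  "tf0 (Cm (TwoCat \<kappa>) G F) = compose (Ob (One (tsrc F))) (tf0 G) (tf0 F)"
  "tf1 (Cm (TwoCat \<kappa>) G F) = compose (Ar (One (tsrc F))) (tf1 G) (tf1 F)"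
  "tf2 (Cm (TwoCat \<kappa>) G F) = compose (Ar (VTwo (tsrc F))) (tf2 G) (tf2 F)"
  by (simp_all add: TwoCat_def)

lemma double_functor_eqI:
  assumes "double_functor F" "double_functor G" "dsrc F = dsrc G" "dtgt F = dtgt G"
    and "\<And>x. x \<in> Ob (Hor (dsrc G)) \<Longrightarrow> dfo F x = dfo G x"
    and "\<And>f. f \<in> Ar (Hor (dsrc G)) \<Longrightarrow> dfh F f = dfh G f"
    and "\<And>u. u \<in> Ar (Ver (dsrc G)) \<Longrightarrow> dfv F u = dfv G u"
    and "\<And>s. s \<in> Ar (HSq (dsrc G)) \<Longrightarrow> dfs F s = dfs G s"
  shows "F = G"
proof -
  have "dfo F = dfo G" "dfh F = dfh G" "dfv F = dfv G" "dfs F = dfs G"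
    using assms unfolding double_functor_def by (auto intro: extensionalityI)
  then show ?thesis using assms by simp
qed

lemma two_functor_eqI:
  assumes "two_functor F" "two_functor G" "tsrc F = tsrc G" "ttgt F = ttgt G"
    and "\<And>x. x \<in> Ob (One (tsrc G)) \<Longrightarrow> tf0 F x = tf0 G x"
    and "\<And>f. f \<in> Ar (One (tsrc G)) \<Longrightarrow> tf1 F f = tf1 G f"
    and "\<And>\<alpha>. \<alpha> \<in> Ar (VTwo (tsrc G)) \<Longrightarrow> tf2 F \<alpha> = tf2 G \<alpha>"
  shows "F = G"
proof -
  have "tf0 F = tf0 G" "tf1 F = tf1 G" "tf2 F = tf2 G"
    using assms unfolding two_functor_def by (auto intro: extensionalityI)
  then show ?thesis using assms by simp
qed

lemma double_functor_Idt: "double_category A \<Longrightarrow> double_functor (Idt (DblCat \<kappa>) A)"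
  unfolding double_functor_def
  by (auto intro!: is_functor_restrict_id double_category.axioms
      simp: double_category.Ob_Ver double_category.Ob_HSq double_category.Ob_VSq
        double_category.Ar_VSq)

lemma double_functor_Cm:
  assumes "double_functor F" "double_functor G" "dtgt F = dsrc G"
  shows "double_functor (Cm (DblCat \<kappa>) G F)"
  using assms unfolding double_functor_def
  by (auto intro!: is_functor_compose
      simp: double_category.Ob_Ver double_category.Ob_HSq double_category.Ob_VSq
        double_category.Ar_VSq)

lemma two_functor_Idt: "two_category A \<Longrightarrow> two_functor (Idt (TwoCat \<kappa>) A)"
  unfolding two_functor_def
  by (auto intro!: is_functor_restrict_id two_category.axioms
      simp: two_category.Ob_HTwo two_category.Ob_VTwo two_category.Ar_HTwo)

lemma two_functor_Cm:
  assumes "two_functor F" "two_functor G" "ttgt F = tsrc G"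
  shows "two_functor (Cm (TwoCat \<kappa>) G F)"
  using assms unfolding two_functor_def
  by (auto intro!: is_functor_compose
      simp: two_category.Ob_HTwo two_category.Ob_VTwo two_category.Ar_HTwo)

lemma double_functorD:
  assumes "double_functor F"
  shows "double_category (dsrc F)" "double_category (dtgt F)"
    "is_functor (Hor (dsrc F)) (Hor (dtgt F)) (dfo F) (dfh F)"
    "is_functor (Ver (dsrc F)) (Ver (dtgt F)) (dfo F) (dfv F)"
    "is_functor (HSq (dsrc F)) (HSq (dtgt F)) (dfv F) (dfs F)"
    "is_functor (VSq (dsrc F)) (VSq (dtgt F)) (dfh F) (dfs F)"
  using assms by (simp_all add: double_functor_def)

lemmas double_functor_maps =
  is_functor.Fo_in [OF double_functorD(3)] is_functor.Fa_in [OF double_functorD(3)]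
  is_functor.Fa_in [OF double_functorD(4)] is_functor.Fa_in [OF double_functorD(5)]
  is_functor.Fa_Dm [OF double_functorD(3)] is_functor.Fa_Cd [OF double_functorD(3)]
  is_functor.Fa_Dm [OF double_functorD(4)] is_functor.Fa_Cd [OF double_functorD(4)]
  is_functor.Fa_Dm [OF double_functorD(5)] is_functor.Fa_Cd [OF double_functorD(5)]
  is_functor.Fa_Dm [OF double_functorD(6)] is_functor.Fa_Cd [OF double_functorD(6)]
  is_functor.Fa_Idt [OF double_functorD(3)] is_functor.Fa_Idt [OF double_functorD(4)]
  is_functor.Fa_Idt [OF double_functorD(6)] is_functor.Fa_Idt [OF double_functorD(5)]
  is_functor.Fa_Cm [OF double_functorD(3)] is_functor.Fa_Cm [OF double_functorD(4)]
  is_functor.Fa_Cm [OF double_functorD(5)] is_functor.Fa_Cm [OF double_functorD(6)]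
  double_category.Ob_Ver [OF double_functorD(1)] double_category.Ob_HSq [OF double_functorD(1)]
  double_category.Ob_VSq [OF double_functorD(1)] double_category.Ar_VSq [OF double_functorD(1)]

lemma two_functorD:
  assumes "two_functor F"
  shows "two_category (tsrc F)" "two_category (ttgt F)"
    "is_functor (One (tsrc F)) (One (ttgt F)) (tf0 F) (tf1 F)"
    "is_functor (VTwo (tsrc F)) (VTwo (ttgt F)) (tf1 F) (tf2 F)"
    "is_functor (HTwo (tsrc F)) (HTwo (ttgt F)) (tf0 F) (tf2 F)"
  using assms by (simp_all add: two_functor_def)

lemmas two_functor_maps =
  is_functor.Fo_in [OF two_functorD(3)] is_functor.Fa_in [OF two_functorD(3)]
  is_functor.Fa_in [OF two_functorD(4)] is_functor.Fa_Dm [OF two_functorD(3)]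
  is_functor.Fa_Cd [OF two_functorD(3)] is_functor.Fa_Dm [OF two_functorD(4)]
  is_functor.Fa_Cd [OF two_functorD(4)] is_functor.Fa_Idt [OF two_functorD(3)]
  is_functor.Fa_Idt [OF two_functorD(4)] is_functor.Fa_Cm [OF two_functorD(3)]
  is_functor.Fa_Cm [OF two_functorD(4)] is_functor.Fa_Cm [OF two_functorD(5)]
  two_category.Ob_HTwo [OF two_functorD(1)] two_category.Ob_VTwo [OF two_functorD(1)]
  two_category.Ar_HTwo [OF two_functorD(1)]

lemma category_DblCat: "category (DblCat \<kappa>)"
proof (unfold_locales, goal_cases)
  case (3 A)
  then show ?case by (simp add: small_double_category_def double_functor_Idt)
next
  case (6 F G)
  then show ?case by (simp add: double_functor_Cm)
next
  case (9 F)
  then show ?case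
    by (intro double_functor_eqI double_functor_Cm double_functor_Idt)
      (auto simp: compose_def double_functor_def)
next
  case (10 F)
  then show ?case
    by (intro double_functor_eqI double_functor_Cm double_functor_Idt)
      (auto simp: compose_def double_functor_maps(1-4), auto simp: double_functor_def)
next
  case (11 F G H)
  then show ?case
    by (intro double_functor_eqI double_functor_Cm)
      (auto simp: compose_def dest: double_functor_maps(1-4))
qed simp_all

lemma category_TwoCat: "category (TwoCat \<kappa>)"
proof (unfold_locales, goal_cases)
  case (3 A)
  then show ?case by (simp add: small_two_category_def two_functor_Idt)
next
  case (6 F G)
  then show ?case by (simp add: two_functor_Cm)
next
  case (9 F)
  then show ?case
    by (intro two_functor_eqI two_functor_Cm two_functor_Idt)
      (auto simp: compose_def two_functor_def)
next
  case (10 F)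
  then show ?case
    by (intro two_functor_eqI two_functor_Cm two_functor_Idt)
      (auto simp: compose_def two_functor_maps(1-3), auto simp: two_functor_def)
next
  case (11 F G H)
  then show ?case
    by (intro two_functor_eqI two_functor_Cm)
      (auto simp: compose_def dest: two_functor_maps(1-3))
qed simp_all

section \<open>Calculus of cells in a 2-category\<close>

context category
begin

text \<open>The endpoint is a separate variable, so that simplification can use the unit law at an
  object that is only provably equal to the endpoint.\<close>

lemma Cm_Idt_eq: "\<lbrakk>f \<in> Ar C; Dm C f = x\<rbrakk> \<Longrightarrow> Cm C f (Idt C x) = f"
  using Cm_Idt by auto

lemma Idt_Cm_eq: "\<lbrakk>f \<in> Ar C; Cd C f = x\<rbrakk> \<Longrightarrow> Cm C (Idt C x) f = f"
  using Idt_Cm by auto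

lemma Cm_assoc_right: "\<lbrakk>f \<in> Ar C; g \<in> Ar C; h \<in> Ar C; Cd C f = Dm C g; Cd C g = Dm C h\<rbrakk>
      \<Longrightarrow> Cm C (Cm C h g) f = Cm C h (Cm C g f)"
  using Cm_assoc by simp

lemmas Cm_simps = Dm_in Cd_in Idt_in Dm_Idt Cd_Idt Cm_in Dm_Cm Cd_Cm Cm_Idt_eq Idt_Cm_eq
  Cm_assoc_right

end

context two_category
begin

lemma Dm_HTwo: "\<alpha> \<in> Ar (VTwo A) \<Longrightarrow> Dm (HTwo A) \<alpha> = Dm (One A) (Dm (VTwo A) \<alpha>)"
  and Cd_HTwo: "\<alpha> \<in> Ar (VTwo A) \<Longrightarrow> Cd (HTwo A) \<alpha> = Cd (One A) (Dm (VTwo A) \<alpha>)"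
  by (simp_all add: Dm_Dm Cd_Dm)

text \<open>The horizontal source and target of a 2-cell are expressed through its source 1-cell, so that
  all side conditions below reduce to equations between 1-cells.\<close>

lemma HTwo_comp:
  assumes "\<alpha> \<in> Ar (VTwo A)" "\<beta> \<in> Ar (VTwo A)"
    "Cd (One A) (Dm (VTwo A) \<alpha>) = Dm (One A) (Dm (VTwo A) \<beta>)"
  shows "Cm (HTwo A) \<beta> \<alpha> \<in> Ar (VTwo A)"
    and "Dm (VTwo A) (Cm (HTwo A) \<beta> \<alpha>) = Cm (One A) (Dm (VTwo A) \<beta>) (Dm (VTwo A) \<alpha>)"
    and "Cd (VTwo A) (Cm (HTwo A) \<beta> \<alpha>) = Cm (One A) (Cd (VTwo A) \<beta>) (Cd (VTwo A) \<alpha>)"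
  using assms htwo.Cm_in [of \<alpha> \<beta>] Dm_Cm_HTwo [of \<alpha> \<beta>] Cd_Cm_HTwo [of \<alpha> \<beta>]
  by (simp_all add: Ar_HTwo Dm_HTwo Cd_HTwo)

lemma HTwo_assoc:
  "\<lbrakk>\<alpha> \<in> Ar (VTwo A); \<beta> \<in> Ar (VTwo A); \<gamma> \<in> Ar (VTwo A);
    Cd (One A) (Dm (VTwo A) \<alpha>) = Dm (One A) (Dm (VTwo A) \<beta>);
    Cd (One A) (Dm (VTwo A) \<beta>) = Dm (One A) (Dm (VTwo A) \<gamma>)\<rbrakk>
  \<Longrightarrow> Cm (HTwo A) (Cm (HTwo A) \<gamma> \<beta>) \<alpha> = Cm (HTwo A) \<gamma> (Cm (HTwo A) \<beta> \<alpha>)"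
  using htwo.Cm_assoc by (simp add: Ar_HTwo Dm_HTwo Cd_HTwo)

lemma HTwo_Idt_Idt:
  "\<lbrakk>f \<in> Ar (One A); g \<in> Ar (One A); Cd (One A) f = Dm (One A) g\<rbrakk>
  \<Longrightarrow> Cm (HTwo A) (Idt (VTwo A) g) (Idt (VTwo A) f) = Idt (VTwo A) (Cm (One A) g f)"
  by (simp add: Idt_Cm_One)

lemma HTwo_Idt_Idt_assoc:
  assumes "f \<in> Ar (One A)" "g \<in> Ar (One A)" "\<alpha> \<in> Ar (VTwo A)" "Cd (One A) f = Dm (One A) g"
    "Cd (One A) (Dm (VTwo A) \<alpha>) = Dm (One A) f"
  shows "Cm (HTwo A) (Idt (VTwo A) g) (Cm (HTwo A) (Idt (VTwo A) f) \<alpha>) =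
    Cm (HTwo A) (Idt (VTwo A) (Cm (One A) g f)) \<alpha>"
  using assms HTwo_assoc [of \<alpha> "Idt (VTwo A) f" "Idt (VTwo A) g"]
  by (simp add: HTwo_Idt_Idt vtwo.Cm_simps Ob_VTwo)

lemma HTwo_unit_right:
  "\<lbrakk>\<alpha> \<in> Ar (VTwo A); Dm (One A) (Dm (VTwo A) \<alpha>) = x\<rbrakk>
  \<Longrightarrow> Cm (HTwo A) \<alpha> (Idt (VTwo A) (Idt (One A) x)) = \<alpha>"
  using htwo.Cm_Idt_eq [of \<alpha> x] Idt_HTwo [of x] htwo.Dm_in [of \<alpha>]
  by (auto simp: Ar_HTwo Dm_HTwo Ob_HTwo)

lemma HTwo_unit_left:
  "\<lbrakk>\<alpha> \<in> Ar (VTwo A); Cd (One A) (Dm (VTwo A) \<alpha>) = x\<rbrakk>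
  \<Longrightarrow> Cm (HTwo A) (Idt (VTwo A) (Idt (One A) x)) \<alpha> = \<alpha>"
  using htwo.Idt_Cm_eq [of \<alpha> x] Idt_HTwo [of x] htwo.Cd_in [of \<alpha>]
  by (auto simp: Ar_HTwo Cd_HTwo Ob_HTwo)

lemma HTwo_VTwo:
  "\<lbrakk>\<alpha> \<in> Ar (VTwo A); \<beta> \<in> Ar (VTwo A); \<alpha>' \<in> Ar (VTwo A); \<beta>' \<in> Ar (VTwo A);
    Cd (One A) (Dm (VTwo A) \<alpha>) = Dm (One A) (Dm (VTwo A) \<beta>);
    Cd (VTwo A) \<alpha> = Dm (VTwo A) \<alpha>'; Cd (VTwo A) \<beta> = Dm (VTwo A) \<beta>'\<rbrakk>
  \<Longrightarrow> Cm (HTwo A) (Cm (VTwo A) \<beta>' \<beta>) (Cm (VTwo A) \<alpha>' \<alpha>) =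
    Cm (VTwo A) (Cm (HTwo A) \<beta>' \<alpha>') (Cm (HTwo A) \<beta> \<alpha>)"
  using interchange [of \<alpha> \<beta> \<alpha>' \<beta>'] Cd_Cd [of \<alpha>] Dm_Cd [of \<beta>]
  by (simp add: Dm_HTwo Cd_HTwo)

lemma whisker_left_VTwo:
  "\<lbrakk>\<alpha> \<in> Ar (VTwo A); \<alpha>' \<in> Ar (VTwo A); g \<in> Ar (One A);
    Cd (One A) (Dm (VTwo A) \<alpha>) = Dm (One A) g; Cd (VTwo A) \<alpha> = Dm (VTwo A) \<alpha>'\<rbrakk>
  \<Longrightarrow> Cm (HTwo A) (Idt (VTwo A) g) (Cm (VTwo A) \<alpha>' \<alpha>) =
    Cm (VTwo A) (Cm (HTwo A) (Idt (VTwo A) g) \<alpha>') (Cm (HTwo A) (Idt (VTwo A) g) \<alpha>)"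
  using HTwo_VTwo [of \<alpha> "Idt (VTwo A) g" \<alpha>' "Idt (VTwo A) g"]
  by (simp add: vtwo.Cm_simps Ob_VTwo)

lemma whisker_right_VTwo:
  "\<lbrakk>\<beta> \<in> Ar (VTwo A); \<beta>' \<in> Ar (VTwo A); f \<in> Ar (One A);
    Cd (One A) f = Dm (One A) (Dm (VTwo A) \<beta>); Cd (VTwo A) \<beta> = Dm (VTwo A) \<beta>'\<rbrakk>
  \<Longrightarrow> Cm (HTwo A) (Cm (VTwo A) \<beta>' \<beta>) (Idt (VTwo A) f) =
    Cm (VTwo A) (Cm (HTwo A) \<beta>' (Idt (VTwo A) f)) (Cm (HTwo A) \<beta> (Idt (VTwo A) f))"
  using HTwo_VTwo [of "Idt (VTwo A) f" \<beta> "Idt (VTwo A) f" \<beta>']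
  by (simp add: vtwo.Cm_simps Ob_VTwo)

lemmas cell_simps = Ob_VTwo one.Cm_simps vtwo.Cm_simps HTwo_comp HTwo_assoc HTwo_Idt_Idt
  HTwo_Idt_Idt_assoc HTwo_unit_left HTwo_unit_right whisker_left_VTwo whisker_right_VTwo

text \<open>Interchange against identity 2-cells. Kept out of \<open>cell_simps\<close> and invoked
  only where two independent cells must trade places or merge into a horizontal composite.\<close>

lemma whisker_exchange:
  assumes "\<alpha> \<in> Ar (VTwo A)" "\<beta> \<in> Ar (VTwo A)"
    "Dm (VTwo A) \<alpha> = f" "Cd (VTwo A) \<alpha> = f'" "Dm (VTwo A) \<beta> = g" "Cd (VTwo A) \<beta> = g'"
    "Cd (One A) f = Dm (One A) g"
  shows "Cm (VTwo A) (Cm (HTwo A) (Idt (VTwo A) g') \<alpha>) (Cm (HTwo A) \<beta> (Idt (VTwo A) f)) = Cm (HTwo A) \<beta> \<alpha>"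
    and "Cm (VTwo A) (Cm (HTwo A) \<beta> (Idt (VTwo A) f')) (Cm (HTwo A) (Idt (VTwo A) g) \<alpha>) = Cm (HTwo A) \<beta> \<alpha>"
proof -
  have [simp]: "f \<in> Ar (One A)" "f' \<in> Ar (One A)" "g \<in> Ar (One A)" "g' \<in> Ar (One A)"
    using assms vtwo.Dm_in vtwo.Cd_in Ob_VTwo by auto
  have "Cd (One A) f' = Dm (One A) g" "Dm (One A) g' = Dm (One A) g"
    using assms Cd_Cd [of \<alpha>] Cd_Dm [of \<alpha>] Dm_Cd [of \<beta>] Dm_Dm [of \<beta>] by auto
  then show "Cm (VTwo A) (Cm (HTwo A) (Idt (VTwo A) g') \<alpha>) (Cm (HTwo A) \<beta> (Idt (VTwo A) f)) = Cm (HTwo A) \<beta> \<alpha>"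
    and "Cm (VTwo A) (Cm (HTwo A) \<beta> (Idt (VTwo A) f')) (Cm (HTwo A) (Idt (VTwo A) g) \<alpha>) = Cm (HTwo A) \<beta> \<alpha>"
    using assms HTwo_VTwo [of "Idt (VTwo A) f" \<beta> \<alpha> "Idt (VTwo A) g'"]
      HTwo_VTwo [of \<alpha> "Idt (VTwo A) g" "Idt (VTwo A) f'" \<beta>]
    by (simp_all add: Ob_VTwo vtwo.Cm_simps)
qed

end

section \<open>The double category of squares of a 2-category\<close>

text \<open>An infinite type of cells absorbs its finite powers. This makes the chosen
  \<open>enc\<close> injective on the triples, quadruples and quintuples that are used as
  cells.\<close>

locale coding =
  fixes U :: "'u itself"
  assumes infinite_cells: "infinite (UNIV :: 'u set)"
begin

lemma ex_inj_pair: "\<exists>e :: 'u \<times> 'u \<Rightarrow> 'u. inj e"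
proof -
  have "|UNIV \<times> UNIV :: ('u \<times> 'u) set| =o |UNIV :: 'u set|"
    by (rule card_of_Times_same_infinite [OF infinite_cells])
  then have "\<exists>e. bij_betw e (UNIV \<times> UNIV :: ('u \<times> 'u) set) (UNIV :: 'u set)"
    by (simp only: card_of_ordIso)
  then show ?thesis by (auto simp: bij_betw_def)
qed

lemma ex_inj_times:
  assumes "\<exists>e :: 'a \<Rightarrow> 'u. inj e"
  shows "\<exists>e :: 'u \<times> 'a \<Rightarrow> 'u. inj e"
proof -
  obtain p :: "'u \<times> 'u \<Rightarrow> 'u" where p: "inj p"
    using ex_inj_pair by (rule exE)
  obtain e :: "'a \<Rightarrow> 'u" where e: "inj e"
    using assms by (rule exE)
  have "inj (p \<circ> map_prod id e)"
    by (intro inj_compose p prod.inj_map inj_on_id e)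
  then show ?thesis by (rule exI [where P = inj])
qed

lemma inj_enc: "\<exists>e :: 'a \<Rightarrow> 'u. inj e \<Longrightarrow> inj (enc :: 'a \<Rightarrow> 'u)"
  unfolding enc_def by (rule someI_ex [where P = inj])

lemma dec_enc: "\<exists>e :: 'a \<Rightarrow> 'u. inj e \<Longrightarrow> dec (enc (x :: 'a) :: 'u) = x"
  unfolding dec_def by (rule inv_f_f [OF inj_enc])

lemma dec_enc_3 [simp]: "dec (enc (x :: 'u \<times> 'u \<times> 'u) :: 'u) = x"
  and dec_enc_4 [simp]: "dec (enc (y :: 'u \<times> 'u \<times> 'u \<times> 'u) :: 'u) = y"
  and dec_enc_5 [simp]: "dec (enc (z :: 'u \<times> 'u \<times> 'u \<times> 'u \<times> 'u) :: 'u) = z"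
  by (rule dec_enc [OF ex_inj_times [OF ex_inj_pair]],
    rule dec_enc [OF ex_inj_times [OF ex_inj_times [OF ex_inj_pair]]],
    rule dec_enc [OF ex_inj_times [OF ex_inj_times [OF ex_inj_times [OF ex_inj_pair]]]])

lemma enc_eq_3 [simp]: "(enc (x :: 'u \<times> 'u \<times> 'u) :: 'u) = enc y \<longleftrightarrow> x = y"
  by (rule inj_eq [OF inj_enc [OF ex_inj_times [OF ex_inj_pair]]])

lemma enc_eq_4 [simp]: "(enc (x :: 'u \<times> 'u \<times> 'u \<times> 'u) :: 'u) = enc y \<longleftrightarrow> x = y"
  by (rule inj_eq [OF inj_enc [OF ex_inj_times [OF ex_inj_times [OF ex_inj_pair]]]])

lemma enc_eq_5 [simp]: "(enc (x :: 'u \<times> 'u \<times> 'u \<times> 'u \<times> 'u) :: 'u) = enc y \<longleftrightarrow> x = y"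
  by (rule inj_eq [OF inj_enc [OF ex_inj_times [OF ex_inj_times [OF ex_inj_times [OF ex_inj_pair]]]]])

lemma Sq_simps [simp]:
  fixes A :: "'u twocat" and f f' g g' u u' v v' w \<alpha> \<beta> :: 'u
  shows "Hor (Sq A) = One A" "Ver (Sq A) = One A"
    "Ob (HSq (Sq A)) = Ar (One A)" "Ob (VSq (Sq A)) = Ar (One A)"
    "Ar (VSq (Sq A)) = Ar (HSq (Sq A))"
    "Dm (HSq (Sq A)) (enc (f, f', u, v, \<alpha>)) = u"
    "Cd (HSq (Sq A)) (enc (f, f', u, v, \<alpha>)) = v"
    "Dm (VSq (Sq A)) (enc (f, f', u, v, \<alpha>)) = f"
    "Cd (VSq (Sq A)) (enc (f, f', u, v, \<alpha>)) = f'"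
    "Idt (HSq (Sq A)) u =
      enc (Idt (One A) (Dm (One A) u), Idt (One A) (Cd (One A) u), u, u, Idt (VTwo A) u)"
    "Idt (VSq (Sq A)) f =
      enc (f, f, Idt (One A) (Dm (One A) f), Idt (One A) (Cd (One A) f), Idt (VTwo A) f)"
    "Cm (HSq (Sq A)) (enc (g, g', v', w, \<beta>)) (enc (f, f', u, v, \<alpha>)) =
      enc (Cm (One A) g f, Cm (One A) g' f', u, w,
        Cm (VTwo A) (Cm (HTwo A) (Idt (VTwo A) g') \<alpha>) (Cm (HTwo A) \<beta> (Idt (VTwo A) f)))"
    "Cm (VSq (Sq A)) (enc (g, g', u', v', \<beta>)) (enc (f, f', u, v, \<alpha>)) =
      enc (f, g', Cm (One A) u' u, Cm (One A) v' v,
        Cm (VTwo A) (Cm (HTwo A) \<beta> (Idt (VTwo A) u)) (Cm (HTwo A) (Idt (VTwo A) v') \<alpha>))"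
  by (simp_all add: Sq_def)

lemma enc_mem_Sq [simp]:
  fixes A :: "'u twocat" and f f' u v \<alpha> :: 'u
  shows "enc (f, f', u, v, \<alpha>) \<in> Ar (HSq (Sq A)) \<longleftrightarrow>
    f \<in> Ar (One A) \<and> f' \<in> Ar (One A) \<and> u \<in> Ar (One A) \<and> v \<in> Ar (One A) \<and> \<alpha> \<in> Ar (VTwo A) \<and>
    Dm (One A) f = Dm (One A) u \<and> Cd (One A) f = Dm (One A) v \<and>
    Dm (One A) f' = Cd (One A) u \<and> Cd (One A) f' = Cd (One A) v \<and>
    Dm (VTwo A) \<alpha> = Cm (One A) v f \<and> Cd (VTwo A) \<alpha> = Cm (One A) f' u"
  by (auto simp: Sq_def Sq_cells_def hom_def image_iff)

text \<open>Naming the four corners turns all boundary conditions into rewrite rules toward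
  variables, which is what the simplification of pastings relies on.\<close>

lemma Sq_cellE:
  fixes A :: "'u twocat"
  assumes "s \<in> Ar (HSq (Sq A))"
  obtains f f' u v \<alpha> a b c d :: 'u where "s = enc (f, f', u, v, \<alpha>)"
    "f \<in> Ar (One A)" "f' \<in> Ar (One A)" "u \<in> Ar (One A)" "v \<in> Ar (One A)" "\<alpha> \<in> Ar (VTwo A)"
    "Dm (One A) f = a" "Cd (One A) f = b" "Dm (One A) f' = c" "Cd (One A) f' = d"
    "Dm (One A) u = a" "Cd (One A) u = c" "Dm (One A) v = b" "Cd (One A) v = d"
    "Dm (VTwo A) \<alpha> = Cm (One A) v f" "Cd (VTwo A) \<alpha> = Cm (One A) f' u"
proof -
  obtain f f' u v \<alpha> :: 'u where s: "s = enc (f, f', u, v, \<alpha>)"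
    using assms by (auto simp: Sq_def)
  show thesis
    by (rule that [OF s]) (use assms in \<open>simp_all add: s\<close>)
qed

lemma double_category_Sq:
  fixes A :: "'u twocat"
  assumes "two_category A"
  shows "double_category (Sq A)"
proof -
  interpret two_category A by fact
  note [simp] = cell_simps
  have HSq: "category (HSq (Sq A))"
  proof (unfold_locales, goal_cases)
    case (11 s t r)
    then show ?case
      by (auto elim!: Sq_cellE)
  qed (auto elim!: Sq_cellE)
  have VSq: "category (VSq (Sq A))"
  proof (unfold_locales, goal_cases)
    case (11 s t r)
    then show ?case
      by (auto elim!: Sq_cellE)
  qed (auto elim!: Sq_cellE)
  have ic: "Cm (VSq (Sq A)) (Cm (HSq (Sq A)) t' s') (Cm (HSq (Sq A)) t s)
        = Cm (HSq (Sq A)) (Cm (VSq (Sq A)) t' t) (Cm (VSq (Sq A)) s' s)"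
    if sq: "s \<in> Ar (HSq (Sq A))" "t \<in> Ar (HSq (Sq A))" "s' \<in> Ar (HSq (Sq A))" "t' \<in> Ar (HSq (Sq A))"
      "Cd (HSq (Sq A)) s = Dm (HSq (Sq A)) t" "Cd (HSq (Sq A)) s' = Dm (HSq (Sq A)) t'"
      "Cd (VSq (Sq A)) s = Dm (VSq (Sq A)) s'" "Cd (VSq (Sq A)) t = Dm (VSq (Sq A)) t'" for s t s' t'
  proof -
    obtain f f' u v \<alpha> a b c d where s: "s = enc (f, f', u, v, \<alpha>)" and [simp]:
      "f \<in> Ar (One A)" "f' \<in> Ar (One A)" "u \<in> Ar (One A)" "v \<in> Ar (One A)" "\<alpha> \<in> Ar (VTwo A)"
      "Dm (One A) f = a" "Cd (One A) f = b" "Dm (One A) f' = c" "Cd (One A) f' = d"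
      "Dm (One A) u = a" "Cd (One A) u = c" "Dm (One A) v = b" "Cd (One A) v = d"
      "Dm (VTwo A) \<alpha> = Cm (One A) v f" "Cd (VTwo A) \<alpha> = Cm (One A) f' u"
      using sq(1) by (rule Sq_cellE)
    obtain g g' w \<beta> x y where t: "t = enc (g, g', v, w, \<beta>)" and [simp]:
      "g \<in> Ar (One A)" "g' \<in> Ar (One A)" "w \<in> Ar (One A)" "\<beta> \<in> Ar (VTwo A)"
      "Dm (One A) g = b" "Cd (One A) g = x" "Dm (One A) g' = d" "Cd (One A) g' = y"
      "Dm (One A) w = x" "Cd (One A) w = y"
      "Dm (VTwo A) \<beta> = Cm (One A) w g" "Cd (VTwo A) \<beta> = Cm (One A) g' v"
      using sq(2,5) s by (auto elim!: Sq_cellE)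
    obtain f'' u' v' \<alpha>' c' d' where s': "s' = enc (f', f'', u', v', \<alpha>')" and [simp]:
      "f'' \<in> Ar (One A)" "u' \<in> Ar (One A)" "v' \<in> Ar (One A)" "\<alpha>' \<in> Ar (VTwo A)"
      "Dm (One A) f'' = c'" "Cd (One A) f'' = d'"
      "Dm (One A) u' = c" "Cd (One A) u' = c'" "Dm (One A) v' = d" "Cd (One A) v' = d'"
      "Dm (VTwo A) \<alpha>' = Cm (One A) v' f'" "Cd (VTwo A) \<alpha>' = Cm (One A) f'' u'"
      using sq(3,7) s by (auto elim!: Sq_cellE)
    obtain g'' w' \<beta>' y' where t': "t' = enc (g', g'', v', w', \<beta>')" and [simp]:
      "g'' \<in> Ar (One A)" "w' \<in> Ar (One A)" "\<beta>' \<in> Ar (VTwo A)"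
      "Dm (One A) g'' = d'" "Cd (One A) g'' = y'" "Dm (One A) w' = y" "Cd (One A) w' = y'"
      "Dm (VTwo A) \<beta>' = Cm (One A) w' g'" "Cd (VTwo A) \<beta>' = Cm (One A) g'' v'"
      using sq(4,6,8) t s' by (auto elim!: Sq_cellE)
    \<comment> \<open>In both normalized pastings the cell \<open>\<beta>\<close> comes first and
      \<open>\<alpha>'\<close> last. In between, \<open>\<alpha>\<close> (upper left) and
      \<open>\<beta>'\<close> (lower right) occur in opposite orders; exchanging these two is the
      whole content of interchange in \<open>Sq A\<close>.\<close>
    have "Cm (VTwo A) (Cm (HTwo A) \<beta>' (Idt (VTwo A) (Cm (One A) f' u)))
        (Cm (HTwo A) (Idt (VTwo A) (Cm (One A) w' g')) \<alpha>) =
      Cm (VTwo A) (Cm (HTwo A) (Idt (VTwo A) (Cm (One A) g'' v')) \<alpha>)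
        (Cm (HTwo A) \<beta>' (Idt (VTwo A) (Cm (One A) v f)))"
      using whisker_exchange [of \<alpha> \<beta>'] by simp
    from arg_cong [where f = "\<lambda>\<gamma>. Cm (VTwo A) \<gamma> (Cm (HTwo A) (Idt (VTwo A) w') (Cm (HTwo A) \<beta> (Idt (VTwo A) f)))", OF this]
    show ?thesis
      using s t s' t' by simp
  qed
  show ?thesis
    by (intro double_category.intro HSq VSq one.category_axioms double_category_axioms.intro)
      (use ic one.category_axioms in \<open>auto elim!: Sq_cellE\<close>)
qed

end

section \<open>The action of \<open>Sq\<close> on 2-functors\<close>

context coding
begin

lemma Sq_fun_simps [simp]:
  fixes F :: "'u twofun" and f f' u v \<alpha> :: 'u
  shows "dsrc (Sq_fun F) = Sq (tsrc F)" "dtgt (Sq_fun F) = Sq (ttgt F)"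
    "dfo (Sq_fun F) = tf0 F" "dfh (Sq_fun F) = tf1 F" "dfv (Sq_fun F) = tf1 F"
    "enc (f, f', u, v, \<alpha>) \<in> Ar (HSq (Sq (tsrc F))) \<Longrightarrow> dfs (Sq_fun F) (enc (f, f', u, v, \<alpha>)) =
      enc (tf1 F f, tf1 F f', tf1 F u, tf1 F v, tf2 F \<alpha>)"
    "dfs (Sq_fun F) \<in> extensional (Ar (HSq (Sq (tsrc F))))"
  by (simp_all add: Sq_fun_def)

lemma double_functor_Sq_fun:
  fixes F :: "'u twofun"
  assumes F: "two_functor F"
  shows "double_functor (Sq_fun F)"
proof -
  interpret A: two_category "tsrc F" using F by (simp add: two_functor_def)
  interpret B: two_category "ttgt F" using F by (simp add: two_functor_def)
  note [simp] = A.cell_simps B.cell_simps two_functor_maps [OF F] A.Dm_HTwo A.Cd_HTwo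
  have Sq: "double_category (Sq (tsrc F))" "double_category (Sq (ttgt F))"
    by (auto intro!: double_category_Sq A.two_category_axioms B.two_category_axioms)
  interpret SA: double_category "Sq (tsrc F)" by (rule Sq)
  interpret SB: double_category "Sq (ttgt F)" by (rule Sq)
  have "is_functor (HSq (Sq (tsrc F))) (HSq (Sq (ttgt F))) (tf1 F) (dfs (Sq_fun F))"
    by (intro is_functor.intro SA.hsq.category_axioms SB.hsq.category_axioms is_functor_axioms.intro)
      (auto elim!: Sq_cellE)
  moreover have "is_functor (VSq (Sq (tsrc F))) (VSq (Sq (ttgt F))) (tf1 F) (dfs (Sq_fun F))"
    by (intro is_functor.intro SA.vsq.category_axioms SB.vsq.category_axioms is_functor_axioms.intro)
      (auto elim!: Sq_cellE)
  ultimately show ?thesis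
    using F Sq unfolding double_functor_def two_functor_def by simp
qed

end

section \<open>Smallness\<close>

context
  fixes \<kappa> :: "'u rel"
  assumes \<kappa>: "universe \<kappa>"
begin

lemma universe_infinite: "infinite (Field \<kappa>)"
proof -
  have "natLeq \<le>o \<kappa>"
    using \<kappa> by (auto simp: universe_def intro: ordLess_imp_ordLeq)
  then show ?thesis
    using cinfinite_mono [OF _ natLeq_cinfinite] by (simp add: cinfinite_def)
qed

lemma universe_coding: "coding TYPE('u)"
  by (rule coding.intro) (rule infinite_super [OF subset_UNIV universe_infinite])

text \<open>A product of finite sets is below \<open>natLeq\<close>, hence below the uncountable
  \<open>\<kappa>\<close>. Otherwise the product is no larger than the disjoint sum, and sums stay
  below an infinite cardinal.\<close>

lemma universe_Times:
  assumes "|X| <o \<kappa>" "|Y| <o \<kappa>"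
  shows "|X \<times> Y| <o \<kappa>"
proof (cases "finite X \<and> finite Y")
  case True
  then have "|X \<times> Y| <o natLeq"
    by (simp add: finite_iff_ordLess_natLeq [symmetric])
  then show ?thesis
    using \<kappa> ordLess_transitive by (auto simp: universe_def)
next
  case False
  then have "|X \<times> Y| \<le>o |X <+> Y|"
    by (intro card_of_Times_ordLeq_infinite_Field)
      (auto simp: Field_card_of card_of_Plus1 card_of_Plus2 card_of_card_order_on)
  moreover have "|X <+> Y| <o \<kappa>"
    using card_of_Plus_ordLess_infinite_Field [OF universe_infinite _ assms] \<kappa>
    by (simp add: universe_def)
  ultimately show ?thesis by (rule ordLeq_ordLess_trans)
qed

lemma universe_image: "|X| <o \<kappa> \<Longrightarrow> Y \<subseteq> f ` X \<Longrightarrow> |Y| <o \<kappa>"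
  by (rule ordLeq_ordLess_trans [OF ordLeq_transitive [OF card_of_mono1 card_of_image]])

lemma small_double_category_Sq:
  assumes "small_two_category \<kappa> A"
  shows "small_double_category \<kappa> (Sq A)"
proof -
  interpret coding "TYPE('u)" by (rule universe_coding)
  have A: "two_category A" "|Ob (One A)| <o \<kappa>" "|Ar (One A)| <o \<kappa>" "|Ar (VTwo A)| <o \<kappa>"
    using assms by (auto simp: small_two_category_def small_def)
  have "|Ar (One A) \<times> Ar (One A) \<times> Ar (One A) \<times> Ar (One A) \<times> Ar (VTwo A)| <o \<kappa>"
    by (intro universe_Times A)
  moreover have "Ar (HSq (Sq A)) \<subseteq>
      enc ` (Ar (One A) \<times> Ar (One A) \<times> Ar (One A) \<times> Ar (One A) \<times> Ar (VTwo A))"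
    by (auto simp: Sq_def Sq_cells_def hom_def)
  ultimately have "|Ar (HSq (Sq A))| <o \<kappa>"
    by (rule universe_image)
  then show ?thesis
    using A double_category_Sq by (simp add: small_double_category_def small_def)
qed

lemma is_functor_Sq: "is_functor (TwoCat \<kappa>) (DblCat \<kappa>) Sq Sq_fun"
proof (intro is_functor.intro category_TwoCat category_DblCat is_functor_axioms.intro)
  interpret coding "TYPE('u)" by (rule universe_coding)
  note [simp] = small_double_category_Sq double_functor_Sq_fun
  fix A F G :: "'u twofun"
  assume F: "F \<in> Ar (TwoCat \<kappa>)"
  then show "Sq_fun F \<in> Ar (DblCat \<kappa>)" "Dm (DblCat \<kappa>) (Sq_fun F) = Sq (Dm (TwoCat \<kappa>) F)"
    "Cd (DblCat \<kappa>) (Sq_fun F) = Sq (Cd (TwoCat \<kappa>) F)" by simp_all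
  assume G: "G \<in> Ar (TwoCat \<kappa>)" and FG: "Cd (TwoCat \<kappa>) F = Dm (TwoCat \<kappa>) G"
  interpret A: two_category "tsrc F" using F by (simp add: two_functor_def)
  interpret B: two_category "tsrc G" using G by (simp add: two_functor_def)
  note [simp] = A.cell_simps B.cell_simps
  note two_functor_maps' = two_functor_maps [of F, unfolded FG [simplified]]
  show "Sq_fun (Cm (TwoCat \<kappa>) G F) = Cm (DblCat \<kappa>) (Sq_fun G) (Sq_fun F)"
    using F G FG
    by (intro double_functor_eqI double_functor_Cm double_functor_Sq_fun two_functor_Cm)
      (auto elim!: Sq_cellE simp: compose_def two_functor_maps' two_functor_maps)
next
  interpret coding "TYPE('u)" by (rule universe_coding)
  fix A :: "'u twocat" assume A: "A \<in> Ob (TwoCat \<kappa>)"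
  then show "Sq A \<in> Ob (DblCat \<kappa>)" by (simp add: small_double_category_Sq)
  from A have A: "two_category A" by (simp add: small_two_category_def)
  show "Sq_fun (Idt (TwoCat \<kappa>) A) = Idt (DblCat \<kappa>) (Sq A)"
    using A
    by (intro double_functor_eqI double_functor_Idt double_functor_Sq_fun two_functor_Idt
        double_category_Sq) (auto elim!: Sq_cellE)
qed

end

section \<open>Calculus of squares in a double category\<close>

context double_category
begin

lemmas square_simps = hor.Cm_simps ver.Cm_simps [unfolded Ob_Ver] hsq.Cm_simps [unfolded Ob_HSq]
  vsq.Cm_simps [unfolded Ob_VSq Ar_VSq] Ob_Ver Ob_HSq Ob_VSq Ar_VSq
  top_Cm bottom_Cm left_Cm right_Cm top_Idt bottom_Idt left_Idt right_Idt Idt_Idt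
  Idt_Cm_Ver Idt_Cm_Hor [symmetric]

lemmas corners = corner_tl [symmetric] corner_tr [symmetric] corner_bl [symmetric] corner_br [symmetric]

text \<open>\<open>Idt_Idt\<close> normalizes the identity square at an object to its
  \<open>VSq\<close> form, so the horizontal unit laws are restated for that form.\<close>

lemma Idt_HSq_units:
  assumes "s \<in> Ar (HSq A)" "x \<in> Ob (Hor A)"
  shows "Cd (HSq A) s = Idt (Ver A) x \<Longrightarrow> Cm (HSq A) (Idt (VSq A) (Idt (Hor A) x)) s = s"
    and "Dm (HSq A) s = Idt (Ver A) x \<Longrightarrow> Cm (HSq A) s (Idt (VSq A) (Idt (Hor A) x)) = s"
  using assms hsq.Idt_Cm_eq [of s "Idt (Ver A) x"] hsq.Cm_Idt_eq [of s "Idt (Ver A) x"]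
  by (simp_all add: Idt_Idt)

lemma whisker_Idt_assoc:
  assumes "s \<in> Ar (HSq A)" "f \<in> Ar (Hor A)" "g \<in> Ar (Hor A)" "Cd (Hor A) f = Dm (Hor A) g"
  shows "Cd (HSq A) s = Idt (Ver A) (Dm (Hor A) f) \<Longrightarrow>
      Cm (HSq A) (Idt (VSq A) g) (Cm (HSq A) (Idt (VSq A) f) s) = Cm (HSq A) (Idt (VSq A) (Cm (Hor A) g f)) s"
    and "t \<in> Ar (HSq A) \<Longrightarrow> Dm (HSq A) s = Idt (Ver A) (Cd (Hor A) g) \<Longrightarrow> Cd (HSq A) s = Dm (HSq A) t \<Longrightarrow>
      Cm (HSq A) s (Idt (VSq A) (Cm (Hor A) g f)) = Cm (HSq A) (Cm (HSq A) s (Idt (VSq A) g)) (Idt (VSq A) f)"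
  using assms hsq.Cm_assoc [of s "Idt (VSq A) f" "Idt (VSq A) g"]
    hsq.Cm_assoc [of "Idt (VSq A) f" "Idt (VSq A) g" s]
  by (simp_all add: square_simps)

lemma whisker_VSq:
  assumes "s \<in> Ar (HSq A)" "t \<in> Ar (HSq A)" "Cd (VSq A) s = Dm (VSq A) t" "f \<in> Ar (Hor A)"
  shows "\<lbrakk>Cd (HSq A) s = Idt (Ver A) (Dm (Hor A) f); Cd (HSq A) t = Idt (Ver A) (Dm (Hor A) f)\<rbrakk> \<Longrightarrow>
      Cm (HSq A) (Idt (VSq A) f) (Cm (VSq A) t s) =
      Cm (VSq A) (Cm (HSq A) (Idt (VSq A) f) t) (Cm (HSq A) (Idt (VSq A) f) s)"
    and "\<lbrakk>Dm (HSq A) s = Idt (Ver A) (Cd (Hor A) f); Dm (HSq A) t = Idt (Ver A) (Cd (Hor A) f)\<rbrakk> \<Longrightarrow>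
      Cm (HSq A) (Cm (VSq A) t s) (Idt (VSq A) f) =
      Cm (VSq A) (Cm (HSq A) t (Idt (VSq A) f)) (Cm (HSq A) s (Idt (VSq A) f))"
  using assms interchange [of s "Idt (VSq A) f" t "Idt (VSq A) f"]
    interchange [of "Idt (VSq A) f" s "Idt (VSq A) f" t]
  by (simp_all add: square_simps)

lemma companion_pairE:
  assumes "companion_pair A f u \<phi> \<psi>"
  obtains a b where "f \<in> Ar (Hor A)" "u \<in> Ar (Ver A)" "\<phi> \<in> Ar (HSq A)" "\<psi> \<in> Ar (HSq A)"
    "a \<in> Ob (Hor A)" "b \<in> Ob (Hor A)"
    "Dm (Hor A) f = a" "Cd (Hor A) f = b" "Dm (Ver A) u = a" "Cd (Ver A) u = b"
    "Dm (VSq A) \<phi> = f" "Cd (VSq A) \<phi> = Idt (Hor A) b" "Dm (HSq A) \<phi> = u" "Cd (HSq A) \<phi> = Idt (Ver A) b"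
    "Dm (VSq A) \<psi> = Idt (Hor A) a" "Cd (VSq A) \<psi> = f" "Dm (HSq A) \<psi> = Idt (Ver A) a" "Cd (HSq A) \<psi> = u"
    "Cm (HSq A) \<phi> \<psi> = Idt (VSq A) f" "Cm (VSq A) \<phi> \<psi> = Idt (HSq A) u"
  using assms hor.hom_obs unfolding companion_pair_def hom_def squares_def by fastforce

lemma companion_pairI:
  assumes "f \<in> Ar (Hor A)" "u \<in> Ar (Ver A)" "\<phi> \<in> Ar (HSq A)" "\<psi> \<in> Ar (HSq A)"
    "Dm (Hor A) f = a" "Cd (Hor A) f = b" "Dm (Ver A) u = a" "Cd (Ver A) u = b"
    "Dm (VSq A) \<phi> = f" "Cd (VSq A) \<phi> = Idt (Hor A) b" "Dm (HSq A) \<phi> = u" "Cd (HSq A) \<phi> = Idt (Ver A) b"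
    "Dm (VSq A) \<psi> = Idt (Hor A) a" "Cd (VSq A) \<psi> = f" "Dm (HSq A) \<psi> = Idt (Ver A) a" "Cd (HSq A) \<psi> = u"
    "Cm (HSq A) \<phi> \<psi> = Idt (VSq A) f" "Cm (VSq A) \<phi> \<psi> = Idt (HSq A) u"
  shows "companion_pair A f u \<phi> \<psi>"
  unfolding companion_pair_def hom_def squares_def
  by (rule exI [of _ a], rule exI [of _ b]) (simp add: assms)

lemma companion_pair_Idt:
  "a \<in> Ob (Hor A) \<Longrightarrow> companion_pair A (Idt (Hor A) a) (Idt (Ver A) a)
    (Idt (VSq A) (Idt (Hor A) a)) (Idt (VSq A) (Idt (Hor A) a))"
  by (rule companion_pairI [of _ _ _ _ a a]) (simp_all add: square_simps Idt_HSq_units)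

text \<open>Each equation is a pasting computation. For the horizontal one, interchange cuts the
  pasting into two rows, each of which collapses by a companion identity. For the vertical one, the
  two middle layers are rearranged until \<open>\<psi>\<close> meets \<open>\<phi>\<close> and
  \<open>\<psi>'\<close> meets \<open>\<phi>'\<close>.\<close>

lemma companion_pair_Cm:
  assumes "companion_pair A f u \<phi> \<psi>" "companion_pair A g v \<phi>' \<psi>'" "Cd (Hor A) f = Dm (Hor A) g"
  shows "companion_pair A (Cm (Hor A) g f) (Cm (Ver A) v u)
    (Cm (VSq A) \<phi>' (Cm (HSq A) (Idt (VSq A) g) \<phi>)) (Cm (VSq A) (Cm (HSq A) \<psi>' (Idt (VSq A) f)) \<psi>)"
    (is "companion_pair A _ _ ?\<phi> ?\<psi>")
  using assms(1)
proof (rule companion_pairE)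
  fix a b assume [simp]: "f \<in> Ar (Hor A)" "u \<in> Ar (Ver A)" "\<phi> \<in> Ar (HSq A)" "\<psi> \<in> Ar (HSq A)"
    "a \<in> Ob (Hor A)" "b \<in> Ob (Hor A)"
    "Dm (Hor A) f = a" "Cd (Hor A) f = b" "Dm (Ver A) u = a" "Cd (Ver A) u = b"
    "Dm (VSq A) \<phi> = f" "Cd (VSq A) \<phi> = Idt (Hor A) b" "Dm (HSq A) \<phi> = u" "Cd (HSq A) \<phi> = Idt (Ver A) b"
    "Dm (VSq A) \<psi> = Idt (Hor A) a" "Cd (VSq A) \<psi> = f" "Dm (HSq A) \<psi> = Idt (Ver A) a" "Cd (HSq A) \<psi> = u"
    and eq1: "Cm (HSq A) \<phi> \<psi> = Idt (VSq A) f" "Cm (VSq A) \<phi> \<psi> = Idt (HSq A) u"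
  obtain c where [simp]: "g \<in> Ar (Hor A)" "v \<in> Ar (Ver A)" "\<phi>' \<in> Ar (HSq A)" "\<psi>' \<in> Ar (HSq A)"
    "c \<in> Ob (Hor A)"
    "Dm (Hor A) g = b" "Cd (Hor A) g = c" "Dm (Ver A) v = b" "Cd (Ver A) v = c"
    "Dm (VSq A) \<phi>' = g" "Cd (VSq A) \<phi>' = Idt (Hor A) c" "Dm (HSq A) \<phi>' = v" "Cd (HSq A) \<phi>' = Idt (Ver A) c"
    "Dm (VSq A) \<psi>' = Idt (Hor A) b" "Cd (VSq A) \<psi>' = g" "Dm (HSq A) \<psi>' = Idt (Ver A) b" "Cd (HSq A) \<psi>' = v"
    and eq2: "Cm (HSq A) \<phi>' \<psi>' = Idt (VSq A) g" "Cm (VSq A) \<phi>' \<psi>' = Idt (HSq A) v"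
    using assms(2,3) by (auto elim!: companion_pairE)
  note [simp] = square_simps Idt_HSq_units
  have "Cm (HSq A) ?\<phi> ?\<psi> = Cm (VSq A) (Cm (HSq A) \<phi>' (Cm (HSq A) \<psi>' (Idt (VSq A) f)))
      (Cm (HSq A) (Cm (HSq A) (Idt (VSq A) g) \<phi>) \<psi>)"
    using interchange [of \<psi> "Cm (HSq A) (Idt (VSq A) g) \<phi>" "Cm (HSq A) \<psi>' (Idt (VSq A) f)" \<phi>'] by simp
  also have "Cm (HSq A) \<phi>' (Cm (HSq A) \<psi>' (Idt (VSq A) f)) = Idt (VSq A) (Cm (Hor A) g f)"
    using hsq.Cm_assoc [of "Idt (VSq A) f" \<psi>' \<phi>'] eq2 by simp
  also have "Cm (HSq A) (Cm (HSq A) (Idt (VSq A) g) \<phi>) \<psi> = Idt (VSq A) (Cm (Hor A) g f)"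
    using hsq.Cm_assoc [of \<psi> \<phi> "Idt (VSq A) g"] eq1 by simp
  finally have h: "Cm (HSq A) ?\<phi> ?\<psi> = Idt (VSq A) (Cm (Hor A) g f)" by simp
  have "Cm (VSq A) (Cm (HSq A) (Idt (VSq A) g) \<phi>) (Cm (HSq A) \<psi>' (Idt (VSq A) f)) = Cm (HSq A) \<psi>' \<phi>"
    using interchange [of "Idt (VSq A) f" \<psi>' \<phi> "Idt (VSq A) g"] by simp
  \<comment> \<open>The squares \<open>\<phi>\<close> and \<open>\<psi>'\<close> touch only at the
    corner \<open>b\<close>, where their sides are identities. Padding with two identity squares
    shows that placing them side by side or one above the other gives the same result.\<close>
  also have "\<dots> = Cm (VSq A) \<psi>' \<phi>"
    using interchange [of \<phi> "Idt (VSq A) (Idt (Hor A) b)" "Idt (VSq A) (Idt (Hor A) b)" \<psi>'] by simp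
  finally have m: "Cm (VSq A) (Cm (HSq A) (Idt (VSq A) g) \<phi>) (Cm (HSq A) \<psi>' (Idt (VSq A) f)) = Cm (VSq A) \<psi>' \<phi>" .
  have "Cm (VSq A) ?\<phi> ?\<psi> =
      Cm (VSq A) \<phi>' (Cm (VSq A) (Cm (VSq A) (Cm (HSq A) (Idt (VSq A) g) \<phi>) (Cm (HSq A) \<psi>' (Idt (VSq A) f))) \<psi>)"
    by simp
  also have "\<dots> = Cm (VSq A) (Cm (VSq A) \<phi>' \<psi>') (Cm (VSq A) \<phi> \<psi>)"
    unfolding m by simp
  also have "\<dots> = Idt (HSq A) (Cm (Ver A) v u)"
    unfolding eq1 eq2 by simp
  finally have v: "Cm (VSq A) ?\<phi> ?\<psi> = Idt (HSq A) (Cm (Ver A) v u)" .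
  show ?thesis
    by (rule companion_pairI [of _ _ _ _ a c]) (use h v in simp_all)
qed

end

section \<open>The 2-category of companion pairs\<close>

definition pair_ver :: "'u \<Rightarrow> 'u" where
  "pair_ver p = (case (dec p :: 'u comp_pair) of (f, u, \<phi>, \<psi>) \<Rightarrow> u)"

definition pair_phi :: "'u \<Rightarrow> 'u" where
  "pair_phi p = (case (dec p :: 'u comp_pair) of (f, u, \<phi>, \<psi>) \<Rightarrow> \<phi>)"

definition pair_psi :: "'u \<Rightarrow> 'u" where
  "pair_psi p = (case (dec p :: 'u comp_pair) of (f, u, \<phi>, \<psi>) \<Rightarrow> \<psi>)"

abbreviation pairs :: "'u dblcat \<Rightarrow> 'u set" where
  "pairs A \<equiv> Ar (One (RR A))"

context coding
begin

lemma pair_simps [simp]: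
  fixes f u \<phi> \<psi> :: 'u
  shows "pair_hor (enc (f, u, \<phi>, \<psi>)) = f" "pair_ver (enc (f, u, \<phi>, \<psi>)) = u"
    "pair_phi (enc (f, u, \<phi>, \<psi>)) = \<phi>" "pair_psi (enc (f, u, \<phi>, \<psi>)) = \<psi>"
  by (simp_all add: pair_hor_def pair_ver_def pair_phi_def pair_psi_def)

lemma RR_simps [simp]:
  fixes A :: "'u dblcat" and p p' q q' s t x :: 'u
  shows "Ob (One (RR A)) = Ob (Hor A)" "Ob (VTwo (RR A)) = pairs A"
    "Ob (HTwo (RR A)) = Ob (Hor A)" "Ar (HTwo (RR A)) = Ar (VTwo (RR A))"
    "Dm (One (RR A)) p = Dm (Hor A) (pair_hor p)" "Cd (One (RR A)) p = Cd (Hor A) (pair_hor p)"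
    "Idt (One (RR A)) x = RR_id A x" "Cm (One (RR A)) q p = RR_comp A q p"
    "Dm (VTwo (RR A)) (enc (p, p', s)) = p" "Cd (VTwo (RR A)) (enc (p, p', s)) = p'"
    "Idt (VTwo (RR A)) p = enc (p, p, Idt (VSq A) (pair_hor p))"
    "Cm (VTwo (RR A)) (enc (q, q', t)) (enc (p, p', s)) = enc (p, q', Cm (VSq A) t s)"
    "Dm (HTwo (RR A)) (enc (p, p', s)) = Dm (Hor A) (pair_hor p)"
    "Cd (HTwo (RR A)) (enc (p, p', s)) = Cd (Hor A) (pair_hor p)"
    "Idt (HTwo (RR A)) x = enc (RR_id A x, RR_id A x, Idt (VSq A) (Idt (Hor A) x))"
    "Cm (HTwo (RR A)) (enc (q, q', t)) (enc (p, p', s)) =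
      enc (RR_comp A q p, RR_comp A q' p', Cm (HSq A) t s)"
  by (simp_all add: RR_def)

lemma RR_mor_iff:
  fixes A :: "'u dblcat" and p :: 'u
  shows "p \<in> pairs A \<longleftrightarrow> p = enc (pair_hor p, pair_ver p, pair_phi p, pair_psi p) \<and>
    companion_pair A (pair_hor p) (pair_ver p) (pair_phi p) (pair_psi p)"
proof
  assume "p \<in> pairs A"
  then show "p = enc (pair_hor p, pair_ver p, pair_phi p, pair_psi p) \<and>
    companion_pair A (pair_hor p) (pair_ver p) (pair_phi p) (pair_psi p)"
    by (auto simp: RR_def RR_mor_def)
next
  assume *: "p = enc (pair_hor p, pair_ver p, pair_phi p, pair_psi p) \<and>
    companion_pair A (pair_hor p) (pair_ver p) (pair_phi p) (pair_psi p)"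
  have "p \<in> enc ` RR_mor A"
    by (rule image_eqI [where f = enc, OF conjunct1 [OF *]]) (simp add: RR_mor_def conjunct2 [OF *])
  then show "p \<in> pairs A" by (simp add: RR_def)
qed

lemma enc_mem_RR_mor:
  fixes A :: "'u dblcat" and f u \<phi> \<psi> :: 'u
  shows "enc (f, u, \<phi>, \<psi>) \<in> pairs A \<longleftrightarrow> companion_pair A f u \<phi> \<psi>"
  by (subst RR_mor_iff) simp

lemma RR_mor_eqI:
  fixes A :: "'u dblcat" and p q :: 'u
  assumes "p \<in> pairs A" "q \<in> pairs A"
    and "pair_hor p = pair_hor q" "pair_ver p = pair_ver q"
    and "pair_phi p = pair_phi q" "pair_psi p = pair_psi q"
  shows "p = q"
proof -
  have "p = enc (pair_hor p, pair_ver p, pair_phi p, pair_psi p)"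
    and "q = enc (pair_hor q, pair_ver q, pair_phi q, pair_psi q)"
    using assms(1,2) RR_mor_iff by auto
  then show ?thesis using assms(3-) by simp
qed

lemma RR_id_simps [simp]:
  fixes A :: "'u dblcat" and x :: 'u
  shows "pair_hor (RR_id A x) = Idt (Hor A) x" "pair_ver (RR_id A x) = Idt (Ver A) x"
    "pair_phi (RR_id A x) = Idt (VSq A) (Idt (Hor A) x)"
    "pair_psi (RR_id A x) = Idt (VSq A) (Idt (Hor A) x)"
  by (simp_all add: RR_id_def)

lemma RR_comp_eq:
  fixes A :: "'u dblcat" and p q :: 'u
  shows "RR_comp A q p = enc (Cm (Hor A) (pair_hor q) (pair_hor p), Cm (Ver A) (pair_ver q) (pair_ver p),
    Cm (VSq A) (pair_phi q) (Cm (HSq A) (Idt (VSq A) (pair_hor q)) (pair_phi p)),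
    Cm (VSq A) (Cm (HSq A) (pair_psi q) (Idt (VSq A) (pair_hor p))) (pair_psi p))"
  by (simp add: RR_comp_def pair_hor_def pair_ver_def pair_phi_def pair_psi_def split: prod.splits)

lemma RR_comp_simps [simp]:
  fixes A :: "'u dblcat" and p q :: 'u
  shows "pair_hor (RR_comp A q p) = Cm (Hor A) (pair_hor q) (pair_hor p)"
    "pair_ver (RR_comp A q p) = Cm (Ver A) (pair_ver q) (pair_ver p)"
    "pair_phi (RR_comp A q p) = Cm (VSq A) (pair_phi q) (Cm (HSq A) (Idt (VSq A) (pair_hor q)) (pair_phi p))"
    "pair_psi (RR_comp A q p) = Cm (VSq A) (Cm (HSq A) (pair_psi q) (Idt (VSq A) (pair_hor p))) (pair_psi p)"
  by (simp_all add: RR_comp_eq)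

lemma RR_cellE:
  fixes A :: "'u dblcat" and c :: 'u
  assumes "c \<in> Ar (VTwo (RR A))"
  obtains p p' s a b :: 'u where "c = enc (p, p', s)" "p \<in> pairs A" "p' \<in> pairs A"
    "s \<in> Ar (HSq A)" "Dm (VSq A) s = pair_hor p" "Cd (VSq A) s = pair_hor p'"
    "Dm (Hor A) (pair_hor p) = a" "Dm (Hor A) (pair_hor p') = a"
    "Cd (Hor A) (pair_hor p) = b" "Cd (Hor A) (pair_hor p') = b"
    "Dm (HSq A) s = Idt (Ver A) a" "Cd (HSq A) s = Idt (Ver A) b"
proof -
  obtain p p' s a b where *: "c = enc (p, p', s)" "p \<in> enc ` RR_mor A" "p' \<in> enc ` RR_mor A"
    "pair_hor p \<in> hom (Hor A) a b" "pair_hor p' \<in> hom (Hor A) a b"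
    "s \<in> squares A (pair_hor p) (pair_hor p') (Idt (Ver A) a) (Idt (Ver A) b)"
    using assms by (auto simp: RR_def RR_cells_def)
  show thesis
    by (rule that [of p p' s a b]) (use * in \<open>simp_all add: RR_def hom_def squares_def\<close>)
qed

lemma enc_mem_RR_cells [simp]:
  fixes A :: "'u dblcat" and p p' s :: 'u
  shows "enc (p, p', s) \<in> Ar (VTwo (RR A)) \<longleftrightarrow> p \<in> pairs A \<and> p' \<in> pairs A \<and>
    s \<in> Ar (HSq A) \<and> Dm (VSq A) s = pair_hor p \<and> Cd (VSq A) s = pair_hor p' \<and>
    Dm (Hor A) (pair_hor p) = Dm (Hor A) (pair_hor p') \<and> Cd (Hor A) (pair_hor p) = Cd (Hor A) (pair_hor p') \<and>
    Dm (HSq A) s = Idt (Ver A) (Dm (Hor A) (pair_hor p)) \<and>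
    Cd (HSq A) s = Idt (Ver A) (Cd (Hor A) (pair_hor p)) \<and> pair_hor p \<in> Ar (Hor A) \<and> pair_hor p' \<in> Ar (Hor A)"
    (is "?l \<longleftrightarrow> ?r")
proof -
  have "Ar (VTwo (RR A)) = enc ` RR_cells A" "pairs A = enc ` RR_mor A"
    by (simp_all add: RR_def)
  moreover have "(enc (p, p', s) :: 'u) \<in> enc ` RR_cells A \<longleftrightarrow> (p, p', s) \<in> RR_cells A"
    by (auto simp: image_iff)
  ultimately show ?thesis
    by (auto simp: RR_cells_def hom_def squares_def)
qed

end

locale coded_double_category = coding U + double_category A
  for U :: "'u itself" and A :: "'u dblcat"
begin

lemma RR_mor_companion:
  "p \<in> pairs A \<Longrightarrow> companion_pair A (pair_hor p) (pair_ver p) (pair_phi p) (pair_psi p)"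
  by (subst (asm) RR_mor_iff) (rule conjunct2)

lemma RR_mor_simps:
  assumes "p \<in> pairs A"
  shows "pair_hor p \<in> Ar (Hor A)" "pair_ver p \<in> Ar (Ver A)"
    "pair_phi p \<in> Ar (HSq A)" "pair_psi p \<in> Ar (HSq A)"
    "Dm (Ver A) (pair_ver p) = Dm (Hor A) (pair_hor p)" "Cd (Ver A) (pair_ver p) = Cd (Hor A) (pair_hor p)"
    "Dm (VSq A) (pair_phi p) = pair_hor p" "Cd (VSq A) (pair_phi p) = Idt (Hor A) (Cd (Hor A) (pair_hor p))"
    "Dm (HSq A) (pair_phi p) = pair_ver p" "Cd (HSq A) (pair_phi p) = Idt (Ver A) (Cd (Hor A) (pair_hor p))"
    "Dm (VSq A) (pair_psi p) = Idt (Hor A) (Dm (Hor A) (pair_hor p))" "Cd (VSq A) (pair_psi p) = pair_hor p"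
    "Dm (HSq A) (pair_psi p) = Idt (Ver A) (Dm (Hor A) (pair_hor p))" "Cd (HSq A) (pair_psi p) = pair_ver p"
    "Cm (HSq A) (pair_phi p) (pair_psi p) = Idt (VSq A) (pair_hor p)"
    "Cm (VSq A) (pair_phi p) (pair_psi p) = Idt (HSq A) (pair_ver p)"
  using RR_mor_companion [OF assms] by (auto elim!: companion_pairE)

lemma RR_id_mem: "x \<in> Ob (Hor A) \<Longrightarrow> RR_id A x \<in> pairs A"
  by (simp add: RR_id_def enc_mem_RR_mor companion_pair_Idt)

lemma RR_comp_mem:
  assumes "p \<in> pairs A" "q \<in> pairs A"
    "Cd (Hor A) (pair_hor p) = Dm (Hor A) (pair_hor q)"
  shows "RR_comp A q p \<in> pairs A"
  unfolding RR_comp_eq enc_mem_RR_mor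
  by (intro companion_pair_Cm RR_mor_companion assms)

lemmas RR_cell_simps = square_simps Idt_HSq_units whisker_VSq RR_mor_simps RR_id_mem RR_comp_mem

lemma category_One_RR: "category (One (RR A))"
proof (rule category.intro, goal_cases)
  case (9 p)
  show ?case
    by (rule RR_mor_eqI [of _ A]) (use 9 in \<open>simp_all add: RR_cell_simps\<close>)
next
  case (10 p)
  show ?case
    by (rule RR_mor_eqI [of _ A]) (use 10 in \<open>simp_all add: RR_cell_simps\<close>)
next
  case (11 p q r)
  show ?case
    by (rule RR_mor_eqI [of _ A])
      (use 11 in \<open>simp_all add: RR_cell_simps whisker_Idt_assoc(1) [symmetric]\<close>)
qed (simp_all add: RR_cell_simps)

text \<open>A 2-cell is a square with identity vertical sides, so the laws for 2-cells are laws of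
  \<open>A\<close>. The category laws for companion pairs enter only through the sources and targets
  recorded in the codes.\<close>

lemma two_category_RR: "two_category (RR A)"
proof -
  note [simp] = RR_cell_simps
  interpret R: category "One (RR A)" by (rule category_One_RR)
  have R: "Dm (Hor A) (pair_hor p) = x \<Longrightarrow> RR_comp A p (RR_id A x) = p"
    "Cd (Hor A) (pair_hor p) = x \<Longrightarrow> RR_comp A (RR_id A x) p = p" if "p \<in> pairs A" for p x
    using R.Cm_Idt_eq [of p x] R.Idt_Cm_eq [of p x] that by simp_all
  have Ra: "RR_comp A (RR_comp A r q) p = RR_comp A r (RR_comp A q p)"
    if "p \<in> pairs A" "q \<in> pairs A" "r \<in> pairs A"
      "Cd (Hor A) (pair_hor p) = Dm (Hor A) (pair_hor q)" "Cd (Hor A) (pair_hor q) = Dm (Hor A) (pair_hor r)"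
    for p q r
    using R.Cm_assoc [of p q r] that by simp
  have V: "category (VTwo (RR A))"
    by (rule category.intro) (auto elim!: RR_cellE)
  have H: "category (HTwo (RR A))"
    by (rule category.intro) (auto elim!: RR_cellE simp: R Ra)
  show ?thesis
    by (intro two_category.intro two_category_axioms.intro V H category_One_RR)
      (auto elim!: RR_cellE simp: interchange)
qed

end

section \<open>Transposing squares along companions\<close>

text \<open>The two maps below are mutually inverse bijections between squares with vertical sides
  \<open>pair_ver q\<close>, \<open>pair_ver q'\<close> and squares with identity vertical sides.\<close>

definition flatten :: "'u dblcat \<Rightarrow> 'u \<Rightarrow> 'u \<Rightarrow> 'u \<Rightarrow> 'u" where
  "flatten A q q' s = Cm (HSq A) (pair_phi q') (Cm (HSq A) s (pair_psi q))"

definition unflatten :: "'u dblcat \<Rightarrow> 'u \<Rightarrow> 'u \<Rightarrow> 'u \<Rightarrow> 'u \<Rightarrow> 'u \<Rightarrow> 'u" where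
  "unflatten A f f' q q' s = Cm (VSq A) (Cm (HSq A) (Idt (VSq A) f') (pair_phi q))
    (Cm (VSq A) s (Cm (HSq A) (pair_psi q') (Idt (VSq A) f)))"

context coded_double_category
begin

lemma flatten_mem:
  assumes "s \<in> Ar (HSq A)" "q \<in> pairs A" "q' \<in> pairs A"
    "Dm (HSq A) s = pair_ver q" "Cd (HSq A) s = pair_ver q'"
  shows "flatten A q q' s \<in> Ar (HSq A)"
    and "Dm (VSq A) (flatten A q q' s) = Cm (Hor A) (pair_hor q') (Dm (VSq A) s)"
    and "Cd (VSq A) (flatten A q q' s) = Cm (Hor A) (Cd (VSq A) s) (pair_hor q)"
    and "Dm (HSq A) (flatten A q q' s) = Idt (Ver A) (Dm (Hor A) (pair_hor q))"
    and "Cd (HSq A) (flatten A q q' s) = Idt (Ver A) (Cd (Hor A) (pair_hor q'))"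
  using assms by (simp_all add: flatten_def RR_cell_simps corners)

text \<open>Unflattening stacks three layers: \<open>pair_psi q'\<close> with \<open>f\<close>, then
  \<open>s\<close>, then \<open>pair_phi q\<close> with \<open>f'\<close>. Flattening again pastes
  \<open>pair_psi q\<close> on the left, which affects only the bottom layer, and
  \<open>pair_phi q'\<close> on the right, which affects only the top layer. Each meets its partner
  along a vertical side and cancels.\<close>

lemma unflatten:
  assumes "s \<in> Ar (HSq A)" "q \<in> pairs A" "q' \<in> pairs A"
    "f \<in> Ar (Hor A)" "f' \<in> Ar (Hor A)"
    "Dm (VSq A) s = Cm (Hor A) (pair_hor q') f" "Cd (VSq A) s = Cm (Hor A) f' (pair_hor q)"
    "Dm (Hor A) f = Dm (Hor A) (pair_hor q)" "Cd (Hor A) f = Dm (Hor A) (pair_hor q')"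
    "Dm (Hor A) f' = Cd (Hor A) (pair_hor q)" "Cd (Hor A) f' = Cd (Hor A) (pair_hor q')"
    "Dm (HSq A) s = Idt (Ver A) (Dm (Hor A) (pair_hor q))"
    "Cd (HSq A) s = Idt (Ver A) (Cd (Hor A) (pair_hor q'))"
  shows "unflatten A f f' q q' s \<in> Ar (HSq A)"
    and "Dm (VSq A) (unflatten A f f' q q' s) = f" "Cd (VSq A) (unflatten A f f' q q' s) = f'"
    and "Dm (HSq A) (unflatten A f f' q q' s) = pair_ver q"
    and "Cd (HSq A) (unflatten A f f' q q' s) = pair_ver q'"
    and "flatten A q q' (unflatten A f f' q q' s) = s"
proof -
  note [simp] = square_simps Idt_HSq_units RR_mor_simps [OF assms(2)] RR_mor_simps [OF assms(3)] assms
  define R1 R3 where R: "R1 = Cm (HSq A) (pair_psi q') (Idt (VSq A) f)"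
    "R3 = Cm (HSq A) (Idt (VSq A) f') (pair_phi q)"
  have [simp]: "R1 \<in> Ar (HSq A)" "R3 \<in> Ar (HSq A)"
    "Dm (VSq A) R1 = f" "Cd (VSq A) R1 = Cm (Hor A) (pair_hor q') f"
    "Dm (HSq A) R1 = Idt (Ver A) (Dm (Hor A) f)" "Cd (HSq A) R1 = pair_ver q'"
    "Dm (VSq A) R3 = Cm (Hor A) f' (pair_hor q)" "Cd (VSq A) R3 = f'"
    "Dm (HSq A) R3 = pair_ver q" "Cd (HSq A) R3 = Idt (Ver A) (Cd (Hor A) f')"
    by (simp_all add: R)
  have R3: "Cm (HSq A) R3 (pair_psi q) = Idt (VSq A) (Cm (Hor A) f' (pair_hor q))"
    using hsq.Cm_assoc [of "pair_psi q" "pair_phi q" "Idt (VSq A) f'"] by (simp add: R)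
  have R1: "Cm (HSq A) (pair_phi q') R1 = Idt (VSq A) (Cm (Hor A) (pair_hor q') f)"
    using hsq.Cm_assoc [of "Idt (VSq A) f" "pair_psi q'" "pair_phi q'"] by (simp add: R)
  have "Cm (HSq A) (Cm (VSq A) R3 (Cm (VSq A) s R1)) (pair_psi q) = Cm (VSq A) s R1"
    using interchange [of "Idt (VSq A) (Idt (Hor A) (Dm (Hor A) f))" "Cm (VSq A) s R1" "pair_psi q" R3]
    by (simp add: R3)
  moreover have "Cm (HSq A) (pair_phi q') (Cm (VSq A) s R1) = s"
    using interchange [of R1 "pair_phi q'" s "Idt (VSq A) (Idt (Hor A) (Cd (Hor A) f'))"]
    by (simp add: R1)
  ultimately show "flatten A q q' (unflatten A f f' q q' s) = s"
    by (simp add: flatten_def unflatten_def R [symmetric])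
qed (use assms in \<open>simp_all add: unflatten_def RR_cell_simps\<close>)

text \<open>The dual cancellation: here the two squares of each pair meet along a horizontal side,
  and the companion identity for vertical composites removes them.\<close>

lemma unflatten_flatten:
  assumes "s \<in> Ar (HSq A)" "q \<in> pairs A" "q' \<in> pairs A"
    "Dm (HSq A) s = pair_ver q" "Cd (HSq A) s = pair_ver q'"
    "Dm (VSq A) s = f" "Cd (VSq A) s = f'"
  shows "unflatten A f f' q q' (flatten A q q' s) = s"
proof -
  note [simp] = square_simps Idt_HSq_units RR_mor_simps [OF assms(2)] RR_mor_simps [OF assms(3)] assms
  have [simp]: "f \<in> Ar (Hor A)" "f' \<in> Ar (Hor A)"
    using vsq.Dm_in [of s] vsq.Cd_in [of s] by simp_all
  have [simp]: "Dm (Hor A) f = Dm (Hor A) (pair_hor q)"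
    "Cd (Hor A) f = Dm (Hor A) (pair_hor q')"
    "Dm (Hor A) f' = Cd (Hor A) (pair_hor q)"
    "Cd (Hor A) f' = Cd (Hor A) (pair_hor q')"
    using corner_tl [of s] corner_tr [of s] corner_bl [of s] corner_br [of s] by simp_all
  define X where X: "X = Cm (HSq A) s (pair_psi q)"
  have [simp]: "X \<in> Ar (HSq A)" "Dm (VSq A) X = f" "Cd (VSq A) X = Cm (Hor A) f' (pair_hor q)"
    "Dm (HSq A) X = Idt (Ver A) (Dm (Hor A) f)" "Cd (HSq A) X = pair_ver q'"
    by (simp_all add: X)
  have "Cm (VSq A) (Cm (HSq A) (pair_phi q') X) (Cm (HSq A) (pair_psi q') (Idt (VSq A) f)) = X"
    using interchange [of "Idt (VSq A) f" "pair_psi q'" X "pair_phi q'"] by simp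
  moreover have "Cm (VSq A) (Cm (HSq A) (Idt (VSq A) f') (pair_phi q)) X = s"
    using interchange [of "pair_psi q" s "pair_phi q" "Idt (VSq A) f'"] by (simp add: X)
  ultimately show ?thesis
    by (simp add: flatten_def unflatten_def X [symmetric])
qed

text \<open>The right-hand side is the horizontal composition formula of \<open>Sq (RR A)\<close>.
  In it \<open>pair_psi q'\<close>, coming from \<open>t\<close>, lies above
  \<open>pair_phi q'\<close>, coming from \<open>s\<close>; they cancel and leave \<open>s\<close>
  and \<open>t\<close> pasted along \<open>pair_ver q'\<close>.\<close>

lemma flatten_HSq:
  assumes "s \<in> Ar (HSq A)" "t \<in> Ar (HSq A)"
    "q \<in> pairs A" "q' \<in> pairs A" "q'' \<in> pairs A"
    "Dm (HSq A) s = pair_ver q" "Cd (HSq A) s = pair_ver q'"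
    "Dm (HSq A) t = pair_ver q'" "Cd (HSq A) t = pair_ver q''"
  shows "flatten A q q'' (Cm (HSq A) t s) =
    Cm (VSq A) (Cm (HSq A) (Idt (VSq A) (Cd (VSq A) t)) (flatten A q q' s))
      (Cm (HSq A) (flatten A q' q'' t) (Idt (VSq A) (Dm (VSq A) s)))"
proof -
  note [simp] = square_simps Idt_HSq_units RR_mor_simps [OF assms(3)] RR_mor_simps [OF assms(4)]
    RR_mor_simps [OF assms(5)] assms
  note [simp] = corners
  define X where X: "X = Cm (HSq A) s (pair_psi q)"
  define Y where Y: "Y = Cm (HSq A) (pair_phi q'') t"
  have [simp]: "X \<in> Ar (HSq A)" "Dm (VSq A) X = Dm (VSq A) s"
    "Cd (VSq A) X = Cm (Hor A) (Cd (VSq A) s) (pair_hor q)"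
    "Dm (HSq A) X = Idt (Ver A) (Dm (Hor A) (pair_hor q))" "Cd (HSq A) X = pair_ver q'"
    by (simp_all add: X)
  have [simp]: "Y \<in> Ar (HSq A)" "Dm (VSq A) Y = Cm (Hor A) (pair_hor q'') (Dm (VSq A) t)"
    "Cd (VSq A) Y = Cd (VSq A) t"
    "Dm (HSq A) Y = pair_ver q'" "Cd (HSq A) Y = Idt (Ver A) (Cd (Hor A) (pair_hor q''))"
    by (simp_all add: Y)
  let ?e = "Idt (VSq A) (Cd (VSq A) t)" and ?e' = "Idt (VSq A) (Dm (VSq A) s)"
  have s: "Cm (HSq A) ?e (flatten A q q' s) = Cm (HSq A) (Cm (HSq A) ?e (pair_phi q')) X"
    by (simp add: flatten_def X)
  have t: "flatten A q' q'' t = Cm (HSq A) Y (pair_psi q')"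
    by (simp add: flatten_def Y)
  have "Cm (VSq A) (Cm (HSq A) ?e (pair_phi q')) (Cm (HSq A) Y (pair_psi q')) = Y"
    using interchange [of "pair_psi q'" Y "pair_phi q'" ?e] by simp
  then have "Cm (VSq A) (Cm (HSq A) (Cm (HSq A) ?e (pair_phi q')) X)
      (Cm (HSq A) (Cm (HSq A) Y (pair_psi q')) ?e') = Cm (HSq A) Y X"
    using interchange [of ?e' "Cm (HSq A) Y (pair_psi q')" X "Cm (HSq A) ?e (pair_phi q')"]
    by simp
  then show ?thesis
    unfolding s t by (simp add: flatten_def X Y)
qed

text \<open>The two squares of a composite pair are pastings of two layers, and interchange
  distributes these layers over \<open>s\<close> and \<open>t\<close>.\<close>

lemma flatten_VSq:
  assumes "s \<in> Ar (HSq A)" "t \<in> Ar (HSq A)" "Cd (VSq A) s = Dm (VSq A) t"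
    "q \<in> pairs A" "q' \<in> pairs A" "r \<in> pairs A" "r' \<in> pairs A"
    "Dm (HSq A) s = pair_ver q" "Cd (HSq A) s = pair_ver q'"
    "Dm (HSq A) t = pair_ver r" "Cd (HSq A) t = pair_ver r'"
    "Cd (Hor A) (pair_hor q) = Dm (Hor A) (pair_hor r)" "Cd (Hor A) (pair_hor q') = Dm (Hor A) (pair_hor r')"
  shows "flatten A (RR_comp A r q) (RR_comp A r' q') (Cm (VSq A) t s) =
    Cm (VSq A) (Cm (HSq A) (flatten A r r' t) (Idt (VSq A) (pair_hor q)))
      (Cm (HSq A) (Idt (VSq A) (pair_hor r')) (flatten A q q' s))"
proof -
  note [simp] = square_simps Idt_HSq_units RR_mor_simps [OF assms(4)] RR_mor_simps [OF assms(5)]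
    RR_mor_simps [OF assms(6)] RR_mor_simps [OF assms(7)] assms
  note [simp] = corners
  have "Cm (HSq A) (Cm (VSq A) t s) (pair_psi (RR_comp A r q)) =
      Cm (VSq A) (Cm (HSq A) t (Cm (HSq A) (pair_psi r) (Idt (VSq A) (pair_hor q))))
        (Cm (HSq A) s (pair_psi q))"
    using interchange [of "pair_psi q" s "Cm (HSq A) (pair_psi r) (Idt (VSq A) (pair_hor q))" t]
    by simp
  then show ?thesis
    using interchange [of "Cm (HSq A) s (pair_psi q)" "Cm (HSq A) (Idt (VSq A) (pair_hor r')) (pair_phi q')"
        "Cm (HSq A) t (Cm (HSq A) (pair_psi r) (Idt (VSq A) (pair_hor q)))" "pair_phi r'"]
    by (simp add: flatten_def)
qed

lemma flatten_Idt:
  "q \<in> pairs A \<Longrightarrow> flatten A q q (Idt (HSq A) (pair_ver q)) = Idt (VSq A) (pair_hor q)"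
  "f \<in> Ar (Hor A) \<Longrightarrow> flatten A (RR_id A (Dm (Hor A) f)) (RR_id A (Cd (Hor A) f)) (Idt (VSq A) f) = Idt (VSq A) f"
  by (simp_all add: flatten_def RR_cell_simps)

end

section \<open>Functoriality of the 2-category of companion pairs\<close>

locale coded_double_functor = coding U
  for U :: "'u itself" +
  fixes F :: "'u dblfun"
  assumes F: "double_functor F"
begin

sublocale A: coded_double_category U "dsrc F"
  using F by (intro coded_double_category.intro coding_axioms) (simp add: double_functor_def)

sublocale B: coded_double_category U "dtgt F"
  using F by (intro coded_double_category.intro coding_axioms) (simp add: double_functor_def)

lemmas F_simps = double_functor_maps [OF F]

lemma RR_pair_map_simps [simp]:
  "pair_hor (RR_pair_map F p) = dfh F (pair_hor p)"
  "pair_ver (RR_pair_map F p) = dfv F (pair_ver p)"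
  "pair_phi (RR_pair_map F p) = dfs F (pair_phi p)"
  "pair_psi (RR_pair_map F p) = dfs F (pair_psi p)"
  by (simp_all add: RR_pair_map_def pair_hor_def pair_ver_def pair_phi_def pair_psi_def split: prod.splits)

lemma RR_pair_map_enc: "RR_pair_map F p =
    enc (dfh F (pair_hor p), dfv F (pair_ver p), dfs F (pair_phi p), dfs F (pair_psi p))"
  by (simp add: RR_pair_map_def pair_hor_def pair_ver_def pair_phi_def pair_psi_def split: prod.splits)

lemma RR_pair_map_mem:
  assumes "p \<in> pairs (dsrc F)"
  shows "RR_pair_map F p \<in> pairs (dtgt F)"
proof -
  note [simp] = A.RR_cell_simps F_simps assms
  have "Cm (HSq (dtgt F)) (dfs F (pair_phi p)) (dfs F (pair_psi p)) = Idt (VSq (dtgt F)) (dfh F (pair_hor p))"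
    "Cm (VSq (dtgt F)) (dfs F (pair_phi p)) (dfs F (pair_psi p)) = Idt (HSq (dtgt F)) (dfv F (pair_ver p))"
    using F_simps(19,20) [of "pair_psi p" "pair_phi p"] by simp_all
  then show ?thesis
    unfolding RR_pair_map_enc enc_mem_RR_mor
    by (intro B.companion_pairI [of _ _ _ _ "dfo F (Dm (Hor (dsrc F)) (pair_hor p))"
          "dfo F (Cd (Hor (dsrc F)) (pair_hor p))"]) simp_all
qed

lemma RR_pair_map_id: "x \<in> Ob (Hor (dsrc F)) \<Longrightarrow> RR_pair_map F (RR_id (dsrc F) x) = RR_id (dtgt F) (dfo F x)"
  by (rule RR_mor_eqI [of _ "dtgt F"])
    (simp_all add: RR_pair_map_mem A.RR_cell_simps B.RR_cell_simps F_simps)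

lemma RR_pair_map_comp:
  assumes "p \<in> pairs (dsrc F)" "q \<in> pairs (dsrc F)"
    "Cd (Hor (dsrc F)) (pair_hor p) = Dm (Hor (dsrc F)) (pair_hor q)"
  shows "RR_pair_map F (RR_comp (dsrc F) q p) = RR_comp (dtgt F) (RR_pair_map F q) (RR_pair_map F p)"
  by (rule RR_mor_eqI [of _ "dtgt F"])
    (use assms in \<open>simp_all add: RR_pair_map_mem A.RR_cell_simps B.RR_comp_mem F_simps\<close>)

lemma RR_fun_simps [simp]:
  "tsrc (RR_fun F) = RR (dsrc F)" "ttgt (RR_fun F) = RR (dtgt F)" "tf0 (RR_fun F) = dfo F"
  "p \<in> pairs (dsrc F) \<Longrightarrow> tf1 (RR_fun F) p = RR_pair_map F p"
  "enc (p, p', s) \<in> Ar (VTwo (RR (dsrc F))) \<Longrightarrow>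
    tf2 (RR_fun F) (enc (p, p', s)) = enc (RR_pair_map F p, RR_pair_map F p', dfs F s)"
  by (simp_all add: RR_fun_def)

lemma two_functor_RR_fun: "two_functor (RR_fun F)"
proof -
  interpret RA: two_category "RR (dsrc F)" by (rule A.two_category_RR)
  interpret RB: two_category "RR (dtgt F)" by (rule B.two_category_RR)
  note [simp] = A.RR_cell_simps F_simps RR_pair_map_mem RR_pair_map_id RR_pair_map_comp
  have "is_functor (One (RR (dsrc F))) (One (RR (dtgt F))) (dfo F) (tf1 (RR_fun F))"
    by (intro is_functor_intros RA.one.category_axioms RB.one.category_axioms)
      simp_all
  moreover have "is_functor (VTwo (RR (dsrc F))) (VTwo (RR (dtgt F))) (tf1 (RR_fun F)) (tf2 (RR_fun F))"
    by (intro is_functor_intros RA.vtwo.category_axioms RB.vtwo.category_axioms)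
      (auto elim!: RR_cellE)
  moreover have "is_functor (HTwo (RR (dsrc F))) (HTwo (RR (dtgt F))) (dfo F) (tf2 (RR_fun F))"
    by (intro is_functor_intros RA.htwo.category_axioms RB.htwo.category_axioms)
      (auto elim!: RR_cellE)
  moreover have "tf1 (RR_fun F) \<in> extensional (pairs (dsrc F))"
    "tf2 (RR_fun F) \<in> extensional (Ar (VTwo (RR (dsrc F))))"
    by (simp_all add: RR_fun_def)
  ultimately show ?thesis
    using F unfolding two_functor_def double_functor_def
    by (simp add: RA.two_category_axioms RB.two_category_axioms)
qed

end

context
  fixes \<kappa> :: "'u rel"
  assumes \<kappa>: "universe \<kappa>"
begin

lemma small_two_category_RR:
  assumes "small_double_category \<kappa> A"
  shows "small_two_category \<kappa> (RR A)"
proof -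
  have A: "double_category A" "|Ob (Hor A)| <o \<kappa>" "|Ar (Hor A)| <o \<kappa>" "|Ar (Ver A)| <o \<kappa>"
      "|Ar (HSq A)| <o \<kappa>"
    using assms by (auto simp: small_double_category_def small_def)
  interpret coding "TYPE('u)" by (rule universe_coding [OF \<kappa>])
  interpret double_category A by (rule A)
  interpret coded_double_category "TYPE('u)" A ..
  have "|Ar (Hor A) \<times> Ar (Ver A) \<times> Ar (HSq A) \<times> Ar (HSq A)| <o \<kappa>"
    by (intro universe_Times [OF \<kappa>] A)
  moreover have "pairs A \<subseteq> enc ` (Ar (Hor A) \<times> Ar (Ver A) \<times> Ar (HSq A) \<times> Ar (HSq A))"
    by (auto simp: RR_def RR_mor_def elim!: companion_pairE)
  ultimately have 1: "|pairs A| <o \<kappa>"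
    by (rule universe_image [OF \<kappa>])
  have "|pairs A \<times> pairs A \<times> Ar (HSq A)| <o \<kappa>"
    by (intro universe_Times [OF \<kappa>] 1 A)
  moreover have "Ar (VTwo (RR A)) \<subseteq> enc ` (pairs A \<times> pairs A \<times> Ar (HSq A))"
    by (auto elim!: RR_cellE)
  ultimately have 2: "|Ar (VTwo (RR A))| <o \<kappa>"
    by (rule universe_image [OF \<kappa>])
  show ?thesis
    using 1 2 A two_category_RR by (simp add: small_two_category_def small_def)
qed

lemma is_functor_RR: "is_functor (DblCat \<kappa>) (TwoCat \<kappa>) RR RR_fun"
proof (intro is_functor.intro category_TwoCat category_DblCat is_functor_axioms.intro)
  interpret coding "TYPE('u)" by (rule universe_coding [OF \<kappa>])
  fix F G :: "'u dblfun"
  assume F: "F \<in> Ar (DblCat \<kappa>)"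
  then interpret F: coded_double_functor "TYPE('u)" F by unfold_locales simp
  show "RR_fun F \<in> Ar (TwoCat \<kappa>)" "Dm (TwoCat \<kappa>) (RR_fun F) = RR (Dm (DblCat \<kappa>) F)"
    "Cd (TwoCat \<kappa>) (RR_fun F) = RR (Cd (DblCat \<kappa>) F)"
    using F small_two_category_RR F.two_functor_RR_fun by simp_all
  assume G: "G \<in> Ar (DblCat \<kappa>)" and FG: "Cd (DblCat \<kappa>) F = Dm (DblCat \<kappa>) G"
  interpret G: coded_double_functor "TYPE('u)" G using G by unfold_locales simp
  have FG: "dtgt F = dsrc G" using FG by simp
  have GF': "double_functor (Cm (DblCat \<kappa>) G F)"
    using double_functor_Cm F.F G.F FG .
  interpret GF: coded_double_functor "TYPE('u)" "Cm (DblCat \<kappa>) G F"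
    using GF' by unfold_locales
  have *: "RR_pair_map (Cm (DblCat \<kappa>) G F) p = RR_pair_map G (RR_pair_map F p)"
    if "p \<in> pairs (dsrc F)" for p
    using F.A.RR_mor_simps [OF that] by (simp add: GF.RR_pair_map_enc G.RR_pair_map_enc compose_def)
  have GF_simps: "p \<in> pairs (dsrc F) \<Longrightarrow>
      tf1 (RR_fun (Cm (DblCat \<kappa>) G F)) p = RR_pair_map G (RR_pair_map F p)"
    "enc (p, p', s) \<in> Ar (VTwo (RR (dsrc F))) \<Longrightarrow> tf2 (RR_fun (Cm (DblCat \<kappa>) G F)) (enc (p, p', s)) =
      enc (RR_pair_map G (RR_pair_map F p), RR_pair_map G (RR_pair_map F p'), dfs G (dfs F s))" for p p' s
    using GF.RR_fun_simps(4,5) * by (simp_all add: compose_def)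
  have mem: "p \<in> pairs (dsrc F) \<Longrightarrow> RR_pair_map F p \<in> pairs (dsrc G)" for p
    using F.RR_pair_map_mem FG by simp
  show "RR_fun (Cm (DblCat \<kappa>) G F) = Cm (TwoCat \<kappa>) (RR_fun G) (RR_fun F)"
  proof (rule two_functor_eqI)
    show "two_functor (Cm (TwoCat \<kappa>) (RR_fun G) (RR_fun F))"
      by (intro two_functor_Cm F.two_functor_RR_fun G.two_functor_RR_fun) (simp add: FG)
    fix c assume "c \<in> Ar (VTwo (tsrc (Cm (TwoCat \<kappa>) (RR_fun G) (RR_fun F))))"
    then have c: "c \<in> Ar (VTwo (RR (dsrc F)))" by simp
    then obtain p p' s :: 'u where c': "c = enc (p, p', s)" by (rule RR_cellE)
    have "tf2 (RR_fun F) c \<in> Ar (VTwo (RR (dsrc G)))"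
      using two_functor_maps(3) [OF F.two_functor_RR_fun] c FG by simp
    then show "tf2 (RR_fun (Cm (DblCat \<kappa>) G F)) c = tf2 (Cm (TwoCat \<kappa>) (RR_fun G) (RR_fun F)) c"
      using c c' G.RR_fun_simps(5) GF_simps(2) F.RR_fun_simps(5) by (simp add: compose_def del: enc_mem_RR_cells)
  qed (use GF_simps(1) mem in \<open>simp_all add: GF.two_functor_RR_fun compose_def\<close>)
next
  interpret coding "TYPE('u)" by (rule universe_coding [OF \<kappa>])
  fix A :: "'u dblcat" assume A: "A \<in> Ob (DblCat \<kappa>)"
  then show "RR A \<in> Ob (TwoCat \<kappa>)" by (simp add: small_two_category_RR)
  from A have A: "double_category A" by (simp add: small_double_category_def)
  interpret double_category A by (rule A)
  interpret coded_double_category "TYPE('u)" A ..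
  have "double_functor (Idt (DblCat \<kappa>) A)" by (rule double_functor_Idt [OF A])
  then interpret I: coded_double_functor "TYPE('u)" "Idt (DblCat \<kappa>) A" by unfold_locales
  have *: "RR_pair_map (Idt (DblCat \<kappa>) A) p = p" if p: "p \<in> pairs A" for p
    by (rule RR_mor_eqI [of _ A]) (use I.RR_pair_map_mem p RR_mor_simps [OF p] in simp_all)
  have **: "p \<in> pairs A \<Longrightarrow> tf1 (RR_fun (Idt (DblCat \<kappa>) A)) p = p"
    "enc (p, p', s) \<in> Ar (VTwo (RR A)) \<Longrightarrow> tf2 (RR_fun (Idt (DblCat \<kappa>) A)) (enc (p, p', s)) = enc (p, p', s)"
    for p p' s :: 'u
    using I.RR_fun_simps(4) [of p] I.RR_fun_simps(5) [of p p' s] * [of p] * [of p'] by simp_all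
  show "RR_fun (Idt (DblCat \<kappa>) A) = Idt (TwoCat \<kappa>) (RR A)"
  proof (rule two_functor_eqI)
    fix c assume "c \<in> Ar (VTwo (tsrc (Idt (TwoCat \<kappa>) (RR A))))"
    then have c: "c \<in> Ar (VTwo (RR A))" by simp
    then obtain p p' s :: 'u where c': "c = enc (p, p', s)" by (rule RR_cellE)
    show "tf2 (RR_fun (Idt (DblCat \<kappa>) A)) c = tf2 (Idt (TwoCat \<kappa>) (RR A)) c"
      using **(2) [of p p' s] c by (simp add: c' del: enc_mem_RR_cells)
  next
    fix p assume "p \<in> Ar (One (tsrc (Idt (TwoCat \<kappa>) (RR A))))"
    then show "tf1 (RR_fun (Idt (DblCat \<kappa>) A)) p = tf1 (Idt (TwoCat \<kappa>) (RR A)) p"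
      using **(1) [of p] by simp
  qed (use I.two_functor_RR_fun I.RR_fun_simps in \<open>auto simp: two_functor_Idt two_category_RR\<close>)
qed

end

section \<open>Unit and counit\<close>

locale coded_two_category = coding U + two_category A
  for U :: "'u itself" and A :: "'u twocat"
begin

sublocale Sq: coded_double_category U "Sq A"
  by (intro coded_double_category.intro coding_axioms double_category_Sq two_category_axioms)

lemma Sq_pair_simps [simp]:
  "pair_hor (Sq_pair A f) = f" "pair_ver (Sq_pair A f) = f"
  "pair_phi (Sq_pair A f) =
    enc (f, Idt (One A) (Cd (One A) f), f, Idt (One A) (Cd (One A) f), Idt (VTwo A) f)"
  "pair_psi (Sq_pair A f) =
    enc (Idt (One A) (Dm (One A) f), f, Idt (One A) (Dm (One A) f), f, Idt (VTwo A) f)"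
  by (simp_all add: Sq_pair_def Let_def)

lemma Sq_pair_companion:
  "f \<in> Ar (One A) \<Longrightarrow> companion_pair (Sq A) f f (pair_phi (Sq_pair A f)) (pair_psi (Sq_pair A f))"
  by (rule Sq.companion_pairI [of _ _ _ _ "Dm (One A) f" "Cd (One A) f"]) (simp_all add: cell_simps)

lemma Sq_pair_mem: "f \<in> Ar (One A) \<Longrightarrow> Sq_pair A f \<in> pairs (Sq A)"
  using Sq_pair_companion [of f] by (simp add: Sq_pair_def Let_def enc_mem_RR_mor)

lemma Sq_pair_Idt: "x \<in> Ob (One A) \<Longrightarrow> Sq_pair A (Idt (One A) x) = RR_id (Sq A) x"
  by (simp add: Sq_pair_def Let_def RR_id_def cell_simps)

lemma Sq_pair_Cm:
  "\<lbrakk>f \<in> Ar (One A); g \<in> Ar (One A); Cd (One A) f = Dm (One A) g\<rbrakk>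
  \<Longrightarrow> Sq_pair A (Cm (One A) g f) = RR_comp (Sq A) (Sq_pair A g) (Sq_pair A f)"
  by (rule RR_mor_eqI [of _ "Sq A"]) (simp_all add: Sq_pair_mem Sq.RR_comp_mem cell_simps)

lemma Sq_RR_unit_simps [simp]:
  "tsrc (Sq_RR_unit A) = A" "ttgt (Sq_RR_unit A) = RR (Sq A)"
  "x \<in> Ob (One A) \<Longrightarrow> tf0 (Sq_RR_unit A) x = x"
  "f \<in> Ar (One A) \<Longrightarrow> tf1 (Sq_RR_unit A) f = Sq_pair A f"
  "\<alpha> \<in> Ar (VTwo A) \<Longrightarrow> tf2 (Sq_RR_unit A) \<alpha> = enc (Sq_pair A (Dm (VTwo A) \<alpha>), Sq_pair A (Cd (VTwo A) \<alpha>),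
    enc (Dm (VTwo A) \<alpha>, Cd (VTwo A) \<alpha>, Idt (One A) (Dm (One A) (Dm (VTwo A) \<alpha>)),
      Idt (One A) (Cd (One A) (Dm (VTwo A) \<alpha>)), \<alpha>) :: 'u)"
  by (simp_all add: Sq_RR_unit_def Let_def)

lemma cell_boundary:
  assumes "\<alpha> \<in> Ar (VTwo A)"
  shows "Dm (VTwo A) \<alpha> \<in> Ar (One A)" "Cd (VTwo A) \<alpha> \<in> Ar (One A)"
    "Dm (One A) (Cd (VTwo A) \<alpha>) = Dm (One A) (Dm (VTwo A) \<alpha>)"
    "Cd (One A) (Cd (VTwo A) \<alpha>) = Cd (One A) (Dm (VTwo A) \<alpha>)"
  using assms vtwo.Dm_in vtwo.Cd_in Dm_Dm [of \<alpha>] Dm_Cd [of \<alpha>] Cd_Dm [of \<alpha>] Cd_Cd [of \<alpha>]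
  by (auto simp: Ob_VTwo)

lemma two_functor_Sq_RR_unit: "two_functor (Sq_RR_unit A)"
proof -
  interpret R: two_category "RR (Sq A)" by (rule Sq.two_category_RR)
  note [simp] = cell_simps Sq_pair_mem Sq_pair_Idt Sq_pair_Cm cell_boundary
  have "is_functor (One A) (One (RR (Sq A))) (tf0 (Sq_RR_unit A)) (tf1 (Sq_RR_unit A))"
    by (intro is_functor_intros one.category_axioms R.one.category_axioms)
      simp_all
  moreover have "is_functor (VTwo A) (VTwo (RR (Sq A))) (tf1 (Sq_RR_unit A)) (tf2 (Sq_RR_unit A))"
  proof (intro is_functor_intros vtwo.category_axioms R.vtwo.category_axioms, goal_cases)
    case (6 \<alpha> \<beta>)
    then have "Dm (One A) (Dm (VTwo A) \<beta>) = Dm (One A) (Dm (VTwo A) \<alpha>)"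
      "Cd (One A) (Dm (VTwo A) \<beta>) = Cd (One A) (Dm (VTwo A) \<alpha>)"
      using cell_boundary [of \<alpha>] by simp_all
    with 6 show ?case by simp
  qed simp_all
  moreover have "is_functor (HTwo A) (HTwo (RR (Sq A))) (tf0 (Sq_RR_unit A)) (tf2 (Sq_RR_unit A))"
    by (intro is_functor_intros htwo.category_axioms R.htwo.category_axioms)
      (simp_all add: Ob_HTwo Ar_HTwo Dm_HTwo Cd_HTwo Idt_HTwo whisker_exchange(1))
  ultimately show ?thesis
    unfolding two_functor_def
    by (simp add: two_category_axioms R.two_category_axioms) (simp add: Sq_RR_unit_def)
qed

end

lemmas (in coded_two_category) Sq_RR_unit_cell =
  two_functor_maps(3) [OF two_functor_Sq_RR_unit, unfolded Sq_RR_unit_simps(1,2)]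

text \<open>The square of \<open>Sq (RR A)\<close> that the counit sends to the square \<open>s\<close> of \<open>A\<close>.\<close>

definition lift_square :: "'u dblcat \<Rightarrow> 'u \<Rightarrow> 'u \<Rightarrow> 'u \<Rightarrow> 'u \<Rightarrow> 'u \<Rightarrow> 'u" where
  "lift_square A p p' q q' s =
    enc (p, p', q, q', enc (RR_comp A q' p, RR_comp A p' q, flatten A q q' s) :: 'u)"

text \<open>By \<open>lift_square_mem\<close> and \<open>lift_squareE\<close> these data are exactly
  the squares of \<open>Sq (RR A)\<close>, seen as squares of \<open>A\<close> with companion pairs
  chosen on all four sides.\<close>

definition pair_square :: "'u dblcat \<Rightarrow> 'u \<Rightarrow> 'u \<Rightarrow> 'u \<Rightarrow> 'u \<Rightarrow> 'u \<Rightarrow> bool" where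
  "pair_square A p p' q q' s \<longleftrightarrow> p \<in> pairs A \<and> p' \<in> pairs A \<and>
    q \<in> pairs A \<and> q' \<in> pairs A \<and>
    s \<in> squares A (pair_hor p) (pair_hor p') (pair_ver q) (pair_ver q')"

text \<open>A vertical morphism of \<open>Sq (RR A)\<close> is again a companion pair and goes to
  its vertical part. Squares therefore have to be transposed back by
  \<open>unflatten\<close>.\<close>

definition counit :: "'u dblcat \<Rightarrow> 'u dblfun" where
  "counit A = \<lparr>dsrc = Sq (RR A), dtgt = A, dfo = restrict id (Ob (Hor A)),
    dfh = restrict pair_hor (pairs A), dfv = restrict pair_ver (pairs A),
    dfs = restrict (\<lambda>x. case (dec x :: 'u sqcell) of (p, p', q, q', c) \<Rightarrow>
      case (dec c :: 'u comp_cell) of (r, r', s) \<Rightarrow> unflatten A (pair_hor p) (pair_hor p') q q' s)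
      (Ar (HSq (Sq (RR A))))\<rparr>"

section \<open>Squares of \<open>Sq (RR A)\<close> as squares of \<open>A\<close>, and functoriality
  of the counit\<close>

context coded_double_category
begin

lemma RR_comp_assoc:
  "\<lbrakk>p \<in> pairs A; q \<in> pairs A; r \<in> pairs A;
    Cd (Hor A) (pair_hor p) = Dm (Hor A) (pair_hor q); Cd (Hor A) (pair_hor q) = Dm (Hor A) (pair_hor r)\<rbrakk>
  \<Longrightarrow> RR_comp A (RR_comp A r q) p = RR_comp A r (RR_comp A q p)"
  using category.Cm_assoc [OF category_One_RR, of p q r] by simp

lemma RR_comp_id:
  "\<lbrakk>p \<in> pairs A; Dm (Hor A) (pair_hor p) = x\<rbrakk> \<Longrightarrow> RR_comp A p (RR_id A x) = p"
  "\<lbrakk>p \<in> pairs A; Cd (Hor A) (pair_hor p) = x\<rbrakk> \<Longrightarrow> RR_comp A (RR_id A x) p = p"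
  using category.Cm_Idt_eq [OF category_One_RR, of p x] category.Idt_Cm_eq [OF category_One_RR, of p x]
  by simp_all

lemma pair_squareD:
  assumes "pair_square A p p' q q' s"
  shows "p \<in> pairs A" "p' \<in> pairs A" "q \<in> pairs A" "q' \<in> pairs A"
    and "s \<in> Ar (HSq A)" "Dm (VSq A) s = pair_hor p" "Cd (VSq A) s = pair_hor p'"
    "Dm (HSq A) s = pair_ver q" "Cd (HSq A) s = pair_ver q'"
    and "Dm (Hor A) (pair_hor q) = Dm (Hor A) (pair_hor p)" "Dm (Hor A) (pair_hor q') = Cd (Hor A) (pair_hor p)"
    "Cd (Hor A) (pair_hor q) = Dm (Hor A) (pair_hor p')" "Cd (Hor A) (pair_hor q') = Cd (Hor A) (pair_hor p')"
  using assms corner_tl [of s] corner_tr [of s] corner_bl [of s] corner_br [of s]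
  by (simp_all add: pair_square_def squares_def RR_mor_simps)

lemma lift_square_mem: "pair_square A p p' q q' s \<Longrightarrow> lift_square A p p' q q' s \<in> Ar (HSq (Sq (RR A)))"
  by (simp add: lift_square_def pair_squareD RR_cell_simps flatten_mem)

text \<open>Flattening is onto: unflattening the underlying 2-cell gives the required
  preimage.\<close>

lemma lift_squareE:
  assumes "x \<in> Ar (HSq (Sq (RR A)))"
  obtains p p' q q' s where "x = lift_square A p p' q q' s" "pair_square A p p' q q' s"
proof -
  obtain p p' q q' c where x: "x = enc (p, p', q, q', c)"
    and m: "p \<in> pairs A" "p' \<in> pairs A" "q \<in> pairs A" "q' \<in> pairs A"
    and c: "c \<in> Ar (VTwo (RR A))" "Dm (VTwo (RR A)) c = RR_comp A q' p" "Cd (VTwo (RR A)) c = RR_comp A p' q"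
    and d: "Dm (Hor A) (pair_hor q) = Dm (Hor A) (pair_hor p)" "Dm (Hor A) (pair_hor q') = Cd (Hor A) (pair_hor p)"
      "Cd (Hor A) (pair_hor q) = Dm (Hor A) (pair_hor p')" "Cd (Hor A) (pair_hor q') = Cd (Hor A) (pair_hor p')"
    using assms by (rule Sq_cellE) simp
  obtain s where s: "c = enc (RR_comp A q' p, RR_comp A p' q, s)" "s \<in> Ar (HSq A)"
    "Dm (VSq A) s = Cm (Hor A) (pair_hor q') (pair_hor p)" "Cd (VSq A) s = Cm (Hor A) (pair_hor p') (pair_hor q)"
    "Dm (HSq A) s = Idt (Ver A) (Dm (Hor A) (pair_hor q))"
    "Cd (HSq A) s = Idt (Ver A) (Cd (Hor A) (pair_hor q'))"
    using c(1) by (rule RR_cellE) (use c m d in \<open>simp add: RR_cell_simps\<close>)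
  have u: "s \<in> Ar (HSq A)" "q \<in> pairs A" "q' \<in> pairs A"
    "pair_hor p \<in> Ar (Hor A)" "pair_hor p' \<in> Ar (Hor A)"
    "Dm (VSq A) s = Cm (Hor A) (pair_hor q') (pair_hor p)" "Cd (VSq A) s = Cm (Hor A) (pair_hor p') (pair_hor q)"
    "Dm (Hor A) (pair_hor p) = Dm (Hor A) (pair_hor q)" "Cd (Hor A) (pair_hor p) = Dm (Hor A) (pair_hor q')"
    "Dm (Hor A) (pair_hor p') = Cd (Hor A) (pair_hor q)" "Cd (Hor A) (pair_hor p') = Cd (Hor A) (pair_hor q')"
    "Dm (HSq A) s = Idt (Ver A) (Dm (Hor A) (pair_hor q))"
    "Cd (HSq A) s = Idt (Ver A) (Cd (Hor A) (pair_hor q'))"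
    using s m d RR_mor_simps(1) by simp_all
  show thesis
    by (rule that [of p p' q q' "unflatten A (pair_hor p) (pair_hor p') q q' s"])
      (use unflatten [OF u] m in
        \<open>simp_all add: lift_square_def pair_square_def squares_def x s\<close>)
qed

lemma lift_square_boundary [simp]:
  "Dm (HSq (Sq (RR A))) (lift_square A p p' q q' s) = q"
  "Cd (HSq (Sq (RR A))) (lift_square A p p' q q' s) = q'"
  "Dm (VSq (Sq (RR A))) (lift_square A p p' q q' s) = p"
  "Cd (VSq (Sq (RR A))) (lift_square A p p' q q' s) = p'"
  by (simp_all add: lift_square_def)

lemma pair_square_HSq:
  assumes s: "pair_square A p p' q q' s" and t: "pair_square A r r' q' q'' t"
  shows "pair_square A (RR_comp A r p) (RR_comp A r' p') q q'' (Cm (HSq A) t s)"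
  using pair_squareD [OF s] pair_squareD [OF t] by (simp add: pair_square_def squares_def RR_cell_simps)

lemma pair_square_VSq:
  assumes s: "pair_square A p p' q q' s" and t: "pair_square A p' p'' r r' t"
  shows "pair_square A p p'' (RR_comp A r q) (RR_comp A r' q') (Cm (VSq A) t s)"
  using pair_squareD [OF s] pair_squareD [OF t] by (simp add: pair_square_def squares_def RR_cell_simps)

lemma lift_square_HSq:
  assumes s: "pair_square A p p' q q' s" and t: "pair_square A r r' q' q'' t"
  shows "Cm (HSq (Sq (RR A))) (lift_square A r r' q' q'' t) (lift_square A p p' q q' s) =
    lift_square A (RR_comp A r p) (RR_comp A r' p') q q'' (Cm (HSq A) t s)"
  using pair_squareD [OF s] pair_squareD [OF t] flatten_HSq [of s t q q' q'']
  by (simp add: lift_square_def RR_comp_assoc)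

lemma lift_square_VSq:
  assumes s: "pair_square A p p' q q' s" and t: "pair_square A p' p'' r r' t"
  shows "Cm (VSq (Sq (RR A))) (lift_square A p' p'' r r' t) (lift_square A p p' q q' s) =
    lift_square A p p'' (RR_comp A r q) (RR_comp A r' q') (Cm (VSq A) t s)"
  using pair_squareD [OF s] pair_squareD [OF t] flatten_VSq [of s t q q' r r']
  by (simp add: lift_square_def RR_comp_assoc)

lemma lift_square_Idt:
  "q \<in> pairs A \<Longrightarrow> Idt (HSq (Sq (RR A))) q =
    lift_square A (RR_id A (Dm (Hor A) (pair_hor q))) (RR_id A (Cd (Hor A) (pair_hor q))) q q (Idt (HSq A) (pair_ver q))"
  "p \<in> pairs A \<Longrightarrow> Idt (VSq (Sq (RR A))) p =
    lift_square A p p (RR_id A (Dm (Hor A) (pair_hor p))) (RR_id A (Cd (Hor A) (pair_hor p))) (Idt (VSq A) (pair_hor p))"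
  by (simp_all add: lift_square_def RR_comp_id flatten_Idt RR_mor_simps)

lemma pair_square_Idt:
  "q \<in> pairs A \<Longrightarrow> pair_square A (RR_id A (Dm (Hor A) (pair_hor q)))
    (RR_id A (Cd (Hor A) (pair_hor q))) q q (Idt (HSq A) (pair_ver q))"
  "p \<in> pairs A \<Longrightarrow> pair_square A p p (RR_id A (Dm (Hor A) (pair_hor p)))
    (RR_id A (Cd (Hor A) (pair_hor p))) (Idt (VSq A) (pair_hor p))"
  by (simp_all add: pair_square_def squares_def RR_cell_simps)

lemma counit_simps [simp]:
  "dsrc (counit A) = Sq (RR A)" "dtgt (counit A) = A"
  "x \<in> Ob (Hor A) \<Longrightarrow> dfo (counit A) x = x"
  "p \<in> pairs A \<Longrightarrow> dfh (counit A) p = pair_hor p"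
  "p \<in> pairs A \<Longrightarrow> dfv (counit A) p = pair_ver p"
  by (simp_all add: counit_def)

lemma counit_lift_square:
  assumes "pair_square A p p' q q' s"
  shows "dfs (counit A) (lift_square A p p' q q' s) = s"
proof -
  have "dfs (counit A) (lift_square A p p' q q' s) =
      unflatten A (pair_hor p) (pair_hor p') q q' (flatten A q q' s)"
    using lift_square_mem [OF assms] by (simp add: counit_def lift_square_def del: enc_mem_Sq)
  then show ?thesis
    using unflatten_flatten [of s q q'] pair_squareD [OF assms] by simp
qed

text \<open>Every square of the source is a lifted one, lifting is compatible with identities and
  both compositions, and the counit returns the square that was lifted. So the functor laws are read
  off in \<open>A\<close>.\<close>

lemma double_functor_counit: "double_functor (counit A)"
proof -
  interpret R: two_category "RR A" by (rule two_category_RR)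
  interpret S: double_category "Sq (RR A)" by (rule double_category_Sq [OF two_category_RR])
  note [simp] = RR_cell_simps counit_lift_square pair_squareD pair_square_Idt pair_square_HSq pair_square_VSq
  have "is_functor (One (RR A)) (Hor A) (dfo (counit A)) (dfh (counit A))"
    by (intro is_functor_intros R.one.category_axioms hor.category_axioms) simp_all
  moreover have "is_functor (One (RR A)) (Ver A) (dfo (counit A)) (dfv (counit A))"
    by (intro is_functor_intros R.one.category_axioms ver.category_axioms) simp_all
  moreover have "is_functor (HSq (Sq (RR A))) (HSq A) (dfv (counit A)) (dfs (counit A))"
  proof (intro is_functor_intros S.hsq.category_axioms hsq.category_axioms, goal_cases)
    case (5 q)
    then show ?case by (simp add: lift_square_Idt(1) del: Sq_simps(10))
  next
    case (6 x y)
    then show ?case by (auto elim!: lift_squareE simp: lift_square_HSq)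
  qed (auto elim!: lift_squareE)
  moreover have "is_functor (VSq (Sq (RR A))) (VSq A) (dfh (counit A)) (dfs (counit A))"
  proof (intro is_functor_intros S.vsq.category_axioms vsq.category_axioms, goal_cases)
    case (5 p)
    then show ?case by (simp add: lift_square_Idt(2) del: Sq_simps(11))
  next
    case (6 x y)
    then show ?case by (auto elim!: lift_squareE simp: lift_square_VSq)
  qed (auto elim!: lift_squareE)
  ultimately show ?thesis
    unfolding double_functor_def
    by (simp add: S.double_category_axioms double_category_axioms) (simp add: counit_def)
qed

end

section \<open>The adjunction between squares and companion pairs\<close>

text \<open>The locale \<open>adjunction\<close> asks for a universal unit. Naturality and the
  triangle identities provide it, with \<open>\<epsilon> y\<close> after \<open>Sa f\<close> as the
  arrow corresponding to \<open>f\<close>.\<close>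

lemma adjunction_of_counit:
  assumes S: "is_functor D C So Sa" and R: "is_functor C D Ro Ra"
    and u: "\<And>x. x \<in> Ob D \<Longrightarrow> u x \<in> hom D x (Ro (So x))"
    and u_nat: "\<And>f x y. f \<in> hom D x y \<Longrightarrow> Cm D (Ra (Sa f)) (u x) = Cm D (u y) f"
    and e: "\<And>y. y \<in> Ob C \<Longrightarrow> \<epsilon> y \<in> hom C (So (Ro y)) y"
    and e_nat: "\<And>g x y. g \<in> hom C x y \<Longrightarrow> Cm C (\<epsilon> y) (Sa (Ra g)) = Cm C g (\<epsilon> x)"
    and tri1: "\<And>y. y \<in> Ob C \<Longrightarrow> Cm D (Ra (\<epsilon> y)) (u (Ro y)) = Idt D (Ro y)"
    and tri2: "\<And>x. x \<in> Ob D \<Longrightarrow> Cm C (\<epsilon> (So x)) (Sa (u x)) = Idt C (So x)"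
  shows "adjunction D C So Sa Ro Ra u"
proof -
  interpret S: is_functor D C So Sa by fact
  interpret R: is_functor C D Ro Ra by fact
  show ?thesis
  proof (intro adjunction.intro S R adjunction_axioms.intro)
    fix x assume "x \<in> Ob D" then show "u x \<in> hom D x (Ro (So x))" by (rule u)
  next
    fix f assume "f \<in> Ar D"
    then show "Cm D (Ra (Sa f)) (u (Dm D f)) = Cm D (u (Cd D f)) f"
      by (intro u_nat S.dom.Ar_hom)
  next
    fix x y f assume x: "x \<in> Ob D" and y: "y \<in> Ob C" and f: "f \<in> hom D x (Ro y)"
    note Sf = S.Fa_hom [OF f] and RSf = R.Fa_hom [OF S.Fa_hom [OF f]]
    show "\<exists>!g. g \<in> hom C (So x) y \<and> Cm D (Ra g) (u x) = f"
    proof (rule ex1I [of _ "Cm C (\<epsilon> y) (Sa f)"], rule conjI)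
      show "Cm C (\<epsilon> y) (Sa f) \<in> hom C (So x) y" by (rule S.cod.Cm_hom [OF Sf e [OF y]])
      have "Cm D (Ra (Cm C (\<epsilon> y) (Sa f))) (u x) = Cm D (Ra (\<epsilon> y)) (Cm D (Ra (Sa f)) (u x))"
        using R.Fa_Cm_hom [OF Sf e [OF y]] S.dom.Cm_assoc_hom [OF u [OF x] RSf R.Fa_hom [OF e [OF y]]]
        by simp
      also have "\<dots> = Cm D (Cm D (Ra (\<epsilon> y)) (u (Ro y))) f"
        using u_nat [OF f] S.dom.Cm_assoc_hom [OF f u [OF R.Fo_in [OF y]] R.Fa_hom [OF e [OF y]]] by simp
      also have "\<dots> = f" using tri1 [OF y] S.dom.Idt_Cm_hom [OF f] by simp
      finally show "Cm D (Ra (Cm C (\<epsilon> y) (Sa f))) (u x) = f" .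
    next
      fix g assume "g \<in> hom C (So x) y \<and> Cm D (Ra g) (u x) = f"
      then have g: "g \<in> hom C (So x) y" and f': "f = Cm D (Ra g) (u x)" by auto
      have Sx: "So x \<in> Ob C" by (rule S.Fo_in [OF x])
      note Su = S.Fa_hom [OF u [OF x]]
      have "Cm C (\<epsilon> y) (Sa f) = Cm C (Cm C (\<epsilon> y) (Sa (Ra g))) (Sa (u x))"
        using S.Fa_Cm_hom [OF u [OF x] R.Fa_hom [OF g]]
          S.cod.Cm_assoc_hom [OF Su S.Fa_hom [OF R.Fa_hom [OF g]] e [OF y]] by (simp add: f')
      also have "\<dots> = Cm C g (Cm C (\<epsilon> (So x)) (Sa (u x)))"
        using e_nat [OF g] S.cod.Cm_assoc_hom [OF Su e [OF Sx] g] by simp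
      also have "\<dots> = g" using tri2 [OF x] S.cod.Cm_Idt_hom [OF g] by simp
      finally show "g = Cm C (\<epsilon> y) (Sa f)" by simp
    qed
  qed
qed

section \<open>Naturality of the counit\<close>

context coded_double_functor
begin

lemma flatten_map:
  assumes "s \<in> Ar (HSq (dsrc F))" "q \<in> pairs (dsrc F)" "q' \<in> pairs (dsrc F)"
    "Dm (HSq (dsrc F)) s = pair_ver q" "Cd (HSq (dsrc F)) s = pair_ver q'"
  shows "dfs F (flatten (dsrc F) q q' s) = flatten (dtgt F) (RR_pair_map F q) (RR_pair_map F q') (dfs F s)"
  using assms by (simp add: flatten_def F_simps A.RR_cell_simps)

lemma pair_square_map:
  assumes "pair_square (dsrc F) p p' q q' s"
  shows "pair_square (dtgt F) (RR_pair_map F p) (RR_pair_map F p')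
    (RR_pair_map F q) (RR_pair_map F q') (dfs F s)"
  using A.pair_squareD [OF assms] by (simp add: pair_square_def squares_def F_simps RR_pair_map_mem)

text \<open>A double functor preserves the companion squares that enter \<open>flatten\<close>. Both
  the naturality of the counit and \<open>canonical_Sq_RR\<close> rest on this.\<close>

lemma Sq_RR_lift_square:
  assumes s: "pair_square (dsrc F) p p' q q' s"
  shows "dfs (Sq_fun (RR_fun F)) (lift_square (dsrc F) p p' q q' s) =
    lift_square (dtgt F) (RR_pair_map F p) (RR_pair_map F p') (RR_pair_map F q) (RR_pair_map F q') (dfs F s)"
proof -
  have "lift_square (dsrc F) p p' q q' s \<in> Ar (HSq (Sq (tsrc (RR_fun F))))"
    using A.lift_square_mem [OF s] by simp
  moreover have "enc (RR_comp (dsrc F) q' p, RR_comp (dsrc F) p' q, flatten (dsrc F) q q' s)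
      \<in> Ar (VTwo (RR (dsrc F)))"
    using A.lift_square_mem [OF s] by (simp add: lift_square_def)
  ultimately show ?thesis
    using A.pair_squareD [OF s]
    unfolding lift_square_def
    by (subst Sq_fun_simps) (simp_all add: RR_pair_map_comp flatten_map A.RR_comp_mem del: enc_mem_Sq enc_mem_RR_cells)
qed

lemma counit_natural:
  "Cm (DblCat \<kappa>) (counit (dtgt F)) (Sq_fun (RR_fun F)) = Cm (DblCat \<kappa>) F (counit (dsrc F))"
proof (rule double_functor_eqI)
  note RF = two_functor_RR_fun
  show "double_functor (Cm (DblCat \<kappa>) (counit (dtgt F)) (Sq_fun (RR_fun F)))"
    by (intro double_functor_Cm B.double_functor_counit double_functor_Sq_fun RF) simp
  show "double_functor (Cm (DblCat \<kappa>) F (counit (dsrc F)))"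
    by (intro double_functor_Cm A.double_functor_counit F) simp
  fix x assume "x \<in> Ar (HSq (dsrc (Cm (DblCat \<kappa>) F (counit (dsrc F)))))"
  then have x: "x \<in> Ar (HSq (Sq (RR (dsrc F))))" by simp
  then show "dfs (Cm (DblCat \<kappa>) (counit (dtgt F)) (Sq_fun (RR_fun F))) x =
    dfs (Cm (DblCat \<kappa>) F (counit (dsrc F))) x"
  proof (rule A.lift_squareE, goal_cases)
    case (1 p p' q q' s)
    then show ?case
      using x pair_square_map [of p p' q q' s]
      by (simp add: compose_def Sq_RR_lift_square A.counit_lift_square B.counit_lift_square)
  qed
qed (simp_all add: compose_def F_simps RR_pair_map_mem)

end

section \<open>The triangle identities\<close>

context coded_double_category
begin

lemma counit_triangle_RR:
  "Cm (TwoCat \<kappa>) (RR_fun (counit A)) (Sq_RR_unit (RR A)) = Idt (TwoCat \<kappa>) (RR A)"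
proof -
  interpret R: coded_two_category U "RR A"
    by (intro coded_two_category.intro coding_axioms two_category_RR)
  interpret E: coded_double_functor U "counit A"
    by (intro coded_double_functor.intro coding_axioms coded_double_functor_axioms.intro double_functor_counit)
  note [simp] = RR_cell_simps
  \<comment> \<open>The canonical pair at \<open>p\<close> in \<open>Sq (RR A)\<close> consists of
    identity 2-cells. By the horizontal companion identity these are also the flattenings of
    \<open>pair_phi p\<close> and \<open>pair_psi p\<close>, which the counit therefore
    recovers.\<close>
  have phi: "dfs (counit A) (pair_phi (Sq_pair (RR A) p)) = pair_phi p"
    and psi: "dfs (counit A) (pair_psi (Sq_pair (RR A) p)) = pair_psi p"
    if p: "p \<in> pairs A" for p
  proof -
    note [simp] = p
    have "pair_phi (Sq_pair (RR A) p) =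
        lift_square A p (RR_id A (Cd (Hor A) (pair_hor p))) p (RR_id A (Cd (Hor A) (pair_hor p))) (pair_phi p)"
      by (simp add: lift_square_def RR_comp_id flatten_def)
    then show "dfs (counit A) (pair_phi (Sq_pair (RR A) p)) = pair_phi p"
      by (simp add: counit_lift_square pair_square_def squares_def del: R.Sq_pair_simps)
    have "pair_psi (Sq_pair (RR A) p) =
        lift_square A (RR_id A (Dm (Hor A) (pair_hor p))) p (RR_id A (Dm (Hor A) (pair_hor p))) p (pair_psi p)"
      by (simp add: lift_square_def RR_comp_id flatten_def)
    then show "dfs (counit A) (pair_psi (Sq_pair (RR A) p)) = pair_psi p"
      by (simp add: counit_lift_square pair_square_def squares_def del: R.Sq_pair_simps)
  qed
  have pair: "RR_pair_map (counit A) (Sq_pair (RR A) p) = p" if p: "p \<in> pairs A" for p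
    by (rule RR_mor_eqI [of _ A])
      (use E.RR_pair_map_mem [of "Sq_pair (RR A) p"] R.Sq_pair_mem p phi psi in
        \<open>simp_all del: R.Sq_pair_simps(3,4)\<close>)
  show ?thesis
  proof (rule two_functor_eqI)
    show "two_functor (Cm (TwoCat \<kappa>) (RR_fun (counit A)) (Sq_RR_unit (RR A)))"
      by (intro two_functor_Cm E.two_functor_RR_fun R.two_functor_Sq_RR_unit) simp
    show "two_functor (Idt (TwoCat \<kappa>) (RR A))"
      by (rule two_functor_Idt [OF two_category_RR])
    fix c assume "c \<in> Ar (VTwo (tsrc (Idt (TwoCat \<kappa>) (RR A))))"
    then have c: "c \<in> Ar (VTwo (RR A))" by simp
    have uc: "tf2 (Sq_RR_unit (RR A)) c \<in> Ar (VTwo (RR (Sq (RR A))))"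
      by (rule R.Sq_RR_unit_cell [OF c])
    from c show "tf2 (Cm (TwoCat \<kappa>) (RR_fun (counit A)) (Sq_RR_unit (RR A))) c = tf2 (Idt (TwoCat \<kappa>) (RR A)) c"
    proof (rule RR_cellE, goal_cases)
      case (1 p p' s a b)
      note [simp] = 1(2-)
      have ab [simp]: "a \<in> Ob (Hor A)" "b \<in> Ob (Hor A)"
        using hor.Dm_in [of "pair_hor p"] hor.Cd_in [of "pair_hor p"] by simp_all
      \<comment> \<open>A square with identity vertical sides is its own flattening along identity
        pairs.\<close>
      have l: "enc (p, p', RR_id A a, RR_id A b, c) = lift_square A p p' (RR_id A a) (RR_id A b) s"
        using 1(1) by (simp add: lift_square_def RR_comp_id flatten_def)
      have "dfs (counit A) (enc (p, p', RR_id A a, RR_id A b, c)) = s"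
        unfolding l by (rule counit_lift_square) (simp add: pair_square_def squares_def)
      moreover have "tf2 (Sq_RR_unit (RR A)) c =
          enc (Sq_pair (RR A) p, Sq_pair (RR A) p', enc (p, p', RR_id A a, RR_id A b, c) :: 'u)"
        using c 1(1) by (simp del: enc_mem_RR_cells)
      ultimately show ?case
        using uc c E.RR_fun_simps(5) [of "Sq_pair (RR A) p" "Sq_pair (RR A) p'" "enc (p, p', RR_id A a, RR_id A b, c)"]
        by (simp add: compose_def pair 1(1) del: enc_mem_RR_cells)
    qed
  qed (simp_all add: compose_def pair R.Sq_pair_mem)
qed

end

context coded_two_category
begin

lemma counit_triangle_Sq:
  "Cm (DblCat \<kappa>) (counit (Sq A)) (Sq_fun (Sq_RR_unit A)) = Idt (DblCat \<kappa>) (Sq A)"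
proof (rule double_functor_eqI)
  note [simp] = Sq_pair_mem cell_simps
  show "double_functor (Cm (DblCat \<kappa>) (counit (Sq A)) (Sq_fun (Sq_RR_unit A)))"
    by (intro double_functor_Cm Sq.double_functor_counit double_functor_Sq_fun two_functor_Sq_RR_unit) simp
  show "double_functor (Idt (DblCat \<kappa>) (Sq A))"
    by (rule double_functor_Idt [OF Sq.double_category_axioms])
  fix x assume "x \<in> Ar (HSq (dsrc (Idt (DblCat \<kappa>) (Sq A))))"
  then have x: "x \<in> Ar (HSq (Sq A))" by simp
  then show "dfs (Cm (DblCat \<kappa>) (counit (Sq A)) (Sq_fun (Sq_RR_unit A))) x = dfs (Idt (DblCat \<kappa>) (Sq A)) x"
  proof (rule Sq_cellE, goal_cases)
    case (1 f f' u v \<alpha> a b c d)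
    note [simp] = 1(2-)
    have ab [simp]: "a \<in> Ob (One A)" "b \<in> Ob (One A)" "c \<in> Ob (One A)" "d \<in> Ob (One A)"
      using one.Dm_in [of f] one.Cd_in [of f] one.Dm_in [of f'] one.Cd_in [of f'] by simp_all
    \<comment> \<open>The canonical pairs carry identity 2-cells, so flattening along them leaves
      \<open>\<alpha>\<close> unchanged.\<close>
    have "dfs (Sq_fun (Sq_RR_unit A)) x =
        lift_square (Sq A) (Sq_pair A f) (Sq_pair A f') (Sq_pair A u) (Sq_pair A v) x"
      by (simp add: 1(1) lift_square_def flatten_def Sq_pair_Cm)
    moreover have "dfs (counit (Sq A)) (lift_square (Sq A) (Sq_pair A f) (Sq_pair A f') (Sq_pair A u) (Sq_pair A v) x) = x"
      by (rule Sq.counit_lift_square) (simp add: 1(1) pair_square_def squares_def)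
    ultimately show ?case using x by (simp add: compose_def)
  qed
qed (simp_all add: compose_def Sq_pair_mem)

end

section \<open>Naturality of the unit\<close>

locale coded_two_functor = coding U
  for U :: "'u itself" +
  fixes F :: "'u twofun"
  assumes F: "two_functor F"
begin

sublocale A: coded_two_category U "tsrc F"
  using F by (intro coded_two_category.intro coding_axioms) (simp add: two_functor_def)

sublocale B: coded_two_category U "ttgt F"
  using F by (intro coded_two_category.intro coding_axioms) (simp add: two_functor_def)

sublocale Sq: coded_double_functor U "Sq_fun F"
  by (intro coded_double_functor.intro coding_axioms coded_double_functor_axioms.intro
      double_functor_Sq_fun F)

lemmas F_simps = two_functor_maps [OF F]

lemma Sq_pair_map:
  assumes "f \<in> Ar (One (tsrc F))"
  shows "RR_pair_map (Sq_fun F) (Sq_pair (tsrc F) f) = Sq_pair (ttgt F) (tf1 F f)"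
  by (rule RR_mor_eqI [of _ "Sq (ttgt F)"])
    (use assms Sq.RR_pair_map_mem [of "Sq_pair (tsrc F) f"] in
      \<open>simp_all add: B.Sq_pair_mem F_simps A.Sq_pair_mem A.cell_simps\<close>)

lemma unit_natural:
  "Cm (TwoCat \<kappa>) (RR_fun (Sq_fun F)) (Sq_RR_unit (tsrc F)) = Cm (TwoCat \<kappa>) (Sq_RR_unit (ttgt F)) F"
proof (rule two_functor_eqI)
  show "two_functor (Cm (TwoCat \<kappa>) (RR_fun (Sq_fun F)) (Sq_RR_unit (tsrc F)))"
    by (intro two_functor_Cm Sq.two_functor_RR_fun A.two_functor_Sq_RR_unit) simp
  show "two_functor (Cm (TwoCat \<kappa>) (Sq_RR_unit (ttgt F)) F)"
    by (intro two_functor_Cm B.two_functor_Sq_RR_unit F) simp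
  fix \<alpha> assume "\<alpha> \<in> Ar (VTwo (tsrc (Cm (TwoCat \<kappa>) (Sq_RR_unit (ttgt F)) F)))"
  then have \<alpha>: "\<alpha> \<in> Ar (VTwo (tsrc F))" by simp
  have "tf2 (Sq_RR_unit (tsrc F)) \<alpha> \<in> Ar (VTwo (RR (Sq (tsrc F))))"
    by (rule A.Sq_RR_unit_cell [OF \<alpha>])
  then show "tf2 (Cm (TwoCat \<kappa>) (RR_fun (Sq_fun F)) (Sq_RR_unit (tsrc F))) \<alpha> =
      tf2 (Cm (TwoCat \<kappa>) (Sq_RR_unit (ttgt F)) F) \<alpha>"
    using \<alpha> Sq.RR_fun_simps(5) [simplified]
    by (simp add: compose_def F_simps Sq_pair_map A.cell_boundary A.Sq_pair_mem A.cell_simps)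
qed (simp_all add: compose_def F_simps A.Sq_pair_mem Sq_pair_map)

end

section \<open>The adjunction between \<open>Sq\<close> and \<open>RR\<close> on small
  objects\<close>

context
  fixes \<kappa> :: "'u rel"
  assumes \<kappa>: "universe \<kappa>"
begin

lemma coded_two_categoryI: "A \<in> Ob (TwoCat \<kappa>) \<Longrightarrow> coded_two_category A"
  using universe_coding [OF \<kappa>] by (simp add: coded_two_category_def small_two_category_def)

lemma coded_double_categoryI: "A \<in> Ob (DblCat \<kappa>) \<Longrightarrow> coded_double_category A"
  using universe_coding [OF \<kappa>] by (simp add: coded_double_category_def small_double_category_def)

lemma coded_two_functorI: "F \<in> Ar (TwoCat \<kappa>) \<Longrightarrow> coded_two_functor F"
  using universe_coding [OF \<kappa>] by (simp add: coded_two_functor_def coded_two_functor_axioms_def)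

lemma coded_double_functorI: "F \<in> Ar (DblCat \<kappa>) \<Longrightarrow> coded_double_functor F"
  using universe_coding [OF \<kappa>] by (simp add: coded_double_functor_def coded_double_functor_axioms_def)

lemma counit_hom:
  assumes "A \<in> Ob (DblCat \<kappa>)"
  shows "counit A \<in> hom (DblCat \<kappa>) (Sq (RR A)) A"
proof -
  interpret coded_double_category "TYPE('u)" A by (rule coded_double_categoryI [OF assms])
  show ?thesis
    using assms double_functor_counit small_two_category_RR [OF \<kappa>] small_double_category_Sq [OF \<kappa>]
    by (simp add: hom_def)
qed

lemma Sq_RR_unit_hom:
  assumes "A \<in> Ob (TwoCat \<kappa>)"
  shows "Sq_RR_unit A \<in> hom (TwoCat \<kappa>) A (RR (Sq A))"
proof -
  interpret coded_two_category "TYPE('u)" A by (rule coded_two_categoryI [OF assms])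
  show ?thesis
    using assms two_functor_Sq_RR_unit small_two_category_RR [OF \<kappa>] small_double_category_Sq [OF \<kappa>]
    by (simp add: hom_def)
qed

lemma counit_triangle:
  "A \<in> Ob (DblCat \<kappa>) \<Longrightarrow> Cm (TwoCat \<kappa>) (RR_fun (counit A)) (Sq_RR_unit (RR A)) = Idt (TwoCat \<kappa>) (RR A)"
  by (rule coded_double_category.counit_triangle_RR [OF coded_double_categoryI])

lemma unit_natural:
  "F \<in> hom (TwoCat \<kappa>) A B \<Longrightarrow>
    Cm (TwoCat \<kappa>) (RR_fun (Sq_fun F)) (Sq_RR_unit A) = Cm (TwoCat \<kappa>) (Sq_RR_unit B) F"
  using coded_two_functor.unit_natural [OF coded_two_functorI, of F] by (simp add: hom_def) blast

lemma counit_natural: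
  "F \<in> hom (DblCat \<kappa>) A B \<Longrightarrow>
    Cm (DblCat \<kappa>) (counit B) (Sq_fun (RR_fun F)) = Cm (DblCat \<kappa>) F (counit A)"
  using coded_double_functor.counit_natural [OF coded_double_functorI, of F] by (simp add: hom_def) blast

lemma counit_triangle':
  "A \<in> Ob (TwoCat \<kappa>) \<Longrightarrow> Cm (DblCat \<kappa>) (counit (Sq A)) (Sq_fun (Sq_RR_unit A)) = Idt (DblCat \<kappa>) (Sq A)"
  by (rule coded_two_category.counit_triangle_Sq [OF coded_two_categoryI])

lemma adjunction_Sq_RR: "adjunction (TwoCat \<kappa>) (DblCat \<kappa>) Sq Sq_fun RR RR_fun Sq_RR_unit"
  by (rule adjunction_of_counit [where D = "TwoCat \<kappa>" and C = "DblCat \<kappa>" and So = Sq and Sa = Sq_fun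
        and Ro = RR and Ra = RR_fun and u = Sq_RR_unit and \<epsilon> = counit])
    (assumption | rule is_functor_Sq [OF \<kappa>] is_functor_RR [OF \<kappa>] Sq_RR_unit_hom unit_natural counit_hom
      counit_natural counit_triangle counit_triangle')+

end

section \<open>Canonical trivial fibrations\<close>

lemma canonical_trivial_fibrationI:
  assumes F: "double_functor F"
    and ob: "\<And>y. y \<in> Ob (Hor (dtgt F)) \<Longrightarrow> \<exists>x\<in>Ob (Hor (dsrc F)). dfo F x = y"
    and hor: "\<And>a b g. \<lbrakk>a \<in> Ob (Hor (dsrc F)); b \<in> Ob (Hor (dsrc F)); g \<in> hom (Hor (dtgt F)) (dfo F a) (dfo F b)\<rbrakk>
      \<Longrightarrow> \<exists>f\<in>hom (Hor (dsrc F)) a b. dfh F f = g"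
    and ver: "\<And>a b v. \<lbrakk>a \<in> Ob (Hor (dsrc F)); b \<in> Ob (Hor (dsrc F)); v \<in> hom (Ver (dtgt F)) (dfo F a) (dfo F b)\<rbrakk>
      \<Longrightarrow> \<exists>u\<in>hom (Ver (dsrc F)) a b. dfv F u = v"
    and full: "\<And>a b c d f f' u v t. \<lbrakk>f \<in> hom (Hor (dsrc F)) a b; f' \<in> hom (Hor (dsrc F)) c d;
        u \<in> hom (Ver (dsrc F)) a c; v \<in> hom (Ver (dsrc F)) b d;
        t \<in> squares (dtgt F) (dfh F f) (dfh F f') (dfv F u) (dfv F v)\<rbrakk>
      \<Longrightarrow> \<exists>s\<in>squares (dsrc F) f f' u v. dfs F s = t"
    and faithful: "\<And>f f' u v s t. \<lbrakk>s \<in> squares (dsrc F) f f' u v; t \<in> squares (dsrc F) f f' u v;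
        dfs F s = dfs F t\<rbrakk> \<Longrightarrow> s = t"
  shows "canonical_trivial_fibration F"
proof -
  note m = double_functor_maps [OF F]
  have 1: "dfo F ` Ob (Hor (dsrc F)) = Ob (Hor (dtgt F))"
    using ob m(1) by blast
  have 2: "dfh F ` hom (Hor (dsrc F)) a b = hom (Hor (dtgt F)) (dfo F a) (dfo F b)"
    "dfv F ` hom (Ver (dsrc F)) a b = hom (Ver (dtgt F)) (dfo F a) (dfo F b)"
    if "a \<in> Ob (Hor (dsrc F))" "b \<in> Ob (Hor (dsrc F))" for a b
    using hor [OF that] ver [OF that] by (auto simp: hom_def m)
  have 3: "bij_betw (dfs F) (squares (dsrc F) f f' u v)
      (squares (dtgt F) (dfh F f) (dfh F f') (dfv F u) (dfv F v))"
    if "f \<in> hom (Hor (dsrc F)) a b" "f' \<in> hom (Hor (dsrc F)) c d"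
      "u \<in> hom (Ver (dsrc F)) a c" "v \<in> hom (Ver (dsrc F)) b d" for a b c d f f' u v
    unfolding bij_betw_def
  proof
    show "inj_on (dfs F) (squares (dsrc F) f f' u v)"
      using faithful by (rule inj_onI)
    show "dfs F ` squares (dsrc F) f f' u v = squares (dtgt F) (dfh F f) (dfh F f') (dfv F u) (dfv F v)"
      using full [OF that] by (auto simp: squares_def m)
  qed
  show ?thesis
    unfolding canonical_trivial_fibration_def Let_def
    by (intro conjI ballI allI) (assumption | rule F 1 2 3)+
qed

lemmas canonical_trivial_fibrationD =
  canonical_trivial_fibration_def [unfolded Let_def, THEN iffD1, THEN conjunct2, THEN conjunct1]
  canonical_trivial_fibration_def [unfolded Let_def, THEN iffD1, THEN conjunct2, THEN conjunct2,
    THEN conjunct1, rule_format, THEN conjunct1]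
  canonical_trivial_fibration_def [unfolded Let_def, THEN iffD1, THEN conjunct2, THEN conjunct2,
    THEN conjunct1, rule_format, THEN conjunct2]
  canonical_trivial_fibration_def [unfolded Let_def, THEN iffD1, THEN conjunct2, THEN conjunct2,
    THEN conjunct2, rule_format]

context coded_double_category
begin

lemma lift_square_squares:
  "pair_square A p p' q q' s \<Longrightarrow> lift_square A p p' q q' s \<in> squares (Sq (RR A)) p p' q q'"
  by (simp add: squares_def lift_square_mem)

lemma lift_square_squaresE:
  assumes "x \<in> squares (Sq (RR A)) p p' q q'"
  obtains s where "x = lift_square A p p' q q' s" "pair_square A p p' q q' s"
proof -
  have "x \<in> Ar (HSq (Sq (RR A)))" using assms by (simp add: squares_def)
  then obtain r r' t t' s where x: "x = lift_square A r r' t t' s" "pair_square A r r' t t' s"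
    by (rule lift_squareE)
  then have "r = p" "r' = p'" "t = q" "t' = q'"
    using assms by (auto simp: squares_def)
  with x show thesis by (intro that) simp_all
qed

lemma canonical_counit:
  assumes hor: "\<And>f. f \<in> Ar (Hor A) \<Longrightarrow> hor_has_companion A f"
    and ver: "\<And>u. u \<in> Ar (Ver A) \<Longrightarrow> ver_has_companion A u"
  shows "canonical_trivial_fibration (counit A)"
proof (rule canonical_trivial_fibrationI)
  show "double_functor (counit A)" by (rule double_functor_counit)
  fix y assume "y \<in> Ob (Hor (dtgt (counit A)))"
  then show "\<exists>x\<in>Ob (Hor (dsrc (counit A))). dfo (counit A) x = y" by auto
next
  fix a b g assume ab: "a \<in> Ob (Hor (dsrc (counit A)))" "b \<in> Ob (Hor (dsrc (counit A)))"
    and "g \<in> hom (Hor (dtgt (counit A))) (dfo (counit A) a) (dfo (counit A) b)"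
  then have g: "g \<in> Ar (Hor A)" "Dm (Hor A) g = a" "Cd (Hor A) g = b" by (simp_all add: hom_def)
  obtain u \<phi> \<psi> where c: "companion_pair A g u \<phi> \<psi>"
    using hor [OF g(1)] by (auto simp: hor_has_companion_def)
  then have "enc (g, u, \<phi>, \<psi>) \<in> pairs A" by (simp add: enc_mem_RR_mor)
  then show "\<exists>f\<in>hom (Hor (dsrc (counit A))) a b. dfh (counit A) f = g"
    by (intro bexI [of _ "enc (g, u, \<phi>, \<psi>)"]) (simp_all add: hom_def g)
next
  fix a b v assume ab: "a \<in> Ob (Hor (dsrc (counit A)))" "b \<in> Ob (Hor (dsrc (counit A)))"
    and "v \<in> hom (Ver (dtgt (counit A))) (dfo (counit A) a) (dfo (counit A) b)"
  then have v: "v \<in> Ar (Ver A)" "Dm (Ver A) v = a" "Cd (Ver A) v = b" by (simp_all add: hom_def)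
  obtain f \<phi> \<psi> where c: "companion_pair A f v \<phi> \<psi>"
    using ver [OF v(1)] by (auto simp: ver_has_companion_def)
  then have m: "enc (f, v, \<phi>, \<psi>) \<in> pairs A" by (simp add: enc_mem_RR_mor)
  have "Dm (Hor A) f = a" "Cd (Hor A) f = b"
    using c v by (auto elim!: companion_pairE)
  then show "\<exists>u\<in>hom (Ver (dsrc (counit A))) a b. dfv (counit A) u = v"
    using m by (intro bexI [of _ "enc (f, v, \<phi>, \<psi>)"]) (simp_all add: hom_def)
next
  fix a b c d p p' q q' t
  assume "p \<in> hom (Hor (dsrc (counit A))) a b" "p' \<in> hom (Hor (dsrc (counit A))) c d"
    "q \<in> hom (Ver (dsrc (counit A))) a c" "q' \<in> hom (Ver (dsrc (counit A))) b d"
  then have m: "p \<in> pairs A" "p' \<in> pairs A" "q \<in> pairs A" "q' \<in> pairs A"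
    by (simp_all add: hom_def)
  assume "t \<in> squares (dtgt (counit A)) (dfh (counit A) p) (dfh (counit A) p') (dfv (counit A) q) (dfv (counit A) q')"
  then have t: "pair_square A p p' q q' t" by (simp add: m pair_square_def)
  show "\<exists>s\<in>squares (dsrc (counit A)) p p' q q'. dfs (counit A) s = t"
    by (rule bexI [of _ "lift_square A p p' q q' t"])
      (simp_all add: lift_square_squares [OF t] counit_lift_square [OF t])
next
  fix p p' q q' s t
  assume st: "s \<in> squares (dsrc (counit A)) p p' q q'" "t \<in> squares (dsrc (counit A)) p p' q q'"
    and eq: "dfs (counit A) s = dfs (counit A) t"
  obtain s' where "s = lift_square A p p' q q' s'" "pair_square A p p' q q' s'"
    using st(1) by (auto elim: lift_square_squaresE)
  moreover obtain t' where "t = lift_square A p p' q q' t'" "pair_square A p p' q q' t'"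
    using st(2) by (auto elim: lift_square_squaresE)
  ultimately show "s = t" using eq by (simp add: counit_lift_square)
qed

end

context coded_two_category
begin

lemma Sq_has_companions:
  assumes "f \<in> Ar (One A)"
  shows "hor_has_companion (Sq A) f" and "ver_has_companion (Sq A) f"
  using Sq_pair_companion [OF assms] unfolding hor_has_companion_def ver_has_companion_def by blast+

lemma canonical_counit_Sq: "canonical_trivial_fibration (counit (Sq A))"
  by (rule Sq.canonical_counit) (simp_all add: Sq_has_companions)

end

section \<open>Preservation of canonical trivial fibrations by \<open>RR\<close> followed by
  \<open>Sq\<close>\<close>

context coded_double_functor
begin

text \<open>The corners are recovered from the boundary of \<open>s\<close>; they provide the
  hom-sets over which the definition of a canonical trivial fibration ranges.\<close>

lemma square_injective:
  assumes F: "canonical_trivial_fibration F"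
    and s: "s \<in> squares (dsrc F) f f' u v" and t: "t \<in> squares (dsrc F) f f' u v" and eq: "dfs F s = dfs F t"
  shows "s = t"
proof -
  have s': "s \<in> Ar (HSq (dsrc F))" "Dm (VSq (dsrc F)) s = f" "Cd (VSq (dsrc F)) s = f'"
    "Dm (HSq (dsrc F)) s = u" "Cd (HSq (dsrc F)) s = v"
    using s by (auto simp: squares_def)
  have "f \<in> hom (Hor (dsrc F)) (Dm (Hor (dsrc F)) f) (Cd (Hor (dsrc F)) f)"
    "f' \<in> hom (Hor (dsrc F)) (Dm (Hor (dsrc F)) f') (Cd (Hor (dsrc F)) f')"
    "u \<in> hom (Ver (dsrc F)) (Dm (Hor (dsrc F)) f) (Dm (Hor (dsrc F)) f')"
    "v \<in> hom (Ver (dsrc F)) (Cd (Hor (dsrc F)) f) (Cd (Hor (dsrc F)) f')"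
    using s' A.vsq.Dm_in [of s] A.vsq.Cd_in [of s] A.hsq.Dm_in [of s] A.hsq.Cd_in [of s]
      A.corner_tl [of s] A.corner_tr [of s] A.corner_bl [of s] A.corner_br [of s]
    by (simp_all add: hom_def A.square_simps)
  then have "inj_on (dfs F) (squares (dsrc F) f f' u v)"
    using canonical_trivial_fibrationD(4) [OF F] bij_betw_imp_inj_on by blast
  then show ?thesis using s t eq by (auto dest: inj_onD)
qed

lemma canonical_square:
  assumes F: "canonical_trivial_fibration F"
    and "f \<in> hom (Hor (dsrc F)) a b" "f' \<in> hom (Hor (dsrc F)) c d"
        "u \<in> hom (Ver (dsrc F)) a c" "v \<in> hom (Ver (dsrc F)) b d"
    and t: "t \<in> squares (dtgt F) (dfh F f) (dfh F f') (dfv F u) (dfv F v)"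
  obtains s where "s \<in> squares (dsrc F) f f' u v" "dfs F s = t"
proof -
  have "t \<in> dfs F ` squares (dsrc F) f f' u v"
    using bij_betw_imp_surj_on [OF canonical_trivial_fibrationD(4) [OF assms(1-5)]] t by simp
  then show thesis using that by blast
qed

text \<open>Fullness lifts the two morphisms and then the two squares. The companion equations
  follow from faithfulness, since both sides have the same boundary and the same image.\<close>

lemma companion_lift:
  assumes C: "canonical_trivial_fibration F"
    and ab: "a \<in> Ob (Hor (dsrc F))" "b \<in> Ob (Hor (dsrc F))"
    and P: "P \<in> pairs (dtgt F)" "Dm (Hor (dtgt F)) (pair_hor P) = dfo F a" "Cd (Hor (dtgt F)) (pair_hor P) = dfo F b"
  shows "\<exists>p\<in>pairs (dsrc F). Dm (Hor (dsrc F)) (pair_hor p) = a \<and> Cd (Hor (dsrc F)) (pair_hor p) = b \<and>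
    RR_pair_map F p = P"
proof -
  note [simp] = F_simps B.RR_mor_simps [OF P(1)] P ab
  have "pair_hor P \<in> dfh F ` hom (Hor (dsrc F)) a b" "pair_ver P \<in> dfv F ` hom (Ver (dsrc F)) a b"
    unfolding canonical_trivial_fibrationD(2,3) [OF C ab] by (simp_all add: hom_def)
  then obtain f u where f: "f \<in> hom (Hor (dsrc F)) a b" "dfh F f = pair_hor P"
    and u: "u \<in> hom (Ver (dsrc F)) a b" "dfv F u = pair_ver P"
    by (auto elim!: imageE)
  have fu [simp]: "f \<in> Ar (Hor (dsrc F))" "Dm (Hor (dsrc F)) f = a" "Cd (Hor (dsrc F)) f = b"
    "u \<in> Ar (Ver (dsrc F))" "Dm (Ver (dsrc F)) u = a" "Cd (Ver (dsrc F)) u = b"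
    using f u by (auto simp: hom_def)
  have i: "Idt (Hor (dsrc F)) a \<in> hom (Hor (dsrc F)) a a" "Idt (Ver (dsrc F)) a \<in> hom (Ver (dsrc F)) a a"
    "Idt (Hor (dsrc F)) b \<in> hom (Hor (dsrc F)) b b" "Idt (Ver (dsrc F)) b \<in> hom (Ver (dsrc F)) b b"
    by (simp_all add: hom_def A.square_simps)
  have "pair_phi P \<in> squares (dtgt F) (dfh F f) (dfh F (Idt (Hor (dsrc F)) b)) (dfv F u) (dfv F (Idt (Ver (dsrc F)) b))"
    by (simp add: squares_def f u)
  then obtain \<phi> where \<phi>: "\<phi> \<in> squares (dsrc F) f (Idt (Hor (dsrc F)) b) u (Idt (Ver (dsrc F)) b)" "dfs F \<phi> = pair_phi P"
    using canonical_square [OF C f(1) i(3) u(1) i(4)] by blast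
  have "pair_psi P \<in> squares (dtgt F) (dfh F (Idt (Hor (dsrc F)) a)) (dfh F f) (dfv F (Idt (Ver (dsrc F)) a)) (dfv F u)"
    by (simp add: squares_def f u)
  then obtain \<psi> where \<psi>: "\<psi> \<in> squares (dsrc F) (Idt (Hor (dsrc F)) a) f (Idt (Ver (dsrc F)) a) u" "dfs F \<psi> = pair_psi P"
    using canonical_square [OF C i(1) f(1) i(2) u(1)] by blast
  have [simp]: "\<phi> \<in> Ar (HSq (dsrc F))" "Dm (VSq (dsrc F)) \<phi> = f" "Cd (VSq (dsrc F)) \<phi> = Idt (Hor (dsrc F)) b"
    "Dm (HSq (dsrc F)) \<phi> = u" "Cd (HSq (dsrc F)) \<phi> = Idt (Ver (dsrc F)) b"
    "\<psi> \<in> Ar (HSq (dsrc F))" "Dm (VSq (dsrc F)) \<psi> = Idt (Hor (dsrc F)) a" "Cd (VSq (dsrc F)) \<psi> = f"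
    "Dm (HSq (dsrc F)) \<psi> = Idt (Ver (dsrc F)) a" "Cd (HSq (dsrc F)) \<psi> = u"
    using \<phi>(1) \<psi>(1) by (auto simp: squares_def)
  have h: "Cm (HSq (dsrc F)) \<phi> \<psi> = Idt (VSq (dsrc F)) f"
    by (rule square_injective [OF C, of _ f f "Idt (Ver (dsrc F)) a" "Idt (Ver (dsrc F)) b"])
      (simp_all add: squares_def A.square_simps \<phi>(2) \<psi>(2) f)
  have v: "Cm (VSq (dsrc F)) \<phi> \<psi> = Idt (HSq (dsrc F)) u"
    by (rule square_injective [OF C, of _ "Idt (Hor (dsrc F)) a" "Idt (Hor (dsrc F)) b" u u])
      (simp_all add: squares_def A.square_simps \<phi>(2) \<psi>(2) u)
  have c: "companion_pair (dsrc F) f u \<phi> \<psi>"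
    by (rule A.companion_pairI [of _ _ _ _ a b]) (use h v in simp_all)
  have "RR_pair_map F (enc (f, u, \<phi>, \<psi>)) = P"
    by (rule RR_mor_eqI [of _ "dtgt F"])
      (use c in \<open>simp_all add: RR_pair_map_mem enc_mem_RR_mor f u \<phi> \<psi>\<close>)
  then show ?thesis
    using c by (intro bexI [of _ "enc (f, u, \<phi>, \<psi>)"]) (simp_all add: enc_mem_RR_mor)
qed

text \<open>Morphisms lift by \<open>companion_lift\<close>. A square of
  \<open>Sq (RR (dsrc F))\<close> is a square of \<open>dsrc F\<close> with companion pairs on its
  boundary, so bijectivity on squares is inherited from \<open>F\<close>.\<close>

lemma canonical_Sq_RR:
  assumes C: "canonical_trivial_fibration F"
  shows "canonical_trivial_fibration (Sq_fun (RR_fun F))"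
proof (rule canonical_trivial_fibrationI)
  let ?G = "Sq_fun (RR_fun F)"
  show "double_functor ?G" by (rule double_functor_Sq_fun [OF two_functor_RR_fun])
  show "\<exists>x\<in>Ob (Hor (dsrc ?G)). dfo ?G x = y" if "y \<in> Ob (Hor (dtgt ?G))" for y
    using equalityD2 [OF canonical_trivial_fibrationD(1) [OF C]] that by auto
  show "\<exists>f\<in>hom (Hor (dsrc ?G)) a b. dfh ?G f = g"
    if "a \<in> Ob (Hor (dsrc ?G))" "b \<in> Ob (Hor (dsrc ?G))" "g \<in> hom (Hor (dtgt ?G)) (dfo ?G a) (dfo ?G b)" for a b g
    using companion_lift [OF C, of a b g] that by (auto simp: hom_def)
  show "\<exists>f\<in>hom (Ver (dsrc ?G)) a b. dfv ?G f = g"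
    if "a \<in> Ob (Hor (dsrc ?G))" "b \<in> Ob (Hor (dsrc ?G))" "g \<in> hom (Ver (dtgt ?G)) (dfo ?G a) (dfo ?G b)" for a b g
    using companion_lift [OF C, of a b g] that by (auto simp: hom_def)
  show "\<exists>s\<in>squares (dsrc ?G) p p' q q'. dfs ?G s = t"
    if "p \<in> hom (Hor (dsrc ?G)) a b" "p' \<in> hom (Hor (dsrc ?G)) c d"
      "q \<in> hom (Ver (dsrc ?G)) a c" "q' \<in> hom (Ver (dsrc ?G)) b d"
      "t \<in> squares (dtgt ?G) (dfh ?G p) (dfh ?G p') (dfv ?G q) (dfv ?G q')" for a b c d p p' q q' t
  proof -
    have m: "p \<in> pairs (dsrc F)" "p' \<in> pairs (dsrc F)"
        "q \<in> pairs (dsrc F)" "q' \<in> pairs (dsrc F)"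
      and d: "pair_hor p \<in> hom (Hor (dsrc F)) a b" "pair_hor p' \<in> hom (Hor (dsrc F)) c d"
        "pair_ver q \<in> hom (Ver (dsrc F)) a c" "pair_ver q' \<in> hom (Ver (dsrc F)) b d"
      using that(1-4) by (auto simp: hom_def A.RR_mor_simps)
    have "t \<in> squares (Sq (RR (dtgt F))) (RR_pair_map F p) (RR_pair_map F p') (RR_pair_map F q) (RR_pair_map F q')"
      using that(5) m by simp
    then obtain t' where t': "t = lift_square (dtgt F) (RR_pair_map F p) (RR_pair_map F p') (RR_pair_map F q) (RR_pair_map F q') t'"
      "pair_square (dtgt F) (RR_pair_map F p) (RR_pair_map F p') (RR_pair_map F q) (RR_pair_map F q') t'"
      by (rule B.lift_square_squaresE)
    obtain s where s: "s \<in> squares (dsrc F) (pair_hor p) (pair_hor p') (pair_ver q) (pair_ver q')" "dfs F s = t'"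
      using canonical_square [OF C d, of t'] t'(2) by (auto simp: pair_square_def)
    then have ps: "pair_square (dsrc F) p p' q q' s" using m by (simp add: pair_square_def)
    show ?thesis
      using A.lift_square_squares [OF ps] Sq_RR_lift_square [OF ps] s(2) t'(1) by (intro bexI) simp_all
  qed
  show "s = t" if st: "s \<in> squares (dsrc ?G) p p' q q'" "t \<in> squares (dsrc ?G) p p' q q'" "dfs ?G s = dfs ?G t"
    for p p' q q' s t
  proof -
    obtain s' where s': "s = lift_square (dsrc F) p p' q q' s'" "pair_square (dsrc F) p p' q q' s'"
      using st(1) by (auto elim: A.lift_square_squaresE)
    obtain t' where t': "t = lift_square (dsrc F) p p' q q' t'" "pair_square (dsrc F) p p' q q' t'"
      using st(2) by (auto elim: A.lift_square_squaresE)
    \<comment> \<open>The counit undoes the lift, so equal images under \<open>?G\<close> force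
      equal images under \<open>F\<close>.\<close>
    have u: "dfs (counit (dtgt F)) (dfs ?G (lift_square (dsrc F) p p' q q' x)) = dfs F x"
      if "pair_square (dsrc F) p p' q q' x" for x
      using pair_square_map [OF that] Sq_RR_lift_square [OF that] by (simp add: B.counit_lift_square)
    have "dfs F s' = dfs F t'"
      using u [OF s'(2)] u [OF t'(2)] st(3) s'(1) t'(1) by simp
    then have "s' = t'"
      using square_injective [OF C] s'(2) t'(2) unfolding pair_square_def by blast
    then show ?thesis using s' t' by simp
  qed
qed

end

section \<open>Companion pairs in \<open>Sq A\<close> as a path object\<close>

definition sq_cell :: "'u \<Rightarrow> 'u" where
  "sq_cell s = (case (dec s :: 'u sqcell) of (f, f', u, v, \<alpha>) \<Rightarrow> \<alpha>)"

text \<open>A companion pair \<open>p\<close> in \<open>Sq A\<close> amounts to a pair of 1-cells with mutually inverse 2-cells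
  \<open>pair_iso p : pair_hor p \<Rightarrow> pair_ver p\<close> and \<open>pair_inv p\<close>.\<close>

definition pair_iso :: "'u \<Rightarrow> 'u" where
  "pair_iso p = sq_cell (pair_phi p)"

definition pair_inv :: "'u \<Rightarrow> 'u" where
  "pair_inv p = sq_cell (pair_psi p)"

text \<open>A 2-cell \<open>p \<Rightarrow> p'\<close> of \<open>RR (Sq A)\<close> is a square with
  identity vertical sides, hence just a 2-cell of \<open>A\<close> between the horizontal
  parts.\<close>

definition path_cell :: "'u twocat \<Rightarrow> 'u \<Rightarrow> 'u \<Rightarrow> 'u \<Rightarrow> 'u" where
  "path_cell A p p' \<alpha> = enc (p, p', enc (pair_hor p, pair_hor p', Idt (One A) (Dm (One A) (pair_hor p)),
    Idt (One A) (Cd (One A) (pair_hor p)), \<alpha>) :: 'u)"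

definition path_square :: "'u twocat \<Rightarrow> 'u \<Rightarrow> 'u \<Rightarrow> 'u \<Rightarrow> 'u \<Rightarrow> 'u \<Rightarrow> 'u" where
  "path_square A p p' q q' \<alpha> =
    enc (p, p', q, q', path_cell A (RR_comp (Sq A) q' p) (RR_comp (Sq A) p' q) \<alpha>)"

definition path_hor :: "'u twocat \<Rightarrow> 'u twofun" where
  "path_hor A = \<lparr>tsrc = RR (Sq A), ttgt = A, tf0 = restrict id (Ob (One A)),
    tf1 = restrict pair_hor (pairs (Sq A)),
    tf2 = restrict (\<lambda>c. case (dec c :: 'u comp_cell) of (p, p', s) \<Rightarrow> sq_cell s) (Ar (VTwo (RR (Sq A))))\<rparr>"

text \<open>Cells are recorded between horizontal parts. Conjugating with the invertible 2-cells of
  the pairs moves them to the vertical parts.\<close>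

definition path_ver :: "'u twocat \<Rightarrow> 'u twofun" where
  "path_ver A = \<lparr>tsrc = RR (Sq A), ttgt = A, tf0 = restrict id (Ob (One A)),
    tf1 = restrict pair_ver (pairs (Sq A)),
    tf2 = restrict (\<lambda>c. case (dec c :: 'u comp_cell) of (p, p', s) \<Rightarrow>
      Cm (VTwo A) (pair_iso p') (Cm (VTwo A) (sq_cell s) (pair_inv p))) (Ar (VTwo (RR (Sq A))))\<rparr>"

text \<open>Horizontal sides are replaced by the canonical pairs on their horizontal parts, vertical
  sides are kept. The 2-cell needs no change because it only sees horizontal parts. Projecting
  afterwards to vertical parts leaves \<open>pair_hor\<close> on horizontal sides and
  \<open>pair_ver\<close> on vertical ones, as the counit does.\<close>

definition straighten :: "'u twocat \<Rightarrow> 'u dblfun" where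
  "straighten A = \<lparr>dsrc = Sq (RR (Sq A)), dtgt = Sq (RR (Sq A)), dfo = restrict id (Ob (One A)),
    dfh = restrict (\<lambda>p. Sq_pair A (pair_hor p)) (pairs (Sq A)),
    dfv = restrict id (pairs (Sq A)),
    dfs = restrict (\<lambda>x. case (dec x :: 'u sqcell) of (p, p', q, q', c) \<Rightarrow>
      case (dec c :: 'u comp_cell) of (r, r', s) \<Rightarrow>
        path_square A (Sq_pair A (pair_hor p)) (Sq_pair A (pair_hor p')) q q' (sq_cell s))
      (Ar (HSq (Sq (RR (Sq A)))))\<rparr>"

context coded_two_category
begin

lemma sq_cell_enc [simp]:
  fixes f f' u v \<alpha> :: 'u
  shows "sq_cell (enc (f, f', u, v, \<alpha>)) = \<alpha>"
  by (simp add: sq_cell_def)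

lemma Sq_square_enc:
  assumes "s \<in> Ar (HSq (Sq A))" "Dm (VSq (Sq A)) s = f" "Cd (VSq (Sq A)) s = f'"
    "Dm (HSq (Sq A)) s = u" "Cd (HSq (Sq A)) s = v"
  shows "s = enc (f, f', u, v, sq_cell s)"
  using assms(1) by (rule Sq_cellE) (use assms in simp)

lemma path_pair_enc:
  assumes p: "p \<in> pairs (Sq A)"
  shows "pair_phi p = enc (pair_hor p, Idt (One A) (Cd (One A) (pair_hor p)), pair_ver p,
      Idt (One A) (Cd (One A) (pair_hor p)), pair_iso p)"
    and "pair_psi p = enc (Idt (One A) (Dm (One A) (pair_hor p)), pair_hor p,
      Idt (One A) (Dm (One A) (pair_hor p)), pair_ver p, pair_inv p)"
  unfolding pair_iso_def pair_inv_def
  by (rule Sq_square_enc; use Sq.RR_mor_simps [OF p] in simp)+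

text \<open>With identities on the remaining sides, the horizontal and the vertical companion
  identity in \<open>Sq A\<close> become the two laws for mutually inverse 2-cells.\<close>

lemma path_pair_simps:
  assumes p: "p \<in> pairs (Sq A)"
  shows "pair_hor p \<in> Ar (One A)" "pair_ver p \<in> Ar (One A)"
    "Dm (One A) (pair_ver p) = Dm (One A) (pair_hor p)" "Cd (One A) (pair_ver p) = Cd (One A) (pair_hor p)"
    "pair_iso p \<in> Ar (VTwo A)" "Dm (VTwo A) (pair_iso p) = pair_hor p" "Cd (VTwo A) (pair_iso p) = pair_ver p"
    "pair_inv p \<in> Ar (VTwo A)" "Dm (VTwo A) (pair_inv p) = pair_ver p" "Cd (VTwo A) (pair_inv p) = pair_hor p"
    "Cm (VTwo A) (pair_inv p) (pair_iso p) = Idt (VTwo A) (pair_hor p)"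
    "Cm (VTwo A) (pair_iso p) (pair_inv p) = Idt (VTwo A) (pair_ver p)"
proof -
  note s = Sq.RR_mor_simps [OF p]
  show m [simp]: "pair_hor p \<in> Ar (One A)" "pair_ver p \<in> Ar (One A)"
    "Dm (One A) (pair_ver p) = Dm (One A) (pair_hor p)" "Cd (One A) (pair_ver p) = Cd (One A) (pair_hor p)"
    using s(1,2,5,6) by simp_all
  note [simp] = cell_simps
  show i [simp]: "pair_iso p \<in> Ar (VTwo A)" "Dm (VTwo A) (pair_iso p) = pair_hor p" "Cd (VTwo A) (pair_iso p) = pair_ver p"
    using s(3) unfolding path_pair_enc [OF p] by simp_all
  show j [simp]: "pair_inv p \<in> Ar (VTwo A)" "Dm (VTwo A) (pair_inv p) = pair_ver p" "Cd (VTwo A) (pair_inv p) = pair_hor p"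
    using s(4) unfolding path_pair_enc [OF p] by simp_all
  show "Cm (VTwo A) (pair_inv p) (pair_iso p) = Idt (VTwo A) (pair_hor p)"
    using s(15) unfolding path_pair_enc [OF p] by simp
  show "Cm (VTwo A) (pair_iso p) (pair_inv p) = Idt (VTwo A) (pair_ver p)"
    using s(16) unfolding path_pair_enc [OF p] by simp
qed

lemma path_cancel:
  assumes "p \<in> pairs (Sq A)" "\<alpha> \<in> Ar (VTwo A)" "Cd (VTwo A) \<alpha> = pair_hor p"
  shows "Cm (VTwo A) (pair_inv p) (Cm (VTwo A) (pair_iso p) \<alpha>) = \<alpha>"
  using vtwo.Cm_assoc [of \<alpha> "pair_iso p" "pair_inv p"] assms vtwo.Idt_Cm [of \<alpha>]
  by (simp add: path_pair_simps)

text \<open>The squares of a composite pair are pastings; in \<open>Sq A\<close> they give two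
  whiskered 2-cells in sequence, which merge into a horizontal composite.\<close>

lemma path_pair_comp:
  assumes p: "p \<in> pairs (Sq A)" and q: "q \<in> pairs (Sq A)"
    and pq: "Cd (One A) (pair_hor p) = Dm (One A) (pair_hor q)"
  shows "pair_iso (RR_comp (Sq A) q p) = Cm (HTwo A) (pair_iso q) (pair_iso p)"
    and "pair_inv (RR_comp (Sq A) q p) = Cm (HTwo A) (pair_inv q) (pair_inv p)"
proof -
  note [simp] = cell_simps path_pair_simps [OF p] path_pair_simps [OF q] pq
  show "pair_iso (RR_comp (Sq A) q p) = Cm (HTwo A) (pair_iso q) (pair_iso p)"
    unfolding pair_iso_def [of "RR_comp (Sq A) q p"] RR_comp_simps path_pair_enc [OF p] path_pair_enc [OF q]
    by (simp add: whisker_exchange(2))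
  show "pair_inv (RR_comp (Sq A) q p) = Cm (HTwo A) (pair_inv q) (pair_inv p)"
    unfolding pair_inv_def [of "RR_comp (Sq A) q p"] RR_comp_simps path_pair_enc [OF p] path_pair_enc [OF q]
    by (simp add: whisker_exchange(2))
qed

lemma path_Sq_pair [simp]:
  "pair_iso (Sq_pair A f) = Idt (VTwo A) f" "pair_inv (Sq_pair A f) = Idt (VTwo A) f"
  by (simp_all add: pair_iso_def pair_inv_def)

lemma path_pair_id:
  "x \<in> Ob (One A) \<Longrightarrow> pair_iso (RR_id (Sq A) x) = Idt (VTwo A) (Idt (One A) x)"
  "x \<in> Ob (One A) \<Longrightarrow> pair_inv (RR_id (Sq A) x) = Idt (VTwo A) (Idt (One A) x)"
  by (simp_all add: Sq_pair_Idt [symmetric] del: RR_id_simps)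

lemma path_cellE:
  assumes "c \<in> Ar (VTwo (RR (Sq A)))"
  obtains p p' \<alpha> where "c = path_cell A p p' \<alpha>" "p \<in> pairs (Sq A)" "p' \<in> pairs (Sq A)"
    "\<alpha> \<in> Ar (VTwo A)" "Dm (VTwo A) \<alpha> = pair_hor p" "Cd (VTwo A) \<alpha> = pair_hor p'"
    "Dm (One A) (pair_hor p') = Dm (One A) (pair_hor p)" "Cd (One A) (pair_hor p') = Cd (One A) (pair_hor p)"
  using assms
proof (rule RR_cellE, goal_cases)
  case (1 p p' s a b)
  note [simp] = 1(2-) path_pair_simps(1) [OF 1(3)] path_pair_simps(1) [OF 1(4)] cell_simps
  have s: "s = enc (pair_hor p, pair_hor p', Idt (One A) a, Idt (One A) b, sq_cell s)"
    by (rule Sq_square_enc) simp_all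
  have ab [simp]: "a \<in> Ob (One A)" "b \<in> Ob (One A)"
    using one.Dm_in [of "pair_hor p"] one.Cd_in [of "pair_hor p"] 1(8,10)
    by (simp_all del: one.Dm_in one.Cd_in)
  have "enc (pair_hor p, pair_hor p', Idt (One A) a, Idt (One A) b, sq_cell s) \<in> Ar (HSq (Sq A))"
    using 1(5) s by simp
  then have "sq_cell s \<in> Ar (VTwo A)" "Dm (VTwo A) (sq_cell s) = pair_hor p" "Cd (VTwo A) (sq_cell s) = pair_hor p'"
    by simp_all
  moreover have "c = path_cell A p p' (sq_cell s)"
    using 1(2,8,10) s by (simp add: path_cell_def)
  ultimately show ?case using 1(1) [of p p' "sq_cell s"] 1(8-11) by simp
qed

lemma path_cell_mem:
  assumes "p \<in> pairs (Sq A)" "p' \<in> pairs (Sq A)"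
    "\<alpha> \<in> Ar (VTwo A)" "Dm (VTwo A) \<alpha> = pair_hor p" "Cd (VTwo A) \<alpha> = pair_hor p'"
  shows "path_cell A p p' \<alpha> \<in> Ar (VTwo (RR (Sq A)))"
  using assms cell_boundary [of \<alpha>] by (simp add: path_cell_def cell_simps)

lemma path_cell_simps [simp]:
  "Dm (VTwo (RR (Sq A))) (path_cell A p p' \<alpha>) = p" "Cd (VTwo (RR (Sq A))) (path_cell A p p' \<alpha>) = p'"
  "Dm (HTwo (RR (Sq A))) (path_cell A p p' \<alpha>) = Dm (One A) (pair_hor p)"
  "Cd (HTwo (RR (Sq A))) (path_cell A p p' \<alpha>) = Cd (One A) (pair_hor p)"
  by (simp_all add: path_cell_def)

lemma path_cell_Idt:
  "p \<in> pairs (Sq A) \<Longrightarrow> Idt (VTwo (RR (Sq A))) p = path_cell A p p (Idt (VTwo A) (pair_hor p))"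
  by (simp add: path_cell_def)

lemma path_cell_VTwo:
  assumes "p \<in> pairs (Sq A)" "p' \<in> pairs (Sq A)" "p'' \<in> pairs (Sq A)"
    "\<alpha> \<in> Ar (VTwo A)" "Dm (VTwo A) \<alpha> = pair_hor p" "Cd (VTwo A) \<alpha> = pair_hor p'"
    "\<beta> \<in> Ar (VTwo A)" "Dm (VTwo A) \<beta> = pair_hor p'" "Cd (VTwo A) \<beta> = pair_hor p''"
  shows "Cm (VTwo (RR (Sq A))) (path_cell A p' p'' \<beta>) (path_cell A p p' \<alpha>) = path_cell A p p'' (Cm (VTwo A) \<beta> \<alpha>)"
  using assms cell_boundary [of \<alpha>] cell_boundary [of \<beta>] by (simp add: path_cell_def cell_simps)

lemma path_cell_HTwo:
  assumes "p \<in> pairs (Sq A)" "p' \<in> pairs (Sq A)"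
    "q \<in> pairs (Sq A)" "q' \<in> pairs (Sq A)"
    "\<alpha> \<in> Ar (VTwo A)" "Dm (VTwo A) \<alpha> = pair_hor p" "Cd (VTwo A) \<alpha> = pair_hor p'"
    "\<beta> \<in> Ar (VTwo A)" "Dm (VTwo A) \<beta> = pair_hor q" "Cd (VTwo A) \<beta> = pair_hor q'"
    "Cd (One A) (pair_hor p) = Dm (One A) (pair_hor q)"
  shows "Cm (HTwo (RR (Sq A))) (path_cell A q q' \<beta>) (path_cell A p p' \<alpha>) =
    path_cell A (RR_comp (Sq A) q p) (RR_comp (Sq A) q' p') (Cm (HTwo A) \<beta> \<alpha>)"
  using assms cell_boundary [of \<alpha>] cell_boundary [of \<beta>] by (simp add: path_cell_def cell_simps whisker_exchange(1))

lemma path_hor_simps [simp]: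
  "tsrc (path_hor A) = RR (Sq A)" "ttgt (path_hor A) = A"
  "x \<in> Ob (One A) \<Longrightarrow> tf0 (path_hor A) x = x"
  "p \<in> pairs (Sq A) \<Longrightarrow> tf1 (path_hor A) p = pair_hor p"
  by (simp_all add: path_hor_def)

lemma path_ver_simps [simp]:
  "tsrc (path_ver A) = RR (Sq A)" "ttgt (path_ver A) = A"
  "x \<in> Ob (One A) \<Longrightarrow> tf0 (path_ver A) x = x"
  "p \<in> pairs (Sq A) \<Longrightarrow> tf1 (path_ver A) p = pair_ver p"
  by (simp_all add: path_ver_def)

lemma path_hor_cell:
  "path_cell A p p' \<alpha> \<in> Ar (VTwo (RR (Sq A))) \<Longrightarrow> tf2 (path_hor A) (path_cell A p p' \<alpha>) = \<alpha>"
  by (simp add: path_hor_def path_cell_def del: enc_mem_RR_cells)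

lemma path_ver_cell:
  "path_cell A p p' \<alpha> \<in> Ar (VTwo (RR (Sq A))) \<Longrightarrow> tf2 (path_ver A) (path_cell A p p' \<alpha>) =
    Cm (VTwo A) (pair_iso p') (Cm (VTwo A) \<alpha> (pair_inv p))"
  by (simp add: path_ver_def path_cell_def del: enc_mem_RR_cells)

lemma two_functor_path:
  "two_functor (path_hor A)" "two_functor (path_ver A)"
proof -
  interpret R: two_category "RR (Sq A)" by (rule Sq.two_category_RR)
  note [simp] = path_pair_simps path_cell_mem path_hor_cell path_ver_cell path_cell_VTwo path_cell_HTwo
    Sq.RR_comp_mem Sq.RR_id_mem path_pair_comp path_pair_id cell_simps
  have "is_functor (One (RR (Sq A))) (One A) (tf0 (path_hor A)) (tf1 (path_hor A))"
    by (intro is_functor_intros R.one.category_axioms one.category_axioms) simp_all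
  moreover have "is_functor (VTwo (RR (Sq A))) (VTwo A) (tf1 (path_hor A)) (tf2 (path_hor A))"
  proof (intro is_functor_intros R.vtwo.category_axioms vtwo.category_axioms, goal_cases)
    case (5 p)
    then show ?case by (simp add: path_cell_Idt del: RR_simps(11))
  qed (auto elim!: path_cellE)
  moreover have "is_functor (HTwo (RR (Sq A))) (HTwo A) (tf0 (path_hor A)) (tf2 (path_hor A))"
  proof (intro is_functor_intros R.htwo.category_axioms htwo.category_axioms, goal_cases)
    case (5 x)
    then show ?case by (simp add: R.Idt_HTwo path_cell_Idt Idt_HTwo del: RR_simps(11,15))
  qed (auto elim!: path_cellE simp: Ob_HTwo Ar_HTwo Dm_HTwo Cd_HTwo)
  ultimately show "two_functor (path_hor A)"
    unfolding two_functor_def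
    by (simp add: R.two_category_axioms two_category_axioms) (simp add: path_hor_def)
  have "is_functor (One (RR (Sq A))) (One A) (tf0 (path_ver A)) (tf1 (path_ver A))"
    by (intro is_functor_intros R.one.category_axioms one.category_axioms) simp_all
  moreover have "is_functor (VTwo (RR (Sq A))) (VTwo A) (tf1 (path_ver A)) (tf2 (path_ver A))"
  proof (intro is_functor_intros R.vtwo.category_axioms vtwo.category_axioms, goal_cases)
    case (5 p)
    then show ?case by (simp add: path_cell_Idt del: RR_simps(11))
  qed (auto elim!: path_cellE simp: path_cancel)
  moreover have "is_functor (HTwo (RR (Sq A))) (HTwo A) (tf0 (path_ver A)) (tf2 (path_ver A))"
  proof (intro is_functor_intros R.htwo.category_axioms htwo.category_axioms, goal_cases)
    case (5 x)
    then show ?case by (simp add: R.Idt_HTwo path_cell_Idt Idt_HTwo del: RR_simps(11,15))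
  next
    case (6 c d)
    then have cd: "c \<in> Ar (VTwo (RR (Sq A)))" "d \<in> Ar (VTwo (RR (Sq A)))" by simp_all
    from cd(1) show ?case
    proof (rule path_cellE, goal_cases)
      case (1 p p' \<alpha>)
      note c = this
      from cd(2) show ?case
      proof (rule path_cellE, goal_cases)
        case (1 q q' \<beta>)
        have pq: "Cd (One A) (pair_hor p) = Dm (One A) (pair_hor q)"
          using 6(3) c(1) 1(1) by simp
        \<comment> \<open>Conjugation commutes with horizontal composition by interchange. The
          whiskering rules are withheld so that \<open>HTwo_VTwo\<close> splits the
          composites.\<close>
        have "Cm (VTwo A) (Cm (HTwo A) (pair_iso q') (pair_iso p'))
            (Cm (VTwo A) (Cm (HTwo A) \<beta> \<alpha>) (Cm (HTwo A) (pair_inv q) (pair_inv p))) =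
          Cm (HTwo A) (Cm (VTwo A) (pair_iso q') (Cm (VTwo A) \<beta> (pair_inv q)))
            (Cm (VTwo A) (pair_iso p') (Cm (VTwo A) \<alpha> (pair_inv p)))"
          using c 1 pq by (simp add: HTwo_VTwo del: whisker_left_VTwo whisker_right_VTwo)
        then show ?case
          using c 1 pq by simp
      qed
    qed
  qed (auto elim!: path_cellE simp: Ob_HTwo Ar_HTwo Dm_HTwo Cd_HTwo)
  ultimately show "two_functor (path_ver A)"
    unfolding two_functor_def
    by (simp add: R.two_category_axioms two_category_axioms) (simp add: path_ver_def)
qed

lemma unit_path_cell:
  "\<alpha> \<in> Ar (VTwo A) \<Longrightarrow> tf2 (Sq_RR_unit A) \<alpha> =
    path_cell A (Sq_pair A (Dm (VTwo A) \<alpha>)) (Sq_pair A (Cd (VTwo A) \<alpha>)) \<alpha>"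
  by (simp add: path_cell_def)

text \<open>The invertible 2-cells of canonical pairs are identities, so both projections return the
  original cell.\<close>

lemma path_unit:
  "Cm (TwoCat \<kappa>) (path_hor A) (Sq_RR_unit A) = Idt (TwoCat \<kappa>) A"
  "Cm (TwoCat \<kappa>) (path_ver A) (Sq_RR_unit A) = Idt (TwoCat \<kappa>) A"
proof -
  note [simp] = Sq_pair_mem unit_path_cell path_cell_mem path_hor_cell path_ver_cell cell_boundary cell_simps
  show "Cm (TwoCat \<kappa>) (path_hor A) (Sq_RR_unit A) = Idt (TwoCat \<kappa>) A"
    and "Cm (TwoCat \<kappa>) (path_ver A) (Sq_RR_unit A) = Idt (TwoCat \<kappa>) A"
    by (rule two_functor_eqI; simp add: two_functor_Cm two_functor_path two_functor_Sq_RR_unit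
        two_functor_Idt two_category_axioms compose_def del: Sq_RR_unit_simps(5))+
qed

end

context coded_two_functor
begin

lemma path_hor_natural:
  "Cm (TwoCat \<kappa>) (path_hor (ttgt F)) (RR_fun (Sq_fun F)) = Cm (TwoCat \<kappa>) F (path_hor (tsrc F))"
proof (rule two_functor_eqI)
  have RS: "two_functor (RR_fun (Sq_fun F))" by (rule Sq.two_functor_RR_fun)
  show "two_functor (Cm (TwoCat \<kappa>) (path_hor (ttgt F)) (RR_fun (Sq_fun F)))"
    by (intro two_functor_Cm RS B.two_functor_path) simp
  show "two_functor (Cm (TwoCat \<kappa>) F (path_hor (tsrc F)))"
    by (intro two_functor_Cm F A.two_functor_path) simp
  fix c assume "c \<in> Ar (VTwo (tsrc (Cm (TwoCat \<kappa>) F (path_hor (tsrc F)))))"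
  then have c: "c \<in> Ar (VTwo (RR (Sq (tsrc F))))" by simp
  then show "tf2 (Cm (TwoCat \<kappa>) (path_hor (ttgt F)) (RR_fun (Sq_fun F))) c =
    tf2 (Cm (TwoCat \<kappa>) F (path_hor (tsrc F))) c"
  proof (rule A.path_cellE, goal_cases)
    case (1 p p' \<alpha>)
    note [simp] = A.path_pair_simps [OF 1(2)] A.path_pair_simps [OF 1(3)] 1(2-) F_simps A.cell_simps
    have m: "RR_pair_map (Sq_fun F) p \<in> pairs (Sq (ttgt F))"
        "RR_pair_map (Sq_fun F) p' \<in> pairs (Sq (ttgt F))"
      using Sq.RR_pair_map_mem [of p] Sq.RR_pair_map_mem [of p'] by simp_all
    have "tf2 (RR_fun (Sq_fun F)) c = path_cell (ttgt F) (RR_pair_map (Sq_fun F) p) (RR_pair_map (Sq_fun F) p') (tf2 F \<alpha>)"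
      unfolding 1(1) path_cell_def
      by (subst Sq.RR_fun_simps(5)) simp_all
    then show ?case
      using c 1(1) A.path_hor_cell [of p p' \<alpha>] B.path_hor_cell B.path_cell_mem [OF m]
      by (simp add: compose_def)
  qed
qed (simp_all add: compose_def F_simps Sq.RR_pair_map_mem [simplified] A.path_pair_simps)

end

section \<open>Straightening the horizontal sides of squares of companion pairs\<close>

context coded_two_category
begin

abbreviation SqP :: "'u dblcat" where
  "SqP \<equiv> Sq (RR (Sq A))"

definition path_boundary :: "'u \<Rightarrow> 'u \<Rightarrow> 'u \<Rightarrow> 'u \<Rightarrow> 'u \<Rightarrow> bool" where
  "path_boundary p p' q q' \<alpha> \<longleftrightarrow> p \<in> pairs (Sq A) \<and> p' \<in> pairs (Sq A) \<and>
    q \<in> pairs (Sq A) \<and> q' \<in> pairs (Sq A) \<and> \<alpha> \<in> Ar (VTwo A) \<and>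
    Dm (VTwo A) \<alpha> = Cm (One A) (pair_hor q') (pair_hor p) \<and>
    Cd (VTwo A) \<alpha> = Cm (One A) (pair_hor p') (pair_hor q) \<and>
    Dm (One A) (pair_hor q) = Dm (One A) (pair_hor p) \<and> Dm (One A) (pair_hor q') = Cd (One A) (pair_hor p) \<and>
    Cd (One A) (pair_hor q) = Dm (One A) (pair_hor p') \<and> Cd (One A) (pair_hor q') = Cd (One A) (pair_hor p')"

lemmas path_boundaryD = path_boundary_def [THEN iffD1]

lemma path_square_mem:
  "path_boundary p p' q q' \<alpha> \<Longrightarrow> path_square A p p' q q' \<alpha> \<in> Ar (HSq SqP)"
  by (simp add: path_boundary_def path_square_def path_cell_mem Sq.RR_comp_mem path_pair_simps)

lemma path_squareE:
  assumes "x \<in> Ar (HSq SqP)"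
  obtains p p' q q' \<alpha> where "x = path_square A p p' q q' \<alpha>" "path_boundary p p' q q' \<alpha>"
proof -
  obtain p p' q q' x' a b c d where x: "x = enc (p, p', q, q', x')"
    and m: "p \<in> pairs (Sq A)" "p' \<in> pairs (Sq A)"
      "q \<in> pairs (Sq A)" "q' \<in> pairs (Sq A)"
    and x': "x' \<in> Ar (VTwo (RR (Sq A)))" "Dm (VTwo (RR (Sq A))) x' = RR_comp (Sq A) q' p"
      "Cd (VTwo (RR (Sq A))) x' = RR_comp (Sq A) p' q"
    and d: "Dm (One A) (pair_hor p) = a" "Cd (One A) (pair_hor p) = b" "Dm (One A) (pair_hor p') = c"
      "Cd (One A) (pair_hor p') = d" "Dm (One A) (pair_hor q) = a" "Cd (One A) (pair_hor q) = c"
      "Dm (One A) (pair_hor q') = b" "Cd (One A) (pair_hor q') = d"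
    using assms by (rule Sq_cellE) simp
  from x'(1) show thesis
  proof (rule path_cellE, goal_cases)
    case (1 r r' \<alpha>)
    have r: "r = RR_comp (Sq A) q' p" "r' = RR_comp (Sq A) p' q"
      using x' 1(1) by simp_all
    show thesis
      by (rule that [of p p' q q' \<alpha>])
        (use 1 r x m d in \<open>simp_all add: path_square_def path_boundary_def\<close>)
  qed
qed

lemma path_square_boundary [simp]:
  "Dm (HSq SqP) (path_square A p p' q q' \<alpha>) = q"
  "Cd (HSq SqP) (path_square A p p' q q' \<alpha>) = q'"
  "Dm (VSq SqP) (path_square A p p' q q' \<alpha>) = p"
  "Cd (VSq SqP) (path_square A p p' q q' \<alpha>) = p'"
  by (simp_all add: path_square_def)

text \<open>The composite cell depends on \<open>p\<close> and \<open>r'\<close> only through their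
  horizontal parts. This is why straightening the horizontal sides is compatible with
  composition.\<close>

lemma path_square_HSq:
  assumes s: "path_boundary p p' q q' \<alpha>" and t: "path_boundary r r' q' q'' \<beta>"
  defines "\<gamma> \<equiv> Cm (VTwo A) (Cm (HTwo A) (Idt (VTwo A) (pair_hor r')) \<alpha>) (Cm (HTwo A) \<beta> (Idt (VTwo A) (pair_hor p)))"
  shows "Cm (HSq SqP) (path_square A r r' q' q'' \<beta>) (path_square A p p' q q' \<alpha>) =
      path_square A (RR_comp (Sq A) r p) (RR_comp (Sq A) r' p') q q'' \<gamma>"
    and "path_boundary (RR_comp (Sq A) r p) (RR_comp (Sq A) r' p') q q'' \<gamma>"
    and "Cd (One A) (pair_hor p) = Dm (One A) (pair_hor r)" "Cd (One A) (pair_hor p') = Dm (One A) (pair_hor r')"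
proof -
  show d: "Cd (One A) (pair_hor p) = Dm (One A) (pair_hor r)" "Cd (One A) (pair_hor p') = Dm (One A) (pair_hor r')"
    using path_boundaryD [OF s] path_boundaryD [OF t] by simp_all
  note [simp] = d path_boundaryD [OF s] path_boundaryD [OF t] path_pair_simps Sq.RR_comp_mem Sq.RR_comp_assoc cell_simps
  show "Cm (HSq SqP) (path_square A r r' q' q'' \<beta>) (path_square A p p' q q' \<alpha>) =
      path_square A (RR_comp (Sq A) r p) (RR_comp (Sq A) r' p') q q'' \<gamma>"
    by (simp add: \<gamma>_def path_square_def path_cell_Idt path_cell_HTwo path_cell_VTwo del: RR_simps(11))
  show "path_boundary (RR_comp (Sq A) r p) (RR_comp (Sq A) r' p') q q'' \<gamma>"
    by (simp add: path_boundary_def \<gamma>_def)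
qed

lemma path_square_VSq:
  assumes s: "path_boundary p p' q q' \<alpha>" and t: "path_boundary p' p'' r r' \<beta>"
  defines "\<gamma> \<equiv> Cm (VTwo A) (Cm (HTwo A) \<beta> (Idt (VTwo A) (pair_hor q))) (Cm (HTwo A) (Idt (VTwo A) (pair_hor r')) \<alpha>)"
  shows "Cm (VSq SqP) (path_square A p' p'' r r' \<beta>) (path_square A p p' q q' \<alpha>) =
      path_square A p p'' (RR_comp (Sq A) r q) (RR_comp (Sq A) r' q') \<gamma>"
    and "path_boundary p p'' (RR_comp (Sq A) r q) (RR_comp (Sq A) r' q') \<gamma>"
proof -
  note [simp] = path_boundaryD [OF s] path_boundaryD [OF t] path_pair_simps Sq.RR_comp_mem Sq.RR_comp_assoc cell_simps
  show "Cm (VSq SqP) (path_square A p' p'' r r' \<beta>) (path_square A p p' q q' \<alpha>) =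
      path_square A p p'' (RR_comp (Sq A) r q) (RR_comp (Sq A) r' q') \<gamma>"
    by (simp add: \<gamma>_def path_square_def path_cell_Idt path_cell_HTwo path_cell_VTwo del: RR_simps(11))
  show "path_boundary p p'' (RR_comp (Sq A) r q) (RR_comp (Sq A) r' q') \<gamma>"
    by (simp add: path_boundary_def \<gamma>_def)
qed

lemma path_boundary_Idt:
  "q \<in> pairs (Sq A) \<Longrightarrow> path_boundary (RR_id (Sq A) (Dm (One A) (pair_hor q)))
    (RR_id (Sq A) (Cd (One A) (pair_hor q))) q q (Idt (VTwo A) (pair_hor q))"
  "p \<in> pairs (Sq A) \<Longrightarrow> path_boundary p p (RR_id (Sq A) (Dm (One A) (pair_hor p)))
    (RR_id (Sq A) (Cd (One A) (pair_hor p))) (Idt (VTwo A) (pair_hor p))"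
  by (simp_all add: path_boundary_def Sq.RR_id_mem path_pair_simps cell_simps)

lemma path_boundary_straighten:
  "path_boundary p p' q q' \<alpha> \<Longrightarrow> path_boundary (Sq_pair A (pair_hor p)) (Sq_pair A (pair_hor p')) q q' \<alpha>"
  by (simp add: path_boundary_def Sq_pair_mem path_pair_simps)

lemma path_square_Idt:
  "q \<in> pairs (Sq A) \<Longrightarrow> Idt (HSq SqP) q =
    path_square A (RR_id (Sq A) (Dm (One A) (pair_hor q))) (RR_id (Sq A) (Cd (One A) (pair_hor q))) q q
      (Idt (VTwo A) (pair_hor q))"
  "p \<in> pairs (Sq A) \<Longrightarrow> Idt (VSq SqP) p =
    path_square A p p (RR_id (Sq A) (Dm (One A) (pair_hor p))) (RR_id (Sq A) (Cd (One A) (pair_hor p)))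
      (Idt (VTwo A) (pair_hor p))"
  by (simp_all add: path_square_def Sq.RR_comp_id path_cell_Idt del: RR_simps(11))

lemma straighten_simps [simp]:
  "dsrc (straighten A) = SqP" "dtgt (straighten A) = SqP"
  "x \<in> Ob (One A) \<Longrightarrow> dfo (straighten A) x = x"
  "p \<in> pairs (Sq A) \<Longrightarrow> dfh (straighten A) p = Sq_pair A (pair_hor p)"
  "p \<in> pairs (Sq A) \<Longrightarrow> dfv (straighten A) p = p"
  by (simp_all add: straighten_def)

lemma straighten_path_square:
  "path_boundary p p' q q' \<alpha> \<Longrightarrow> dfs (straighten A) (path_square A p p' q q' \<alpha>) =
    path_square A (Sq_pair A (pair_hor p)) (Sq_pair A (pair_hor p')) q q' \<alpha>"
  using path_square_mem [of p p' q q' \<alpha>]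
  unfolding straighten_def path_square_def path_cell_def by (simp del: enc_mem_Sq)

lemma double_functor_straighten: "double_functor (straighten A)"
proof -
  interpret R: two_category "RR (Sq A)" by (rule Sq.two_category_RR)
  interpret S: double_category "SqP" by (rule double_category_Sq [OF Sq.two_category_RR])
  note [simp] = path_pair_simps Sq_pair_mem Sq.RR_comp_mem Sq.RR_id_mem path_square_mem straighten_path_square
    path_boundaryD path_boundary_Idt path_boundary_straighten path_square_HSq path_square_VSq Sq_pair_Cm Sq_pair_Idt cell_simps
  have "is_functor (One (RR (Sq A))) (One (RR (Sq A))) (dfo (straighten A)) (dfh (straighten A))"
    by (intro is_functor_intros R.one.category_axioms) simp_all
  moreover have "is_functor (One (RR (Sq A))) (One (RR (Sq A))) (dfo (straighten A)) (dfv (straighten A))"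
    by (intro is_functor_intros R.one.category_axioms) simp_all
  moreover have "is_functor (HSq SqP) (HSq SqP) (dfv (straighten A)) (dfs (straighten A))"
  proof (intro is_functor_intros S.hsq.category_axioms, goal_cases)
    case (5 q)
    then show ?case by (simp add: path_square_Idt(1) del: Sq_simps(10))
  next
    case (6 s t)
    then show ?case by (auto elim!: path_squareE)
  qed (auto elim!: path_squareE)
  moreover have "is_functor (VSq SqP) (VSq SqP) (dfh (straighten A)) (dfs (straighten A))"
  proof (intro is_functor_intros S.vsq.category_axioms, goal_cases)
    case (5 p)
    then show ?case by (simp add: path_square_Idt(2) del: Sq_simps(11))
  next
    case (6 s t)
    then show ?case by (auto elim!: path_squareE)
  qed (auto elim!: path_squareE)
  ultimately show ?thesis
    unfolding double_functor_def
    by (simp add: S.double_category_axioms) (simp add: straighten_def)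
qed

lemma Sq_path_square:
  assumes "path_boundary p p' q q' \<alpha>"
  shows "dfs (Sq_fun (path_hor A)) (path_square A p p' q q' \<alpha>) =
      enc (pair_hor p, pair_hor p', pair_hor q, pair_hor q', \<alpha>)"
    and "dfs (Sq_fun (path_ver A)) (path_square A p p' q q' \<alpha>) =
      enc (pair_ver p, pair_ver p', pair_ver q, pair_ver q',
        Cm (VTwo A) (Cm (HTwo A) (pair_iso p') (pair_iso q))
          (Cm (VTwo A) \<alpha> (Cm (HTwo A) (pair_inv q') (pair_inv p))))"
  using path_square_mem [OF assms] unfolding path_square_def
  by (subst Sq_fun_simps; simp add: path_hor_cell path_ver_cell path_pair_comp)+

text \<open>Unflattening conjugates only along the vertical sides \<open>q\<close> and
  \<open>q'\<close>; the horizontal sides enter through identity 2-cells, unlike in the second part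
  of \<open>Sq_path_square\<close>.\<close>

lemma counit_path_square:
  assumes b: "path_boundary p p' q q' \<alpha>"
  shows "dfs (counit (Sq A)) (path_square A p p' q q' \<alpha>) =
      enc (pair_hor p, pair_hor p', pair_ver q, pair_ver q',
        Cm (VTwo A) (Cm (HTwo A) (Idt (VTwo A) (pair_hor p')) (pair_iso q))
          (Cm (VTwo A) \<alpha> (Cm (HTwo A) (pair_inv q') (Idt (VTwo A) (pair_hor p)))))"
proof -
  note [simp] = path_boundaryD [OF b] path_pair_simps cell_simps
  have "path_square A p p' q q' \<alpha> \<in> Ar (HSq SqP)"
    by (rule path_square_mem [OF b])
  then have "dfs (counit (Sq A)) (path_square A p p' q q' \<alpha>) =
      unflatten (Sq A) (pair_hor p) (pair_hor p') q q'
        (enc (Cm (One A) (pair_hor q') (pair_hor p), Cm (One A) (pair_hor p') (pair_hor q),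
          Idt (One A) (Dm (One A) (pair_hor p)), Idt (One A) (Cd (One A) (pair_hor p')), \<alpha>))"
    by (simp add: counit_def path_square_def path_cell_def del: enc_mem_Sq)
  then show ?thesis
    by (simp add: unflatten_def path_pair_enc)
qed

text \<open>On straightened horizontal sides the invertible 2-cells are identities, so the formula
  for \<open>path_ver\<close> turns into the one for the counit, while \<open>path_hor\<close>
  ignores these 2-cells altogether.\<close>

lemma straighten_path:
  "Cm (DblCat \<kappa>) (Sq_fun (path_hor A)) (straighten A) = Sq_fun (path_hor A)"
  "Cm (DblCat \<kappa>) (Sq_fun (path_ver A)) (straighten A) = counit (Sq A)"
proof -
  note [simp] = path_pair_simps Sq_pair_mem path_square_mem straighten_path_square path_boundaryD
    path_boundary_straighten cell_simps
  have D: "double_functor (Sq_fun (path_hor A))" "double_functor (Sq_fun (path_ver A))"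
    by (intro double_functor_Sq_fun two_functor_path)+
  show "Cm (DblCat \<kappa>) (Sq_fun (path_hor A)) (straighten A) = Sq_fun (path_hor A)"
  proof (rule double_functor_eqI)
    show "double_functor (Cm (DblCat \<kappa>) (Sq_fun (path_hor A)) (straighten A))"
      by (intro double_functor_Cm double_functor_straighten D) simp
    fix x assume "x \<in> Ar (HSq (dsrc (Sq_fun (path_hor A))))"
    then have x: "x \<in> Ar (HSq SqP)" by simp
    then show "dfs (Cm (DblCat \<kappa>) (Sq_fun (path_hor A)) (straighten A)) x = dfs (Sq_fun (path_hor A)) x"
      by (rule path_squareE) (use x in \<open>simp add: compose_def Sq_path_square\<close>)
  qed (simp_all add: D compose_def)
  show "Cm (DblCat \<kappa>) (Sq_fun (path_ver A)) (straighten A) = counit (Sq A)"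
  proof (rule double_functor_eqI)
    show "double_functor (Cm (DblCat \<kappa>) (Sq_fun (path_ver A)) (straighten A))"
      by (intro double_functor_Cm double_functor_straighten D) simp
    show "double_functor (counit (Sq A))" by (rule Sq.double_functor_counit)
    fix x assume "x \<in> Ar (HSq (dsrc (counit (Sq A))))"
    then have x: "x \<in> Ar (HSq SqP)" by simp
    then show "dfs (Cm (DblCat \<kappa>) (Sq_fun (path_ver A)) (straighten A)) x = dfs (counit (Sq A)) x"
      by (rule path_squareE) (use x in \<open>simp add: compose_def Sq_path_square counit_path_square\<close>)
  qed (simp_all add: compose_def)
qed

end

section \<open>The Quillen equivalences\<close>

text \<open>Isolates what the two model structures have in common: canonical trivial fibrations, and
  companions in fibrant objects. Each half of the theorem is an instance.\<close>

lemma Sq_quillen_equivalences: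
  fixes \<kappa> :: "'u rel"
  assumes \<kappa>: "universe \<kappa>" and M: "model_structure (DblCat \<kappa>) M"
    and triv: "Fib M \<inter> WE M = {F \<in> Ar (DblCat \<kappa>). canonical_trivial_fibration F}"
    and fibrant: "\<And>A. \<lbrakk>A \<in> Ob (DblCat \<kappa>); fibrant (DblCat \<kappa>) M A\<rbrakk> \<Longrightarrow>
      (\<forall>f\<in>Ar (Hor A). hor_has_companion A f) \<and> (\<forall>u\<in>Ar (Ver A). ver_has_companion A u)"
    and N: "is_TwoCat_transferred \<kappa> M N"
  shows "(\<forall>L_ob L_fun \<eta>. adjunction (DblCat \<kappa>) (TwoCat \<kappa>) L_ob L_fun Sq Sq_fun \<eta> \<longrightarrow>
      quillen_equivalence (DblCat \<kappa>) M (TwoCat \<kappa>) N L_ob L_fun Sq Sq_fun \<eta>) \<and>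
    quillen_equivalence (TwoCat \<kappa>) N (DblCat \<kappa>) M Sq Sq_fun RR RR_fun Sq_RR_unit"
proof -
  interpret adj: adjunction "TwoCat \<kappa>" "DblCat \<kappa>" Sq Sq_fun RR RR_fun Sq_RR_unit
    by (rule adjunction_Sq_RR [OF \<kappa>])
  interpret MC: model_structure "DblCat \<kappa>" M by (rule M)
  have counit_mem: "counit A \<in> Ar (DblCat \<kappa>)" if "A \<in> Ob (DblCat \<kappa>)" for A
    using adj.left.cod.homD [OF counit_hom [OF \<kappa> that]] by (rule conjunct1)
  have path_mem: "path_hor A \<in> hom (TwoCat \<kappa>) (RR (Sq A)) A \<and> path_ver A \<in> hom (TwoCat \<kappa>) (RR (Sq A)) A \<and>
    straighten A \<in> hom (DblCat \<kappa>) (Sq (RR (Sq A))) (Sq (RR (Sq A)))" if A: "A \<in> Ob (TwoCat \<kappa>)" for A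
  proof -
    interpret coded_two_category "TYPE('u)" A by (rule coded_two_categoryI [OF \<kappa> A])
    have "RR (Sq A) \<in> Ob (TwoCat \<kappa>)" "Sq (RR (Sq A)) \<in> Ob (DblCat \<kappa>)"
      using A adj.left.Fo_in adj.right.Fo_in by blast+
    then show ?thesis
      using A two_functor_path double_functor_straighten by (simp add: hom_def)
  qed
  interpret strictified_adjunction "TwoCat \<kappa>" "DblCat \<kappa>" Sq Sq_fun RR RR_fun Sq_RR_unit M N counit
    path_hor path_ver straighten
  \<comment> \<open>Goals 1 to 6 concern the transfer, \<open>RR\<close> and the counit; goals 7 to
    14 concern the path object.\<close>
  proof (unfold_locales, goal_cases)
    case 1
    show ?case using N by (simp add: is_TwoCat_transferred_def)
  next
    case (2 F)
    then have G: "F \<in> Ar (DblCat \<kappa>)" "canonical_trivial_fibration F" using triv by auto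
    interpret coded_double_functor "TYPE('u)" F by (rule coded_double_functorI [OF \<kappa> G(1)])
    show ?case
      using canonical_Sq_RR [OF G(2)] adj.left.Fa_in [OF adj.right.Fa_in [OF G(1)]] triv by simp
  next
    case (3 A)
    then show ?case by (rule counit_hom [OF \<kappa>])
  next
    case (4 A)
    then show ?case by (rule counit_triangle [OF \<kappa>])
  next
    case (5 A)
    then have A: "A \<in> Ob (DblCat \<kappa>)" by (simp add: fibrant_def)
    interpret coded_double_category "TYPE('u)" A by (rule coded_double_categoryI [OF \<kappa> A])
    show ?case
      using canonical_counit fibrant [OF A 5] counit_mem [OF A] triv by simp
  next
    case (6 A)
    interpret coded_two_category "TYPE('u)" A by (rule coded_two_categoryI [OF \<kappa> 6])
    show ?case
      using canonical_counit_Sq counit_mem [OF adj.left.Fo_in [OF 6]] triv by simp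
  next
    case (7 A) then show ?case using path_mem by blast
  next
    case (8 A) then show ?case using path_mem by blast
  next
    case (9 A)
    then show ?case by (rule coded_two_category.path_unit [OF coded_two_categoryI [OF \<kappa>]])
  next
    case (10 A)
    then show ?case by (rule coded_two_category.path_unit [OF coded_two_categoryI [OF \<kappa>]])
  next
    case (11 F A B)
    then have "F \<in> Ar (TwoCat \<kappa>)" "A = tsrc F" "B = ttgt F" by (auto simp: hom_def)
    then show ?case
      using coded_two_functor.path_hor_natural [OF coded_two_functorI [OF \<kappa>]] by simp
  next
    case (12 A) then show ?case using path_mem by blast
  next
    case (13 A)
    then show ?case by (rule coded_two_category.straighten_path [OF coded_two_categoryI [OF \<kappa>]])
  next
    case (14 A)
    then show ?case by (rule coded_two_category.straighten_path [OF coded_two_categoryI [OF \<kappa>]])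
  qed
  show ?thesis
    using left_quillen_equivalence S_quillen_equivalence by blast
qed

theorem proposition7p14:
  fixes \<kappa> :: "'u rel"
  assumes "universe \<kappa>"
  shows "(\<forall>M N. is_DblCat_tr_ladj \<kappa> M \<and> is_TwoCat_transferred \<kappa> M N \<longrightarrow>
            (\<forall>L_ob L_fun \<eta>. adjunction (DblCat \<kappa>) (TwoCat \<kappa>) L_ob L_fun Sq Sq_fun \<eta> \<longrightarrow>
              quillen_equivalence (DblCat \<kappa>) M (TwoCat \<kappa>) N L_ob L_fun Sq Sq_fun \<eta>) \<and>
            quillen_equivalence (TwoCat \<kappa>) N (DblCat \<kappa>) M Sq Sq_fun RR RR_fun Sq_RR_unit) \<and>
         (\<forall>M N. is_DblCat_tr_adj \<kappa> M \<and> is_TwoCat_transferred \<kappa> M N \<longrightarrow>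
            (\<forall>L_ob L_fun \<eta>. adjunction (DblCat \<kappa>) (TwoCat \<kappa>) L_ob L_fun Sq Sq_fun \<eta> \<longrightarrow>
              quillen_equivalence (DblCat \<kappa>) M (TwoCat \<kappa>) N L_ob L_fun Sq Sq_fun \<eta>) \<and>
            quillen_equivalence (TwoCat \<kappa>) N (DblCat \<kappa>) M Sq Sq_fun RR RR_fun Sq_RR_unit)"
proof ((rule conjI; intro allI impI; elim conjE), goal_cases)
  case (1 M N)
  show ?case
    by (rule Sq_quillen_equivalences [OF assms _ _ _ 1(2)])
      (use 1(1) [unfolded is_DblCat_tr_ladj_def] in blast)+
next
  case (2 M N)
  show ?case
    by (rule Sq_quillen_equivalences [OF assms _ _ _ 2(2)])
      (use 2(1) [unfolded is_DblCat_tr_adj_def] in blast)+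
qed

end
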